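(* There is an algorithm that, given a closed $\omega$-regular language $L$ and finitely many bounded automata defining partial bijections of $L$, decides whether the inverse semigroup $G$ that they generate has an infinite orbit, i.e. whether there exists $x\in L$ such that $x\cdot G=\{x\cdot g\mid g\in G,\ x\cdot g\text{ defined}\}$ is infinite.
   Context: A Büchi automaton over a finite alphabet $\Sigma$ is a finite directed graph with edges labelled in $\Sigma$, a set of initial vertices (states) and a set of residual states; it accepts the words in $\Sigma^\omega$ labelling a right-infinite path that starts at an initial state and visits residual states infinitely often. A language $L\subseteq\Sigma^\omega$ is $\omega$-regular if it is accepted by some Büchi automaton. Relations on $L$ are viewed as languages over $\Sigma\times\Sigma$ via $(x,y)\leftrightarrow(x_0,y_0)(x_1,y_1)\cdots$. A safety automaton is one in which all states are residual. Let $\mathscr A$ be a safety automaton over $\Sigma\times\Sigma$ accepting a relation contained in $L\times L$. A state $v$ of $\mathscr A$ is trivial if every right-infinite path starting at $v$ has a label of the form $(w,w)$. The automaton $\mathscr A$ is bounded if only finitely many right-infinite paths starting at an initial state never visit a trivial state. It defines a partial bijection if the accepted relation is the graph of an injective partial map $L\dashrightarrow L$. The inverse semigroup generated by partial bijections is the smallest set of partial bijections of $L$ containing them and closed under composition and inversion. *)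

theory Defs
  imports "HOL-Analysis.Function_Topology" "HOL-Library.Nat_Bijection"
begin

text \<open>
  Infinite words are functions \<^typ>\<open>nat \<Rightarrow> 'a\<close>. An edge is a triple (source, label, target).
\<close>

record ('q, 'a) buchi =
  states :: "'q set"
  edges :: "('q \<times> 'a \<times> 'q) set"
  initial :: "'q set"
  residual :: "'q set"

abbreviation source :: "'q \<times> 'a \<times> 'q \<Rightarrow> 'q" where "source e \<equiv> fst e"
abbreviation label :: "'q \<times> 'a \<times> 'q \<Rightarrow> 'a" where "label e \<equiv> fst (snd e)"
abbreviation target :: "'q \<times> 'a \<times> 'q \<Rightarrow> 'q" where "target e \<equiv> snd (snd e)"

definition buchi_automaton :: "'a set \<Rightarrow> ('q, 'a) buchi \<Rightarrow> bool" where
  "buchi_automaton \<Sigma> A \<longleftrightarrow>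
     finite \<Sigma> \<and> finite (states A) \<and> edges A \<subseteq> states A \<times> \<Sigma> \<times> states A \<and>
     initial A \<subseteq> states A \<and> residual A \<subseteq> states A"

definition safety_automaton :: "'a set \<Rightarrow> ('q, 'a) buchi \<Rightarrow> bool" where
  "safety_automaton \<Sigma> A \<longleftrightarrow> buchi_automaton \<Sigma> A \<and> residual A = states A"

definition infinite_path :: "('q, 'a) buchi \<Rightarrow> 'q \<Rightarrow> (nat \<Rightarrow> 'q \<times> 'a \<times> 'q) \<Rightarrow> bool" where
  "infinite_path A v p \<longleftrightarrow>
     source (p 0) = v \<and> (\<forall>i. p i \<in> edges A \<and> target (p i) = source (p (Suc i)))"

definition language :: "('q, 'a) buchi \<Rightarrow> (nat \<Rightarrow> 'a) set" where
  "language A = {w. \<exists>v \<in> initial A. \<exists>p. infinite_path A v p \<and>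
     (\<exists>\<^sub>\<infinity>i. source (p i) \<in> residual A) \<and> (\<forall>i. label (p i) = w i)}"

definition accepted_relation ::
    "('q, 'a \<times> 'a) buchi \<Rightarrow> ((nat \<Rightarrow> 'a) \<times> (nat \<Rightarrow> 'a)) set" where
  "accepted_relation A = {(x, y). (\<lambda>i. (x i, y i)) \<in> language A}"

definition trivial_state :: "('q, 'a \<times> 'a) buchi \<Rightarrow> 'q \<Rightarrow> bool" where
  "trivial_state A v \<longleftrightarrow> (\<forall>p. infinite_path A v p \<longrightarrow> (\<exists>w. \<forall>i. label (p i) = (w i, w i)))"

definition bounded_automaton :: "('q, 'a \<times> 'a) buchi \<Rightarrow> bool" where
  "bounded_automaton A \<longleftrightarrow>
     finite {p. \<exists>v \<in> initial A. infinite_path A v p \<and> (\<forall>i. \<not> trivial_state A (source (p i)))}"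

text \<open>
  Partial maps are represented by their graphs. They act on the right, so the product of
  \<open>g\<close> and \<open>h\<close> is \<open>g O h\<close>, which applies \<open>g\<close> first.
\<close>

definition partial_bijection :: "'x set \<Rightarrow> ('x \<times> 'x) set \<Rightarrow> bool" where
  "partial_bijection L g \<longleftrightarrow>
     g \<subseteq> L \<times> L \<and> (\<exists>f :: 'x \<rightharpoonup> 'x. inj_on f (dom f) \<and> g = Map.graph f)"

inductive_set inverse_semigroup :: "('x \<times> 'x) set set \<Rightarrow> ('x \<times> 'x) set set"
  for S :: "('x \<times> 'x) set set" where
  generator: "g \<in> S \<Longrightarrow> g \<in> inverse_semigroup S"
| composition: "\<lbrakk>g \<in> inverse_semigroup S; h \<in> inverse_semigroup S\<rbrakk> \<Longrightarrow> g O h \<in> inverse_semigroup S"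
| inversion: "g \<in> inverse_semigroup S \<Longrightarrow> g\<inverse> \<in> inverse_semigroup S"

lemma partial_bijection_iff:
  "partial_bijection L g \<longleftrightarrow> g \<subseteq> L \<times> L \<and> single_valued g \<and> single_valued (g\<inverse>)"
proof
  assume "partial_bijection L g"
  then obtain f where g: "g \<subseteq> L \<times> L" "inj_on f (dom f)" "g = Map.graph f"
    by (auto simp: partial_bijection_def)
  have "x = x'" if "f x = Some y" "f x' = Some y" for x x' y
    using that g(2) by (metis domI inj_onD)
  then show "g \<subseteq> L \<times> L \<and> single_valued g \<and> single_valued (g\<inverse>)"
    using g(1) unfolding g(3) by (simp add: single_valued_def Map.graph_def)
next
  assume *: "g \<subseteq> L \<times> L \<and> single_valued g \<and> single_valued (g\<inverse>)"
  define f where "f x = (if \<exists>y. (x, y) \<in> g then Some (THE y. (x, y) \<in> g) else None)" for x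
  have f: "f x = Some y \<longleftrightarrow> (x, y) \<in> g" for x y
  proof -
    have "(THE y. (x, y) \<in> g) = z" if "(x, z) \<in> g" for z
      using that * by (auto simp: single_valued_def)
    then show ?thesis by (auto simp: f_def)
  qed
  have "inj_on f (dom f)"
    using * f unfolding inj_on_def single_valued_def dom_def by (smt (verit) converse_iff mem_Collect_eq not_None_eq)
  moreover have "g = Map.graph f"
    using f by (auto simp: Map.graph_def)
  ultimately show "partial_bijection L g"
    using * by (auto simp: partial_bijection_def)
qed

text \<open>
  Partial bijections of \<open>L\<close> are closed under composition and inversion, so the inductive set
  above is indeed the smallest such set of partial bijections.
\<close>

lemma inverse_semigroup_partial_bijection:
  assumes "g \<in> inverse_semigroup S" and "\<And>s. s \<in> S \<Longrightarrow> partial_bijection L s"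
  shows "partial_bijection L g"
  using assms
proof (induction)
  case (composition g h)
  then have "partial_bijection L g" "partial_bijection L h" by blast+
  then show ?case unfolding partial_bijection_iff
    by (simp add: converse_relcomp single_valued_relcomp) blast
qed (auto simp: partial_bijection_iff)

definition orbit :: "('x \<times> 'x) set set \<Rightarrow> 'x \<Rightarrow> 'x set" where
  "orbit G x = {y. \<exists>g \<in> G. (x, y) \<in> g}"

datatype recf =
    Zero
  | Succ
  | Proj nat
  | Comp recf "recf list"
  | PrimRec recf recf
  | Mu recf

text \<open>
  \<open>evals f xs y\<close> means that \<open>f\<close> halts on the arguments \<open>xs\<close> with value \<open>y\<close>.
  The recursion argument of \<open>PrimRec\<close> and the search argument of \<open>Mu\<close> come first.
\<close>

inductive evals :: "recf \<Rightarrow> nat list \<Rightarrow> nat \<Rightarrow> bool" where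
  Zero: "evals Zero xs 0"
| Succ: "evals Succ [x] (Suc x)"
| Proj: "i < length xs \<Longrightarrow> evals (Proj i) xs (xs ! i)"
| Comp: "\<lbrakk>list_all2 (\<lambda>g y. evals g xs y) gs ys; evals f ys z\<rbrakk> \<Longrightarrow> evals (Comp f gs) xs z"
| PrimRec_0: "evals f xs z \<Longrightarrow> evals (PrimRec f g) (0 # xs) z"
| PrimRec_Suc: "\<lbrakk>evals (PrimRec f g) (n # xs) r; evals g (n # r # xs) z\<rbrakk>
    \<Longrightarrow> evals (PrimRec f g) (Suc n # xs) z"
| Mu: "\<lbrakk>evals f (n # xs) 0; \<And>m. m < n \<Longrightarrow> \<exists>y > 0. evals f (m # xs) y\<rbrakk> \<Longrightarrow> evals (Mu f) xs n"

inductive_cases evals_elims: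
  "evals Zero xs y" "evals Succ xs y" "evals (Proj i) xs y" "evals (Comp f gs) xs y"
  "evals (PrimRec f g) (0 # xs) y" "evals (PrimRec f g) (Suc n # xs) y" "evals (Mu f) xs y"

lemma evals_deterministic: "evals f xs y \<Longrightarrow> evals f xs z \<Longrightarrow> y = z"
proof (induction arbitrary: z rule: evals.induct)
  case (Comp xs gs ys f w)
  from Comp.prems obtain ys' where
    ys': "list_all2 (\<lambda>g y. evals g xs y) gs ys'" and z: "evals f ys' z"
    by (rule evals_elims(4))
  have "ys = ys'"
    using Comp.IH(1) ys' unfolding list_all2_conv_all_nth by (metis nth_equalityI)
  then show ?case using z Comp.IH(2) by simp
next
  case (PrimRec_0 f xs w g)
  from PrimRec_0.prems have "evals f xs z" by (rule evals_elims(5))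
  then show ?case by (rule PrimRec_0.IH)
next
  case (PrimRec_Suc f g n xs r w)
  from PrimRec_Suc.prems obtain r' where "evals (PrimRec f g) (n # xs) r'" "evals g (n # r' # xs) z"
    by (rule evals_elims(6))
  then show ?case using PrimRec_Suc.IH by blast
next
  case (Mu f n xs)
  from Mu.prems have z: "evals f (z # xs) 0" "\<And>m. m < z \<Longrightarrow> \<exists>y > 0. evals f (m # xs) y"
    using evals_elims(7) by metis+
  show ?case
  proof (cases n z rule: linorder_cases)
    case less
    then show ?thesis using z(2) Mu.IH(1) by (metis less_irrefl)
  next
    case greater
    then show ?thesis using z(1) Mu.IH(2) by (metis less_irrefl)
  qed
qed (blast elim: evals_elims)+

text \<open>
  An input consists of the size \<open>k\<close> of the alphabet \<open>{..<k}\<close>, an automaton over this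
  alphabet, and finitely many automata over \<open>{..<k} \<times> {..<k}\<close>; states are natural numbers.
\<close>

definition edge_code :: "('a \<Rightarrow> nat) \<Rightarrow> nat \<times> 'a \<times> nat \<Rightarrow> nat" where
  "edge_code c e = prod_encode (source e, prod_encode (c (label e), target e))"

definition automaton_code :: "('a \<Rightarrow> nat) \<Rightarrow> (nat, 'a) buchi \<Rightarrow> nat" where
  "automaton_code c A = list_encode
     [set_encode (states A), set_encode (edge_code c ` edges A),
      set_encode (initial A), set_encode (residual A)]"

definition input_code ::
    "nat \<Rightarrow> (nat, nat) buchi \<Rightarrow> (nat, nat \<times> nat) buchi list \<Rightarrow> nat" where
  "input_code k A Bs =
     list_encode (k # automaton_code id A # map (automaton_code prod_encode) Bs)"

text \<open>
  \<open>closed\<close> below refers to the product topology on \<^typ>\<open>nat \<Rightarrow> nat\<close> with \<^typ>\<open>nat\<close> discrete,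
  whose subspace topology on the words over \<open>{..<k}\<close> (a closed subset) is the usual one.
\<close>

definition valid_input ::
    "nat \<Rightarrow> (nat, nat) buchi \<Rightarrow> (nat, nat \<times> nat) buchi list \<Rightarrow> bool" where
  "valid_input k A Bs \<longleftrightarrow>
     buchi_automaton {..<k} A \<and> closed (language A) \<and>
     (\<forall>B \<in> set Bs. safety_automaton ({..<k} \<times> {..<k}) B \<and> bounded_automaton B \<and>
        partial_bijection (language A) (accepted_relation B))"

end

theory Submission imports Defs begin

text \<open>
  Only the automata defining the generators matter. Apart from finitely many pairs, two words related
  by a bounded automaton are joined by a path that ends in trivial states, so they have a common tail;
  finitely many extra pairs cannot make an orbit infinite. On the words of length \<open>n\<close> the remaining
  pairs form a finite graph, depending on the set \<open>T\<close> of trivial states that accept the tail. Passing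
  from length \<open>n\<close> to \<open>n + 1\<close> puts together copies of the old components (one for every new letter) and
  joins some of them, but only at ``special'' words, the labels of paths that have not yet become
  trivial. Boundedness means that the number of special words of length \<open>n\<close> is bounded, so up to
  isomorphism only finitely many structures (special words, paths, connectedness) occur, and an
  isomorphism between the structures of lengths \<open>n < m\<close> lifts to all later lengths. Hence one of two
  finite certificates exists: an isomorphism under which component sizes do not increase, and then all
  orbits are finite; or an isomorphism and a word \<open>v\<close> such that the component of \<open>v @ u\<close> is that of
  \<open>\<phi> u\<close> and properly contains the copy of the component of \<open>u\<close>, and then the word that repeats \<open>v\<close>
  forever has an infinite orbit. Searching for both certificates in parallel decides the question.
\<close>

section \<open>Computable functions and semidecidable predicates\<close>

text \<open>The certificates are sound for every set \<open>D\<close> that is closed under edges and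
  carries only diagonal labels. Triviality and boundedness, which speak of infinite paths, enter
  where a certificate is shown to exist, so no bound is ever computed.

  Existence rests on two pigeonholes. Call a letter of a finite word a growth if reading it makes
  the component more than a copy of the previous one. If a word has more growths than there are
  triples (configuration, tail set, name of a special word), two growths agree, and the factor
  between them is the \<open>v\<close> that can be repeated. Otherwise component sizes are bounded,
  since a growth splits a component into boundedly many pieces with fewer growths; then
  configurations repeat together with their sizes.

  The parameter \<open>T\<close> cannot be fixed once and for all: moving a factor \<open>w\<close>
  from the prefix to the tail replaces \<open>T\<close> by \<open>pullback w T\<close>. Hence
  isomorphisms must respect connectedness for all \<open>T\<close> at once, and the repeated word
  \<open>v\<close> must fix its \<open>T\<close>.\<close>

definition rec_fn :: "nat \<Rightarrow> (nat list \<Rightarrow> nat) \<Rightarrow> bool" where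
  "rec_fn n f \<longleftrightarrow> (\<exists>r. \<forall>xs. length xs = n \<longrightarrow> evals r xs (f xs))"

lemma rec_fn_cong: "(\<And>xs. length xs = n \<Longrightarrow> f xs = g xs) \<Longrightarrow> rec_fn n f \<longleftrightarrow> rec_fn n g"
  by (simp add: rec_fn_def)

lemma rec_fn_proj: "i < n \<Longrightarrow> rec_fn n (\<lambda>xs. xs ! i)"
  unfolding rec_fn_def by (auto intro!: exI[of _ "Proj i"] evals.Proj)

lemma rec_fn_comp:
  assumes f: "rec_fn (length gs) f" and gs: "\<And>g. g \<in> set gs \<Longrightarrow> rec_fn n g"
  shows "rec_fn n (\<lambda>xs. f (map (\<lambda>g. g xs) gs))"
proof -
  obtain \<rho> where \<rho>: "\<And>g xs. g \<in> set gs \<Longrightarrow> length xs = n \<Longrightarrow> evals (\<rho> g) xs (g xs)"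
    using gs unfolding rec_fn_def by metis
  obtain r where r: "\<And>ys. length ys = length gs \<Longrightarrow> evals r ys (f ys)" using f unfolding rec_fn_def by blast
  have "evals (Comp r (map \<rho> gs)) xs (f (map (\<lambda>g. g xs) gs))" if "length xs = n" for xs
    by (rule evals.Comp[of _ _ "map (\<lambda>g. g xs) gs"])
       (use \<rho> that r in \<open>auto simp: list_all2_conv_all_nth\<close>)
  then show ?thesis unfolding rec_fn_def by blast
qed

lemma rec_fn_comp1: "rec_fn 1 (\<lambda>xs. f (xs ! 0)) \<Longrightarrow> rec_fn n g \<Longrightarrow> rec_fn n (\<lambda>xs. f (g xs))"
  using rec_fn_comp[of "[g]" "\<lambda>xs. f (xs ! 0)" n] by simp

lemma rec_fn_comp2:
  "rec_fn 2 (\<lambda>xs. f (xs ! 0) (xs ! 1)) \<Longrightarrow> rec_fn n g \<Longrightarrow> rec_fn n h \<Longrightarrow> rec_fn n (\<lambda>xs. f (g xs) (h xs))"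
  using rec_fn_comp[of "[g, h]" "\<lambda>xs. f (xs ! 0) (xs ! 1)" n] by (auto simp: numeral_2_eq_2)

lemma rec_fn_Suc: "rec_fn n f \<Longrightarrow> rec_fn n (\<lambda>xs. Suc (f xs))"
proof (rule rec_fn_comp1[of Suc])
  have "evals Succ xs (Suc (xs ! 0))" if "length xs = 1" for xs :: "nat list"
    using that by (cases xs) (auto intro: evals.Succ)
  then show "rec_fn 1 (\<lambda>xs. Suc (xs ! 0))" unfolding rec_fn_def by blast
qed

lemma rec_fn_const: "rec_fn n (\<lambda>xs. c)"
proof (induction c)
  case 0
  show ?case unfolding rec_fn_def using evals.Zero by blast
qed (rule rec_fn_Suc)

lemma rec_fn_primrec:
  assumes "rec_fn n g" "rec_fn (Suc (Suc n)) h"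
    and F0: "\<And>xs. length xs = n \<Longrightarrow> F (0 # xs) = g xs"
    and FS: "\<And>k xs. length xs = n \<Longrightarrow> F (Suc k # xs) = h (k # F (k # xs) # xs)"
  shows "rec_fn (Suc n) F"
proof -
  obtain r s where r: "\<And>xs. length xs = n \<Longrightarrow> evals r xs (g xs)"
    and s: "\<And>xs. length xs = Suc (Suc n) \<Longrightarrow> evals s xs (h xs)"
    using assms unfolding rec_fn_def by blast
  have "evals (PrimRec r s) (k # xs) (F (k # xs))" if "length xs = n" for k xs
  proof (induction k)
    case 0
    then show ?case using evals.PrimRec_0 r F0 that by metis
  next
    case (Suc k)
    show ?case unfolding FS[OF that] by (rule evals.PrimRec_Suc[OF Suc]) (use s that in simp)
  qed
  then show ?thesis unfolding rec_fn_def by (metis length_Suc_conv)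
qed

lemma rec_fn_plus: "rec_fn n f \<Longrightarrow> rec_fn n g \<Longrightarrow> rec_fn n (\<lambda>xs. f xs + g xs)"
proof (rule rec_fn_comp2[of "(+)"])
  show "rec_fn 2 (\<lambda>xs. xs ! 0 + xs ! 1)"
    unfolding numeral_2_eq_2
    by (rule rec_fn_primrec[where g = "\<lambda>xs. xs ! 0" and h = "\<lambda>xs. Suc (xs ! 1)"])
       (auto intro!: rec_fn_proj rec_fn_Suc)
qed

lemma rec_fn_pred: "rec_fn n f \<Longrightarrow> rec_fn n (\<lambda>xs. f xs - Suc 0)"
proof (rule rec_fn_comp1[of "\<lambda>x. x - Suc 0"])
  show "rec_fn 1 (\<lambda>xs. xs ! 0 - Suc 0)"
    unfolding One_nat_def
    by (rule rec_fn_primrec[where g = "\<lambda>xs. 0" and h = "\<lambda>xs. xs ! 0"]) (auto intro!: rec_fn_proj rec_fn_const)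
qed

lemma rec_fn_minus: "rec_fn n f \<Longrightarrow> rec_fn n g \<Longrightarrow> rec_fn n (\<lambda>xs. f xs - g xs)"
proof (rule rec_fn_comp2[of "\<lambda>x y. y - x"])
  show "rec_fn 2 (\<lambda>xs. xs ! 1 - xs ! 0)"
    unfolding numeral_2_eq_2
    by (rule rec_fn_primrec[where g = "\<lambda>xs. xs ! 0" and h = "\<lambda>xs. xs ! 1 - Suc 0"])
       (auto intro!: rec_fn_proj rec_fn_pred)
qed

lemma rec_fn_triangle: "rec_fn n f \<Longrightarrow> rec_fn n (\<lambda>xs. triangle (f xs))"
proof (rule rec_fn_comp1[of triangle])
  show "rec_fn 1 (\<lambda>xs. triangle (xs ! 0))"
    unfolding One_nat_def
    by (rule rec_fn_primrec[where g = "\<lambda>xs. 0" and h = "\<lambda>xs. xs ! 1 + Suc (xs ! 0)"])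
       (auto intro!: rec_fn_proj rec_fn_const rec_fn_plus rec_fn_Suc)
qed

lemma rec_fn_prod_encode: "rec_fn n f \<Longrightarrow> rec_fn n g \<Longrightarrow> rec_fn n (\<lambda>xs. prod_encode (f xs, g xs))"
  unfolding prod_encode_def by (auto intro!: rec_fn_plus rec_fn_triangle)

text \<open>The index of the diagonal on which \<open>z\<close> lies in the enumeration by \<^const>\<open>prod_encode\<close>.\<close>

primrec diagonal :: "nat \<Rightarrow> nat" where
  "diagonal 0 = 0"
| "diagonal (Suc z) = diagonal z + (1 - (triangle (Suc (diagonal z)) - Suc z))"

text \<open>In the recursion the truncated difference
  \<open>1 - (triangle (Suc (diagonal z)) - Suc z)\<close> is 1 exactly when \<open>Suc z\<close>
  has reached the next triangular number.\<close>

lemma diagonal_bounds: "triangle (diagonal z) \<le> z \<and> z < triangle (Suc (diagonal z))"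
proof (induction z)
  case (Suc z)
  then show ?case by (cases "triangle (Suc (diagonal z)) \<le> Suc z") auto
qed simp

lemma triangle_mono: "m \<le> n \<Longrightarrow> triangle m \<le> triangle n"
  by (induction n rule: dec_induct) auto

lemma diagonal_prod_encode: "diagonal (prod_encode (m, n)) = m + n"
proof -
  let ?z = "prod_encode (m, n)"
  have "triangle (m + n) \<le> ?z" "?z < triangle (Suc (m + n))" by (auto simp: prod_encode_def)
  then have "\<not> Suc (diagonal ?z) \<le> m + n" "\<not> Suc (m + n) \<le> diagonal ?z"
    using diagonal_bounds[of ?z] triangle_mono by (meson le_trans not_le)+
  then show ?thesis by simp
qed

text \<open>Since \<open>prod_encode (m, n) = triangle (m + n) + m\<close>, the diagonal
  \<open>m + n\<close> yields both components by subtraction. This makes decoding primitive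
  recursive.\<close>

lemma prod_decode_diagonal:
  "prod_decode z = (z - triangle (diagonal z), diagonal z - (z - triangle (diagonal z)))"
proof -
  obtain m n where z: "z = prod_encode (m, n)" by (metis prod_decode_inverse surj_pair)
  have "z - triangle (m + n) = m" by (simp add: z prod_encode_def)
  then show ?thesis using diagonal_prod_encode[of m n] by (simp add: z[symmetric]) (simp add: z)
qed

lemma rec_fn_diagonal: "rec_fn n f \<Longrightarrow> rec_fn n (\<lambda>xs. diagonal (f xs))"
proof (rule rec_fn_comp1[of diagonal])
  show "rec_fn 1 (\<lambda>xs. diagonal (xs ! 0))"
    unfolding One_nat_def
    by (rule rec_fn_primrec[where g = "\<lambda>xs. 0"
          and h = "\<lambda>xs. xs ! 1 + (1 - (triangle (Suc (xs ! 1)) - Suc (xs ! 0)))"])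
       (auto intro!: rec_fn_proj rec_fn_const rec_fn_plus rec_fn_minus rec_fn_triangle rec_fn_Suc simp del: triangle_Suc)
qed

section \<open>Types with bijective codes\<close>

text \<open>A bijection rather than an injection: every number is a code, so an unbounded search may
  decode whatever number it meets without testing it.\<close>

class coded =
  fixes encode :: "'a \<Rightarrow> nat"
  assumes bij_encode: "bij encode"
begin

definition decode :: "nat \<Rightarrow> 'a" where "decode = inv encode"

lemma decode_encode [simp]: "decode (encode x) = x"
  unfolding decode_def using bij_encode by (simp add: bij_is_inj)

lemma encode_decode [simp]: "encode (decode n) = n"
  unfolding decode_def using bij_encode by (simp add: bij_is_surj surj_f_inv_f)

lemma encode_eq_iff [simp]: "encode x = encode y \<longleftrightarrow> x = y"
  by (metis decode_encode)

end

instantiation nat :: coded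
begin
definition encode_nat :: "nat \<Rightarrow> nat" where [simp]: "encode_nat n = n"
instance by standard (simp add: encode_nat_def[abs_def] bij_def)
end

instantiation prod :: (coded, coded) coded
begin
definition encode_prod :: "'a \<times> 'b \<Rightarrow> nat" where
  "encode_prod p = prod_encode (encode (fst p), encode (snd p))"
instance
proof
  have "encode p = encode q \<Longrightarrow> p = q" for p q :: "'a \<times> 'b"
    by (simp add: encode_prod_def prod_eq_iff)
  moreover have "encode (decode (fst (prod_decode n)) :: 'a, decode (snd (prod_decode n)) :: 'b) = n" for n
    by (simp add: encode_prod_def)
  ultimately show "bij (encode :: 'a \<times> 'b \<Rightarrow> nat)"
    by (intro bijI injI surjI[of _ "\<lambda>n. (decode (fst (prod_decode n)), decode (snd (prod_decode n)))"]) blast+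
qed
end

instantiation list :: (coded) coded
begin
definition encode_list :: "'a list \<Rightarrow> nat" where
  "encode_list xs = list_encode (map encode xs)"
instance
proof
  have "map decode (map encode xs) = xs" for xs :: "'a list" by (simp add: map_idI)
  then have "encode p = encode q \<Longrightarrow> p = q" for p q :: "'a list"
    unfolding encode_list_def list_encode_eq by metis
  moreover have "encode (map decode (list_decode n) :: 'a list) = n" for n
    by (simp add: encode_list_def comp_def)
  ultimately show "bij (encode :: 'a list \<Rightarrow> nat)"
    by (intro bijI injI surjI[of _ "\<lambda>n. map decode (list_decode n)"]) blast+
qed
end

lemma encode_Nil: "encode [] = 0" and encode_Cons: "encode (x # xs) = Suc (encode (x, xs))"
  by (auto simp: encode_list_def encode_prod_def)

lemma decode_nat [simp]: "decode n = n" for n :: nat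
  by (metis encode_decode encode_nat_def)

section \<open>Computability over coded types\<close>

definition computable :: "('a::coded \<Rightarrow> 'b::coded) \<Rightarrow> bool" where
  "computable f \<longleftrightarrow> (\<exists>r. \<forall>x. evals r [encode x] (encode (f x)))"

definition decidable :: "('a::coded \<Rightarrow> bool) \<Rightarrow> bool" where
  "decidable P \<longleftrightarrow> computable (\<lambda>x. of_bool (P x) :: nat)"

definition semidec :: "('a::coded \<Rightarrow> bool) \<Rightarrow> bool" where
  "semidec P \<longleftrightarrow> (\<exists>Q. decidable Q \<and> (\<forall>x. P x \<longleftrightarrow> (\<exists>n :: nat. Q (x, n))))"

named_theorems comp_rules

lemma computable_if_rec_fn: "rec_fn 1 g \<Longrightarrow> (\<And>x. encode (f x) = g [encode x]) \<Longrightarrow> computable f"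
proof -
  assume "rec_fn 1 g" and g: "\<And>x. encode (f x) = g [encode x]"
  then obtain r where "\<And>xs. length xs = 1 \<Longrightarrow> evals r xs (g xs)" unfolding rec_fn_def by blast
  then have "evals r [encode x] (encode (f x))" for x by (simp add: g)
  then show "computable f" unfolding computable_def by blast
qed

lemma rec_fn_encode: "computable f \<Longrightarrow> rec_fn n g \<Longrightarrow> rec_fn n (\<lambda>xs. encode (f (decode (g xs))))"
proof (rule rec_fn_comp1[of "\<lambda>x. encode (f (decode x))"])
  assume "computable f"
  then obtain r where r: "\<And>x. evals r [encode x] (encode (f x))" unfolding computable_def by blast
  have "evals r xs (encode (f (decode (xs ! 0))))" if "length xs = 1" for xs
    using r[of "decode (xs ! 0)"] that by (cases xs) auto
  then show "rec_fn 1 (\<lambda>xs. encode (f (decode (xs ! 0))))" unfolding rec_fn_def by blast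
qed

lemma computable_id [comp_rules]: "computable (\<lambda>x. x)"
  by (rule computable_if_rec_fn[OF rec_fn_proj[of 0]]) auto

lemma computable_const [comp_rules]: "computable (\<lambda>x. c)"
  by (rule computable_if_rec_fn[OF rec_fn_const[of _ "encode c"]]) auto

lemma computable_comp: "computable f \<Longrightarrow> computable g \<Longrightarrow> computable (\<lambda>x. f (g x))"
  by (rule computable_if_rec_fn[OF rec_fn_encode[of f, OF _ rec_fn_encode[of g, OF _ rec_fn_proj[of 0]]]]) auto

lemma computable_pair [comp_rules]: "computable f \<Longrightarrow> computable g \<Longrightarrow> computable (\<lambda>x. (f x, g x))"
  by (rule computable_if_rec_fn[OF rec_fn_prod_encode[OF rec_fn_encode[of f, OF _ rec_fn_proj[of 0]] rec_fn_encode[of g, OF _ rec_fn_proj[of 0]]]])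
     (auto simp: encode_prod_def)

lemma prod_decode_encode: "prod_decode (encode p) = (encode (fst p), encode (snd p))"
  by (simp add: encode_prod_def)

lemma computable_fst_fun: "computable (fst :: 'a::coded \<times> 'b::coded \<Rightarrow> 'a)"
proof (rule computable_if_rec_fn)
  show "rec_fn 1 (\<lambda>xs. xs ! 0 - triangle (diagonal (xs ! 0)))"
    by (intro rec_fn_minus rec_fn_triangle rec_fn_diagonal rec_fn_proj) auto
  show "encode (fst p) = [encode p] ! 0 - triangle (diagonal ([encode p] ! 0))" for p :: "'a \<times> 'b"
    using prod_decode_encode[of p] by (simp add: prod_decode_diagonal)
qed

lemma computable_fst [comp_rules]: "computable f \<Longrightarrow> computable (\<lambda>x. fst (f x))"
  by (rule computable_comp[OF computable_fst_fun])

lemma computable_snd_fun: "computable (snd :: 'a::coded \<times> 'b::coded \<Rightarrow> 'b)"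
proof (rule computable_if_rec_fn)
  show "rec_fn 1 (\<lambda>xs. diagonal (xs ! 0) - (xs ! 0 - triangle (diagonal (xs ! 0))))"
    by (intro rec_fn_minus rec_fn_triangle rec_fn_diagonal rec_fn_proj) auto
  show "encode (snd p) = diagonal ([encode p] ! 0) - ([encode p] ! 0 - triangle (diagonal ([encode p] ! 0)))"
    for p :: "'a \<times> 'b"
  proof -
    have "snd (prod_decode (encode p)) = encode (snd p)" by (simp add: prod_decode_encode)
    then show ?thesis by (simp add: prod_decode_diagonal)
  qed
qed

lemma computable_snd [comp_rules]: "computable f \<Longrightarrow> computable (\<lambda>x. snd (f x))"
  by (rule computable_comp[OF computable_snd_fun])

lemma computable_encode [comp_rules]: "computable f \<Longrightarrow> computable (\<lambda>x. encode (f x))"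
  by (rule computable_comp[of encode]) (auto intro!: computable_if_rec_fn[OF rec_fn_proj[of 0]])

lemma computable_decode [comp_rules]: "computable f \<Longrightarrow> computable (\<lambda>x. decode (f x))"
  by (rule computable_comp[of decode]) (auto intro!: computable_if_rec_fn[OF rec_fn_proj[of 0]])

lemma computable_Suc [comp_rules]: "computable f \<Longrightarrow> computable (\<lambda>x. Suc (f x))"
  by (rule computable_comp[of Suc]) (auto intro!: computable_if_rec_fn[OF rec_fn_Suc[OF rec_fn_proj[of 0]]])

lemma computable_minus [comp_rules]:
  fixes f g :: "'a::coded \<Rightarrow> nat"
  shows "computable f \<Longrightarrow> computable g \<Longrightarrow> computable (\<lambda>x. f x - g x)"
  by (rule computable_if_rec_fn[OF rec_fn_minus[OF rec_fn_encode[of f, OF _ rec_fn_proj[of 0]] rec_fn_encode[of g, OF _ rec_fn_proj[of 0]]]]) auto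

lemma computable_plus [comp_rules]:
  fixes f g :: "'a::coded \<Rightarrow> nat"
  shows "computable f \<Longrightarrow> computable g \<Longrightarrow> computable (\<lambda>x. f x + g x)"
  by (rule computable_if_rec_fn[OF rec_fn_plus[OF rec_fn_encode[of f, OF _ rec_fn_proj[of 0]] rec_fn_encode[of g, OF _ rec_fn_proj[of 0]]]]) auto

text \<open>The parameter \<open>x\<close> and the intermediate values travel as codes through a
  primitive recursion on \<open>n x\<close>. Case distinctions, bounded quantifiers and list
  operations are later written as \<open>rec_nat\<close> terms to use this.\<close>

lemma computable_rec_nat [comp_rules]:
  fixes g :: "'a::coded \<Rightarrow> 'b::coded"
  assumes g: "computable g" and h: "computable (\<lambda>p. h (fst p) (fst (snd p)) (snd (snd p)))" and n: "computable n"
  shows "computable (\<lambda>x. rec_nat (g x) (h x) (n x))"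
proof -
  define F where "F xs = encode (rec_nat (g (decode (xs ! 1))) (h (decode (xs ! 1))) (xs ! 0))" for xs
  let ?h = "\<lambda>p. h (fst p) (fst (snd p)) (snd (snd p))"
  have "rec_fn (Suc 1) F"
  proof (rule rec_fn_primrec)
    show "rec_fn 1 (\<lambda>xs. encode (g (decode (xs ! 0))))" by (intro rec_fn_encode g rec_fn_proj) simp
    show "rec_fn (Suc (Suc 1)) (\<lambda>xs. encode (?h (decode (prod_encode (xs ! 2, prod_encode (xs ! 0, xs ! 1))))))"
      by (intro rec_fn_encode[OF h] rec_fn_prod_encode rec_fn_proj) auto
    have *: "decode (prod_encode (a, prod_encode (b, c))) = (decode a :: 'a, b :: nat, decode c :: 'b)" for a b c
      using decode_encode[of "(decode a :: 'a, b :: nat, decode c :: 'b)"] by (simp add: encode_prod_def)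
    show "F (Suc k # xs) = encode (?h (decode (prod_encode ((k # F (k # xs) # xs) ! 2,
      prod_encode ((k # F (k # xs) # xs) ! 0, (k # F (k # xs) # xs) ! 1)))))" if "length xs = 1" for k xs
      unfolding * by (simp add: F_def numeral_2_eq_2)
  qed (simp add: F_def)
  then have "rec_fn 2 (\<lambda>xs. F [xs ! 0, xs ! 1])"
    by (subst rec_fn_cong[of 2 _ F]) (auto simp: F_def numeral_2_eq_2)
  then have "rec_fn 1 (\<lambda>xs. F [encode (n (decode (xs ! 0))), xs ! 0])"
    by (rule rec_fn_comp2[of "\<lambda>a b. F [a, b]"]) (rule rec_fn_encode[OF n] rec_fn_proj zero_less_one)+
  then show ?thesis by (rule computable_if_rec_fn) (simp add: F_def)
qed

lemma computable_if [comp_rules]: "decidable P \<Longrightarrow> computable f \<Longrightarrow> computable g \<Longrightarrow> computable (\<lambda>x. if P x then f x else g x)"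
proof -
  assume a: "decidable P" "computable f" "computable g"
  have "computable (\<lambda>x. rec_nat (g x) (\<lambda>_ _. f x) (of_bool (P x)))"
    by (intro computable_rec_nat a(3) a(1)[unfolded decidable_def]) (rule computable_comp[OF a(2) computable_fst[OF computable_id]])
  then show ?thesis by (rule back_subst[of computable]) auto
qed

lemma decidable_not [comp_rules]: "decidable P \<Longrightarrow> decidable (\<lambda>x. \<not> P x)"
proof -
  assume "decidable P"
  then have "computable (\<lambda>x. 1 - of_bool (P x) :: nat)" unfolding decidable_def by (intro computable_minus computable_const)
  then show ?thesis unfolding decidable_def by (rule back_subst[of computable]) auto
qed

lemma decidable_conj [comp_rules]: "decidable P \<Longrightarrow> decidable Q \<Longrightarrow> decidable (\<lambda>x. P x \<and> Q x)"
proof -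
  assume "decidable P" "decidable Q"
  then have "computable (\<lambda>x. if P x then of_bool (Q x) else 0 :: nat)"
    by (intro computable_if computable_const) (auto simp: decidable_def)
  then show ?thesis unfolding decidable_def by (rule back_subst[of computable]) auto
qed

lemma decidable_disj [comp_rules]: "decidable P \<Longrightarrow> decidable Q \<Longrightarrow> decidable (\<lambda>x. P x \<or> Q x)"
  using decidable_not[OF decidable_conj[OF decidable_not[of P] decidable_not[of Q]]] by simp

lemma decidable_imp [comp_rules]: "decidable P \<Longrightarrow> decidable Q \<Longrightarrow> decidable (\<lambda>x. P x \<longrightarrow> Q x)"
  unfolding imp_conv_disj by (intro decidable_disj decidable_not)

lemma decidable_le [comp_rules]: "computable f \<Longrightarrow> computable g \<Longrightarrow> decidable (\<lambda>x. f x \<le> (g x :: nat))"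
proof -
  assume "computable f" "computable g"
  then have "computable (\<lambda>x. 1 - (f x - g x))" by (intro computable_minus computable_const)
  then show ?thesis unfolding decidable_def by (rule back_subst[of computable]) auto
qed

lemma decidable_less [comp_rules]: "computable f \<Longrightarrow> computable g \<Longrightarrow> decidable (\<lambda>x. f x < (g x :: nat))"
  using decidable_le[OF computable_Suc[of f], of g] by (simp add: Suc_le_eq)

lemma decidable_eq [comp_rules]:
  assumes "computable f" "computable g"
  shows "decidable (\<lambda>x. f x = g x)"
proof -
  have "decidable (\<lambda>x. encode (f x) \<le> encode (g x) \<and> encode (g x) \<le> encode (f x))"
    by (intro decidable_conj decidable_le computable_encode assms)
  then show ?thesis by (rule back_subst[of decidable]) (auto simp: fun_eq_iff simp flip: eq_iff)
qed

lemma decidable_iff [comp_rules]: "decidable P \<Longrightarrow> decidable Q \<Longrightarrow> decidable (\<lambda>x. P x \<longleftrightarrow> Q x)"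
  unfolding iff_conv_conj_imp by (intro decidable_conj decidable_imp)

lemma decidable_comp: "decidable P \<Longrightarrow> computable f \<Longrightarrow> decidable (\<lambda>x. P (f x))"
  unfolding decidable_def by (rule computable_comp)

lemma decidable_bex_less [comp_rules]:
  fixes P :: "'a::coded \<Rightarrow> nat \<Rightarrow> bool"
  assumes "decidable (\<lambda>p. P (fst p) (snd p))" "computable n"
  shows "decidable (\<lambda>x. \<exists>i < n x. P x i)"
proof -
  have "computable (\<lambda>x. rec_nat 0 (\<lambda>i r. if P x i then 1 else r) (n x) :: nat)"
    by (intro comp_rules assms(2) decidable_comp[OF assms(1), of "\<lambda>p. (fst p, fst (snd p))", simplified])
  moreover have "rec_nat 0 (\<lambda>i r. if P x i then 1 else r) m = (of_bool (\<exists>i < m. P x i) :: nat)" for x m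
    by (induction m) (auto simp: less_Suc_eq)
  ultimately show ?thesis unfolding decidable_def by simp
qed

lemma decidable_ball_less [comp_rules]:
  fixes P :: "'a::coded \<Rightarrow> nat \<Rightarrow> bool"
  assumes "decidable (\<lambda>p. P (fst p) (snd p))" "computable n"
  shows "decidable (\<lambda>x. \<forall>i < n x. P x i)"
  using decidable_not[OF decidable_bex_less[OF decidable_not[OF assms(1)] assms(2)]] by simp

lemma decidable_evals:
  fixes P :: "'a::coded \<times> nat \<Rightarrow> bool"
  assumes "decidable P"
  obtains r where "\<And>n x. evals r [n, encode x] (of_bool (P (x, n)))"
proof -
  from rec_fn_encode[OF assms[unfolded decidable_def] rec_fn_prod_encode[OF rec_fn_proj[of 1 2] rec_fn_proj[of 0 2]]]
  have "rec_fn 2 (\<lambda>xs. of_bool (P (decode (prod_encode (xs ! 1, xs ! 0)))))" (is "rec_fn 2 ?f") by simp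
  then obtain r where r: "\<And>xs. length xs = 2 \<Longrightarrow> evals r xs (?f xs)" unfolding rec_fn_def by blast
  have "evals r [n, encode x] (of_bool (P (x, n)))" for n and x :: 'a
  proof -
    have "?f [n, encode x] = of_bool (P (x, n))"
      using decode_encode[of "(x, n)"] by (simp add: encode_prod_def)
    then show ?thesis using r[of "[n, encode x]"] by simp
  qed
  then show ?thesis by (rule that)
qed

lemma evals_Mu_Least:
  assumes r: "\<And>n. evals r (n # xs) (of_bool (\<not> P n))" and ex: "\<exists>n. P n"
  shows "evals (Mu r) xs (LEAST n. P n)"
proof (rule evals.Mu)
  show "evals r ((LEAST n. P n) # xs) 0" using r[of "LEAST n. P n"] LeastI_ex[OF ex] by simp
  show "\<exists>y>0. evals r (m # xs) y" if "m < (LEAST n. P n)" for m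
    using r[of m] not_less_Least[OF that] by (intro exI[of _ 1]) auto
qed

lemma computable_Least:
  fixes P :: "'a::coded \<Rightarrow> nat \<Rightarrow> bool"
  assumes P: "decidable (\<lambda>p. P (fst p) (snd p))" and ex: "\<And>x. \<exists>n. P x n"
  shows "computable (\<lambda>x. LEAST n. P x n)"
proof -
  obtain r where "\<And>n x. evals r [n, encode x] (of_bool (\<not> P x n))"
    using decidable_evals[OF decidable_not[OF P]] by auto
  then have "evals (Mu r) [encode x] (LEAST n. P x n)" for x by (rule evals_Mu_Least) (rule ex)
  then show ?thesis unfolding computable_def by auto
qed

named_theorems semi_rules

lemma decidable_imp_semidec: "decidable P \<Longrightarrow> semidec P"
proof -
  assume "decidable P"
  then have "decidable (\<lambda>p. P (fst p))" by (rule decidable_comp[OF _ computable_fst_fun])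
  then show ?thesis unfolding semidec_def by (intro exI[of _ "\<lambda>p. P (fst p)"]) auto
qed

lemma semidec_conj [semi_rules]:
  assumes "semidec P" "semidec Q"
  shows "semidec (\<lambda>x. P x \<and> Q x)"
proof -
  obtain P' Q' where P: "decidable P'" "\<And>x. P x \<longleftrightarrow> (\<exists>n :: nat. P' (x, n))"
    and Q: "decidable Q'" "\<And>x. Q x \<longleftrightarrow> (\<exists>n :: nat. Q' (x, n))" using assms unfolding semidec_def by blast
  let ?d = "\<lambda>p. decode (snd p) :: nat \<times> nat"
  let ?R = "\<lambda>p. P' (fst p, fst (?d p)) \<and> Q' (fst p, snd (?d p))"
  have "decidable ?R"
    by (intro decidable_conj decidable_comp[OF P(1)] decidable_comp[OF Q(1)] comp_rules)
  moreover have "P x \<and> Q x \<longleftrightarrow> (\<exists>n. ?R (x, n))" for x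
  proof
    assume "P x \<and> Q x"
    then obtain m n where "P' (x, m)" "Q' (x, n)" using P Q by blast
    then show "\<exists>n. ?R (x, n)" by (intro exI[of _ "encode (m, n)"]) simp
  qed (use P Q in auto)
  ultimately show ?thesis unfolding semidec_def by blast
qed

lemma semidec_ex [semi_rules]:
  fixes P :: "'a::coded \<Rightarrow> 'b::coded \<Rightarrow> bool"
  assumes "semidec (\<lambda>p. P (fst p) (snd p))"
  shows "semidec (\<lambda>x. \<exists>y. P x y)"
proof -
  obtain P' where P: "decidable P'" "\<And>p. P (fst p) (snd p) \<longleftrightarrow> (\<exists>n :: nat. P' (p, n))"
    using assms unfolding semidec_def by blast
  let ?d = "\<lambda>p. decode (snd p) :: 'b \<times> nat"
  let ?R = "\<lambda>p. P' ((fst p, fst (?d p)), snd (?d p))"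
  have "decidable ?R"
    by (intro decidable_comp[OF P(1)] comp_rules)
  moreover have "(\<exists>y. P x y) \<longleftrightarrow> (\<exists>n. ?R (x, n))" for x
  proof
    assume "\<exists>y. P x y"
    then obtain y n where "P' ((x, y), n)" using P(2)[of "(x, _)"] by auto
    then show "\<exists>n. ?R (x, n)" by (intro exI[of _ "encode (y, n)"]) simp
  qed (use P(2)[of "(x, _)"] in auto)
  ultimately show ?thesis unfolding semidec_def by blast
qed

lemma semidec_comp:
  assumes "semidec P" "computable f"
  shows "semidec (\<lambda>x. P (f x))"
proof -
  obtain P' where P: "decidable P'" "\<And>x. P x \<longleftrightarrow> (\<exists>n :: nat. P' (x, n))" using assms unfolding semidec_def by blast
  have "decidable (\<lambda>p. P' (f (fst p), snd p))"
    by (intro decidable_comp[OF P(1)] comp_rules computable_comp[OF assms(2)])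
  then show ?thesis unfolding semidec_def P(2) by (intro exI[of _ "\<lambda>p. P' (f (fst p), snd p)"]) auto
qed

lemma semidec_disj [semi_rules]:
  assumes "semidec P" "semidec Q"
  shows "semidec (\<lambda>x. P x \<or> Q x)"
proof -
  obtain P' Q' where P: "decidable P'" "\<And>x. P x \<longleftrightarrow> (\<exists>n :: nat. P' (x, n))"
    and Q: "decidable Q'" "\<And>x. Q x \<longleftrightarrow> (\<exists>n :: nat. Q' (x, n))" using assms unfolding semidec_def by blast
  have "decidable (\<lambda>p. P' p \<or> Q' p)" by (intro decidable_disj P Q)
  then show ?thesis unfolding semidec_def using P Q by blast
qed

lemma semidec_ball_less [semi_rules]:
  fixes P :: "'a::coded \<Rightarrow> nat \<Rightarrow> bool"
  assumes "semidec (\<lambda>p. P (fst p) (snd p))" and n: "computable n"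
  shows "semidec (\<lambda>x. \<forall>i < n x. P x i)"
proof -
  obtain P' where P: "decidable P'" "\<And>p. P (fst p) (snd p) \<longleftrightarrow> (\<exists>n :: nat. P' (p, n))"
    using assms unfolding semidec_def by blast
  let ?R = "\<lambda>p. \<forall>i < n (fst p). \<exists>m < snd p. P' ((fst p, i), m)"
  have "decidable ?R"
    by (intro comp_rules computable_comp[OF n] decidable_comp[OF P(1)])
  moreover have "(\<forall>i < n x. P x i) \<longleftrightarrow> (\<exists>m. ?R (x, m))" for x
  proof
    assume "\<forall>i < n x. P x i"
    then have "\<forall>i < n x. \<exists>m. P' ((x, i), m)" using P(2)[of "(x, _)"] by auto
    then obtain f where f: "\<And>i. i < n x \<Longrightarrow> P' ((x, i), f i)" by metis
    have "f i < Suc (\<Sum>i<n x. f i)" if "i < n x" for i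
      using member_le_sum[of i "{..<n x}" f] that by auto
    with f show "\<exists>m. ?R (x, m)" by (intro exI[of _ "Suc (\<Sum>i<n x. f i)"]) auto
  next
    assume "\<exists>m. ?R (x, m)"
    then show "\<forall>i < n x. P x i" using P(2)[of "(x, _)"] by auto
  qed
  ultimately show ?thesis unfolding semidec_def by blast
qed

text \<open>The search runs over codes of pairs of a candidate value and a witness; whatever pair it
  finds carries the right value.\<close>

lemma computable_if_semidec_graph:
  fixes f :: "'a::coded \<Rightarrow> 'b::coded"
  assumes "semidec (\<lambda>p. f (fst p) = snd p)"
  shows "computable f"
proof -
  obtain Q where Q: "decidable Q" "\<And>p. f (fst p) = snd p \<longleftrightarrow> (\<exists>n :: nat. Q (p, n))"
    using assms unfolding semidec_def by blast
  let ?d = "\<lambda>n. decode n :: 'b \<times> nat"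
  let ?P = "\<lambda>x n. Q ((x, fst (?d n)), snd (?d n))"
  have ex: "\<exists>n. ?P x n" for x
  proof -
    obtain n where "Q ((x, f x), n)" using Q(2)[of "(x, f x)"] by auto
    then show ?thesis by (intro exI[of _ "encode (f x, n)"]) simp
  qed
  have "decidable (\<lambda>p. ?P (fst p) (snd p))" by (intro decidable_comp[OF Q(1)] comp_rules)
  from computable_Least[of ?P, OF this ex] have "computable (\<lambda>x. fst (?d (LEAST n. ?P x n)))" by (intro comp_rules)
  moreover have "fst (?d (LEAST n. ?P x n)) = f x" for x
  proof -
    have "?P x (LEAST n. ?P x n)" by (rule LeastI_ex[OF ex])
    then show ?thesis using Q(2)[of "(x, fst (?d (LEAST n. ?P x n)))"] by auto
  qed
  ultimately show ?thesis by simp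
qed

text \<open>Post's theorem: the graph of the characteristic function is semidecidable.\<close>

lemma decidable_if_semidec:
  assumes "semidec P" "semidec (\<lambda>x. \<not> P x)"
  shows "decidable P"
  unfolding decidable_def
proof (rule computable_if_semidec_graph)
  have "semidec (\<lambda>p. (P (fst p) \<and> snd p = (1 :: nat)) \<or> (\<not> P (fst p) \<and> snd p = 0))"
    by (intro semi_rules semidec_comp[OF assms(1)] semidec_comp[OF assms(2)] decidable_imp_semidec comp_rules)
  then show "semidec (\<lambda>p. of_bool (P (fst p)) = (snd p :: nat))"
    by (rule back_subst[of semidec]) (auto simp: fun_eq_iff)
qed

text \<open>The parallel search. Post's theorem does not apply, since the two predicates are
  complementary only for some \<open>x\<close>, and nothing is claimed for the others. One
  \<open>Mu\<close> looks for a number that is a witness of either kind; \<open>s\<close> then tests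
  whether it is one for \<open>P\<close>.\<close>

lemma semidec_algorithm:
  fixes P Q :: "'a::coded \<Rightarrow> bool"
  assumes "semidec P" "semidec Q"
  shows "\<exists>r. \<forall>x. (P x \<longleftrightarrow> \<not> Q x) \<longrightarrow> evals r [encode x] (if P x then 1 else 0)"
proof -
  obtain P' Q' where P: "decidable P'" "\<And>x. P x \<longleftrightarrow> (\<exists>n :: nat. P' (x, n))"
    and Q: "decidable Q'" "\<And>x. Q x \<longleftrightarrow> (\<exists>n :: nat. Q' (x, n))" using assms unfolding semidec_def by blast
  let ?S = "\<lambda>p. P' p \<or> Q' p"
  obtain r where r: "\<And>n x. evals r [n, encode x] (of_bool (\<not> ?S (x, n)))"
    using decidable_evals[OF decidable_not[OF decidable_disj[OF P(1) Q(1)]]] by auto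
  obtain s where s: "\<And>n x. evals s [n, encode x] (of_bool (P' (x, n)))"
    using decidable_evals[OF P(1)] by auto
  have "evals (Comp s [Mu r, Proj 0]) [encode x] (if P x then 1 else 0)" if x: "P x \<longleftrightarrow> \<not> Q x" for x
  proof -
    let ?n = "LEAST n. ?S (x, n)"
    have ex: "\<exists>n. ?S (x, n)" using x P(2) Q(2) by blast
    have mu: "evals (Mu r) [encode x] ?n" by (rule evals_Mu_Least[OF r ex])
    have pr: "evals (Proj 0) [encode x] (encode x)" using evals.Proj[of 0 "[encode x]"] by simp
    have "P' (x, ?n) \<longleftrightarrow> P x" using LeastI_ex[OF ex] x P(2) Q(2) by blast
    then have "evals s [?n, encode x] (if P x then 1 else 0)" using s[of ?n x] by (auto split: if_splits)
    then show ?thesis by (intro evals.Comp[of _ _ "[?n, encode x]"]) (auto simp: mu pr)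
  qed
  then show ?thesis by blast
qed

section \<open>Computable operations on lists\<close>

lemma computable_Cons [comp_rules]: "computable f \<Longrightarrow> computable g \<Longrightarrow> computable (\<lambda>x. f x # g x)"
proof -
  assume "computable f" "computable g"
  then have "computable (\<lambda>x. decode (Suc (encode (f x, g x))) :: 'b list)" by (intro comp_rules)
  then show ?thesis by (simp flip: encode_Cons)
qed

text \<open>A nonempty list has the code \<open>Suc k\<close> where \<open>k\<close> codes head and
  tail, so the case distinction is a recursion on the code that ignores the recursive value.\<close>

lemma computable_case_list [comp_rules]:
  assumes "computable f" "computable (\<lambda>p. g (fst p) (fst (snd p)) (snd (snd p)))" "computable l"
  shows "computable (\<lambda>x. case l x of [] \<Rightarrow> f x | y # ys \<Rightarrow> g x y ys)"
proof -
  let ?d = "\<lambda>k. decode k :: 'c \<times> 'c list"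
  have "computable (\<lambda>x. rec_nat (f x) (\<lambda>k r. g x (fst (?d k)) (snd (?d k))) (encode (l x)))"
    by (intro computable_rec_nat computable_encode assms
      computable_comp[OF assms(2), of "\<lambda>p. (fst p, ?d (fst (snd p)))", simplified] comp_rules)
  moreover have "rec_nat (f x) (\<lambda>k r. g x (fst (?d k)) (snd (?d k))) (encode (l x)) =
      (case l x of [] \<Rightarrow> f x | y # ys \<Rightarrow> g x y ys)" for x
    by (cases "l x") (simp_all add: encode_Nil encode_Cons)
  ultimately show ?thesis by simp
qed

lemma computable_tl [comp_rules]: "computable l \<Longrightarrow> computable (\<lambda>x. tl (l x))"
  unfolding tl_def by (intro comp_rules)

lemma computable_hd [comp_rules]: "computable l \<Longrightarrow> computable (\<lambda>x. hd (l x))"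
proof -
  assume "computable l"
  then have "computable (\<lambda>x. case l x of [] \<Rightarrow> hd [] | y # ys \<Rightarrow> y)" by (intro comp_rules)
  moreover have "(case l x of [] \<Rightarrow> hd [] | y # ys \<Rightarrow> y) = hd (l x)" for x by (cases "l x") auto
  ultimately show ?thesis by simp
qed

lemma computable_drop [comp_rules]: "computable n \<Longrightarrow> computable l \<Longrightarrow> computable (\<lambda>x. drop (n x) (l x))"
proof -
  assume "computable n" "computable l"
  then have "computable (\<lambda>x. rec_nat (l x) (\<lambda>k r. tl r) (n x))" by (intro comp_rules)
  moreover have "rec_nat l (\<lambda>k r. tl r) n = drop n l" for n and l :: "'b list"
    by (induction n) (auto simp: drop_Suc tl_drop)
  ultimately show ?thesis by simp
qed

lemma computable_length [comp_rules]: "computable l \<Longrightarrow> computable (\<lambda>x. length (l x))"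
proof -
  assume l: "computable l"
  have "decidable (\<lambda>p. drop (snd p) (l (fst p)) = [])" by (intro comp_rules computable_comp[OF l])
  then have "computable (\<lambda>x. LEAST n. drop n (l x) = [])" by (rule computable_Least) (auto intro: exI[of _ "length _"])
  moreover have "(LEAST n. drop n (l x) = []) = length (l x)" for x by (rule Least_equality) auto
  ultimately show ?thesis by simp
qed

text \<open>\<open>hd (drop i l)\<close> replaces \<open>l ! i\<close>, whose value is unspecified if \<open>i \<ge> length l\<close>.\<close>

lemma Ball_set_iff_drop: "(\<forall>y \<in> set l. P y) \<longleftrightarrow> (\<forall>i < length l. P (hd (drop i l)))"
  by (auto simp: all_set_conv_all_nth hd_drop_conv_nth)

lemma Bex_set_iff_drop: "(\<exists>y \<in> set l. P y) \<longleftrightarrow> (\<exists>i < length l. P (hd (drop i l)))"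
  using Ball_set_iff_drop[of l "\<lambda>y. \<not> P y"] by blast

lemma decidable_ball [comp_rules]:
  assumes "decidable (\<lambda>p. P (fst p) (snd p))" and l: "computable l"
  shows "decidable (\<lambda>x. \<forall>y \<in> set (l x). P x y)"
  unfolding Ball_set_iff_drop
  by (intro comp_rules l computable_comp[OF l]
      decidable_comp[OF assms(1), of "\<lambda>p. (fst p, hd (drop (snd p) (l (fst p))))", simplified])

lemma decidable_bex [comp_rules]:
  assumes "decidable (\<lambda>p. P (fst p) (snd p))" and l: "computable l"
  shows "decidable (\<lambda>x. \<exists>y \<in> set (l x). P x y)"
  unfolding Bex_set_iff_drop
  by (intro comp_rules l computable_comp[OF l]
      decidable_comp[OF assms(1), of "\<lambda>p. (fst p, hd (drop (snd p) (l (fst p))))", simplified])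

lemma decidable_mem [comp_rules]: "computable f \<Longrightarrow> computable l \<Longrightarrow> decidable (\<lambda>x. f x \<in> set (l x))"
proof -
  assume f: "computable f" and l: "computable l"
  have "decidable (\<lambda>x. \<exists>y \<in> set (l x). f x = y)" by (intro comp_rules l computable_comp[OF f])
  then show ?thesis by (rule back_subst[of decidable]) auto
qed

text \<open>A witness for a value is the whole trace of the computation: a list of pairs of argument
  and value in which every entry that is not a base case is justified by the next one. The measure
  \<open>m\<close> makes the trace finite.\<close>

lemma computable_linear_recursion:
  fixes f :: "'a::coded \<Rightarrow> 'b::coded" and m :: "'a \<Rightarrow> nat"
  assumes f: "\<And>x. f x = (if b x then g x else h x (f (d x)))"
    and m: "\<And>x. \<not> b x \<Longrightarrow> m (d x) < m x"
    and b: "decidable b" and g: "computable g" and h: "computable (\<lambda>p. h (fst p) (snd p))" and d: "computable d"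
  shows "computable f"
proof (rule computable_if_semidec_graph)
  let ?e = "\<lambda>i zs. hd (drop i zs) :: 'a \<times> 'b"
  define ok where "ok zs i \<longleftrightarrow> (b (fst (?e i zs)) \<and> snd (?e i zs) = g (fst (?e i zs))) \<or>
    (\<not> b (fst (?e i zs)) \<and> Suc i < length zs \<and> fst (?e (Suc i) zs) = d (fst (?e i zs)) \<and>
      snd (?e i zs) = h (fst (?e i zs)) (snd (?e (Suc i) zs)))" for zs i
  have sound: "snd (?e i zs) = f (fst (?e i zs))" if "\<forall>i < length zs. ok zs i" "i < length zs" for i zs
    using that(2)
  proof (induction "length zs - i" arbitrary: i rule: less_induct)
    case less
    have "ok zs i" using less.prems that(1) by blast
    then show ?case
    proof (cases "b (fst (?e i zs))")
      case False
      with \<open>ok zs i\<close> have "Suc i < length zs" "fst (?e (Suc i) zs) = d (fst (?e i zs))"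
        "snd (?e i zs) = h (fst (?e i zs)) (snd (?e (Suc i) zs))" by (auto simp: ok_def)
      then show ?thesis using less.hyps[of "Suc i"] less.prems f[of "fst (?e i zs)"] False by auto
    qed (use f in \<open>auto simp: ok_def\<close>)
  qed
  have complete: "\<exists>zs. zs \<noteq> [] \<and> hd zs = (x, f x) \<and> (\<forall>i < length zs. ok zs i)" for x
  proof (induction "m x" arbitrary: x rule: less_induct)
    case less
    show ?case
    proof (cases "b x")
      case True
      then show ?thesis using f[of x] by (intro exI[of _ "[(x, f x)]"]) (auto simp: ok_def)
    next
      case False
      from less[OF m[OF this]] obtain zs where zs: "zs \<noteq> []" "hd zs = (d x, f (d x))"
        "\<And>i. i < length zs \<Longrightarrow> ok zs i" by blast
      have "ok ((x, f x) # zs) i" if "i < length ((x, f x) # zs)" for i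
      proof (cases i)
        case 0
        then show ?thesis using False f[of x] zs(1,2) by (auto simp: ok_def)
      next
        case (Suc k)
        then have "ok zs k" using zs(3) that by simp
        then show ?thesis unfolding ok_def Suc by simp
      qed
      then show ?thesis by (intro exI[of _ "(x, f x) # zs"]) auto
    qed
  qed
  have "semidec (\<lambda>p. \<exists>zs. zs \<noteq> [] \<and> hd zs = p \<and> (\<forall>i < length zs. ok zs i))"
    unfolding ok_def
    by (intro semi_rules decidable_imp_semidec comp_rules decidable_comp[OF b] computable_comp[OF g] computable_comp[OF d]
      computable_comp[OF h, of "\<lambda>p. (fst (?e (snd p) (snd (fst p))), snd (?e (Suc (snd p)) (snd (fst p))))", simplified])
  moreover have "(\<exists>zs. zs \<noteq> [] \<and> hd zs = p \<and> (\<forall>i < length zs. ok zs i)) \<longleftrightarrow> f (fst p) = snd p" for p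
  proof
    assume "\<exists>zs. zs \<noteq> [] \<and> hd zs = p \<and> (\<forall>i < length zs. ok zs i)"
    then obtain zs where "zs \<noteq> []" "hd zs = p" "\<forall>i < length zs. ok zs i" by blast
    with sound[of zs 0] show "f (fst p) = snd p" by simp
  next
    assume "f (fst p) = snd p"
    then have "p = (fst p, f (fst p))" by simp
    then show "\<exists>zs. zs \<noteq> [] \<and> hd zs = p \<and> (\<forall>i < length zs. ok zs i)" using complete by metis
  qed
  ultimately show "semidec (\<lambda>p. f (fst p) = snd p)" by simp
qed

lemma computable_rec_list [comp_rules]:
  assumes g: "computable g" and h: "computable (\<lambda>p. h (fst p) (fst (snd p)) (fst (snd (snd p))) (snd (snd (snd p))))" and l: "computable l"
  shows "computable (\<lambda>x. rec_list (g x) (h x) (l x))"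
proof -
  define F where "F p = rec_list (g (fst p)) (h (fst p)) (snd p)" for p
  have "computable F"
  proof (rule computable_linear_recursion[where m = "\<lambda>p. length (snd p)"])
    show "F p = (if snd p = [] then g (fst p) else h (fst p) (hd (snd p)) (tl (snd p)) (F (fst p, tl (snd p))))" for p
      by (cases "snd p") (auto simp: F_def)
    show "computable (\<lambda>p. h (fst (fst p)) (hd (snd (fst p))) (tl (snd (fst p))) (snd p))"
      by (intro computable_comp[OF h, of "\<lambda>p. (fst (fst p), hd (snd (fst p)), tl (snd (fst p)), snd p)", simplified] comp_rules)
    show "computable (\<lambda>p. g (fst p))" by (rule computable_comp[OF g computable_fst_fun])
  qed (intro comp_rules | simp)+
  from computable_comp[OF this computable_pair[OF computable_id l]] show ?thesis by (simp add: F_def)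
qed

lemma computable_append [comp_rules]: "computable f \<Longrightarrow> computable g \<Longrightarrow> computable (\<lambda>x. f x @ g x)"
proof -
  assume "computable f" "computable g"
  then have "computable (\<lambda>x. rec_list (g x) (\<lambda>y ys r. y # r) (f x))" by (intro comp_rules)
  moreover have "rec_list b (\<lambda>y ys r. y # r) a = a @ b" for a b :: "'b list" by (induction a) auto
  ultimately show ?thesis by simp
qed

lemma computable_map [comp_rules]:
  assumes "computable (\<lambda>p. f (fst p) (snd p))" and l: "computable l"
  shows "computable (\<lambda>x. map (f x) (l x))"
proof -
  have "computable (\<lambda>x. rec_list [] (\<lambda>y ys r. f x y # r) (l x))"
    by (intro comp_rules l computable_comp[OF assms(1), of "\<lambda>p. (fst p, fst (snd p))", simplified])
  moreover have "rec_list [] (\<lambda>y ys r. f x y # r) a = map (f x) a" for x a by (induction a) auto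
  ultimately show ?thesis by simp
qed

lemma computable_filter [comp_rules]:
  assumes "decidable (\<lambda>p. f (fst p) (snd p))" and l: "computable l"
  shows "computable (\<lambda>x. filter (f x) (l x))"
proof -
  have "computable (\<lambda>x. rec_list [] (\<lambda>y ys r. if f x y then y # r else r) (l x))"
    by (intro comp_rules l decidable_comp[OF assms(1), of "\<lambda>p. (fst p, fst (snd p))", simplified])
  moreover have "rec_list [] (\<lambda>y ys r. if f x y then y # r else r) a = filter (f x) a" for x a by (induction a) auto
  ultimately show ?thesis by simp
qed

lemma computable_concat [comp_rules]: "computable f \<Longrightarrow> computable (\<lambda>x. concat (f x))"
proof -
  assume "computable f"
  then have "computable (\<lambda>x. rec_list [] (\<lambda>y ys r. y @ r) (f x))" by (intro comp_rules)
  moreover have "rec_list [] (\<lambda>y ys r. y @ r) a = concat a" for a :: "'b list list" by (induction a) auto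
  ultimately show ?thesis by simp
qed

lemma computable_upt [comp_rules]: "computable f \<Longrightarrow> computable (\<lambda>x. [0..<f x])"
proof -
  assume "computable f"
  then have "computable (\<lambda>x. rec_nat [] (\<lambda>k r. r @ [k]) (f x))" by (intro comp_rules)
  moreover have "rec_nat [] (\<lambda>k r. r @ [k]) n = [0..<n]" for n by (induction n) auto
  ultimately show ?thesis by simp
qed

lemma computable_subseqs [comp_rules]: "computable f \<Longrightarrow> computable (\<lambda>x. subseqs (f x))"
proof -
  assume "computable f"
  then have "computable (\<lambda>x. rec_list [[]] (\<lambda>y ys r. map ((#) y) r @ r) (f x))" by (intro comp_rules)
  moreover have "rec_list [[]] (\<lambda>y ys r. map ((#) y) r @ r) a = subseqs a" for a :: "'b list"
    by (induction a) (auto simp: Let_def)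
  ultimately show ?thesis by simp
qed

lemma computable_n_lists [comp_rules]: "computable n \<Longrightarrow> computable f \<Longrightarrow> computable (\<lambda>x. List.n_lists (n x) (f x))"
proof -
  assume "computable n" and f: "computable f"
  then have "computable (\<lambda>x. rec_nat [[]] (\<lambda>k r. concat (map (\<lambda>ys. map (\<lambda>y. y # ys) (f x)) r)) (n x))"
    by (intro comp_rules computable_comp[OF f])
  moreover have "rec_nat [[]] (\<lambda>k r. concat (map (\<lambda>ys. map (\<lambda>y. y # ys) a) r)) n = List.n_lists n a"
    for n and a :: "'b list" by (induction n) auto
  ultimately show ?thesis by simp
qed

lemma computable_div2 [comp_rules]:
  fixes f :: "'a::coded \<Rightarrow> nat"
  shows "computable f \<Longrightarrow> computable (\<lambda>x. f x div 2)"
proof -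
  assume f: "computable f"
  have "decidable (\<lambda>p. f (fst p) < snd p + snd p + 2)" by (intro comp_rules computable_comp[OF f])
  then have "computable (\<lambda>x. LEAST n. f x < n + n + 2)" by (rule computable_Least) presburger
  moreover have "(LEAST n. f x < n + n + 2) = f x div 2" for x
    by (rule Least_equality) auto
  ultimately show ?thesis by simp
qed

lemma decidable_set_decode [comp_rules]: "computable f \<Longrightarrow> computable g \<Longrightarrow> decidable (\<lambda>x. f x \<in> set_decode (g x))"
proof -
  assume "computable f" "computable g"
  then have "decidable (\<lambda>x. \<not> (let h = rec_nat (g x) (\<lambda>k r. r div 2) (f x) in h = h div 2 + h div 2))"
    unfolding Let_def by (intro comp_rules)
  moreover have "rec_nat g (\<lambda>k r. r div 2) n = g div 2 ^ n" for g n :: nat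
    by (induction n) (auto simp: mult.commute simp flip: div_mult2_eq)
  moreover have "h = h div 2 + h div 2 \<longleftrightarrow> even h" for h :: nat by presburger
  ultimately show ?thesis by (simp add: set_decode_def)
qed

lemma computable_list_decode [comp_rules]: "computable f \<Longrightarrow> computable (\<lambda>x. list_decode (f x))"
proof -
  assume "computable f"
  then have "computable (\<lambda>x. decode (f x) :: nat list)" by (intro comp_rules)
  moreover have "decode n = list_decode n" for n
  proof -
    have "encode (list_decode n) = n" by (simp add: encode_list_def map_idI)
    then show ?thesis by (metis decode_encode)
  qed
  ultimately show ?thesis by simp
qed

lemma computable_prod_decode [comp_rules]: "computable f \<Longrightarrow> computable (\<lambda>x. prod_decode (f x))"
proof -
  assume "computable f"
  then have "computable (\<lambda>x. decode (f x) :: nat \<times> nat)" by (intro comp_rules)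
  moreover have "decode n = prod_decode n" for n
    using encode_decode[of n, where 'a = "nat \<times> nat"] by (simp add: encode_prod_def) (metis prod_encode_inverse)
  ultimately show ?thesis by simp
qed

section \<open>Reachability\<close>

lemma semidec_rtranclp:
  fixes R :: "'a::coded \<Rightarrow> 'b::coded \<Rightarrow> 'b \<Rightarrow> bool"
  assumes R: "semidec (\<lambda>p. R (fst p) (fst (snd p)) (snd (snd p)))"
  shows "semidec (\<lambda>p. (R (fst p))\<^sup>*\<^sup>* (fst (snd p)) (snd (snd p)))"
proof -
  let ?ok = "\<lambda>x a b zs. zs \<noteq> [] \<and> hd zs = a \<and> hd (drop (length zs - 1) zs) = b \<and>
    (\<forall>i < length zs - 1. R x (hd (drop i zs)) (hd (drop (Suc i) zs)))"
  have "semidec (\<lambda>p. \<exists>zs. ?ok (fst p) (fst (snd p)) (snd (snd p)) zs)"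
    by (intro semi_rules; (intro semidec_comp[OF R, of "\<lambda>p. (fst (fst (fst p)), hd (drop (snd p) (snd (fst p))),
        hd (drop (Suc (snd p)) (snd (fst p))))", simplified] comp_rules | intro decidable_imp_semidec comp_rules))
  moreover have "(\<exists>zs. ?ok x a b zs) \<longleftrightarrow> (R x)\<^sup>*\<^sup>* a b" for x a b
  proof
    assume "\<exists>zs. ?ok x a b zs"
    then obtain zs where zs: "?ok x a b zs" by blast
    have "(R x)\<^sup>*\<^sup>* a (hd (drop i zs))" if "i \<le> length zs - 1" for i
      using that
    proof (induction i)
      case 0
      then show ?case using zs by simp
    next
      case (Suc i)
      then have "(R x)\<^sup>*\<^sup>* a (hd (drop i zs))" "R x (hd (drop i zs)) (hd (drop (Suc i) zs))" using zs by auto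
      then show ?case by (rule rtranclp.rtrancl_into_rtrancl)
    qed
    from this[of "length zs - 1"] show "(R x)\<^sup>*\<^sup>* a b" using zs by simp
  next
    assume "(R x)\<^sup>*\<^sup>* a b"
    then show "\<exists>zs. ?ok x a b zs"
    proof (induction rule: converse_rtranclp_induct)
      case base
      show ?case by (intro exI[of _ "[b]"]) auto
    next
      case (step y z)
      then obtain zs where zs: "?ok x z b zs" by blast
      have "R x (hd (drop i (y # zs))) (hd (drop (Suc i) (y # zs)))" if "i < length (y # zs) - 1" for i
        using zs that step(1) by (cases i) auto
      moreover have "hd (drop (length (y # zs) - 1) (y # zs)) = b"
        using zs by (cases zs) auto
      ultimately show ?case by (intro exI[of _ "y # zs"]) auto
    qed
  qed
  ultimately show ?thesis by simp
qed

text \<open>Unreachability is witnessed by a set that is closed under \<open>R\<close> and separates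
  \<open>a\<close> from \<open>b\<close>. The set of all points reachable from \<open>a\<close> is
  finite because it lies in \<open>insert a (set (W x))\<close>, so it can serve as this
  witness.\<close>

lemma decidable_rtranclp:
  fixes R :: "'a::coded \<Rightarrow> 'b::coded \<Rightarrow> 'b \<Rightarrow> bool"
  assumes R: "decidable (\<lambda>p. R (fst p) (fst (snd p)) (snd (snd p)))"
    and W: "computable W" "\<And>x a b. R x a b \<Longrightarrow> b \<in> set (W x)"
  shows "decidable (\<lambda>p. (R (fst p))\<^sup>*\<^sup>* (fst (snd p)) (snd (snd p)))"
proof (rule decidable_if_semidec)
  let ?sep = "\<lambda>x a b S. a \<in> set S \<and> b \<notin> set S \<and> (\<forall>c \<in> set S. \<forall>d \<in> set (W x). R x c d \<longrightarrow> d \<in> set S)"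
  have "semidec (\<lambda>p. \<exists>S. ?sep (fst p) (fst (snd p)) (snd (snd p)) S)"
    by (intro semidec_ex decidable_imp_semidec comp_rules computable_comp[OF W(1)]
      decidable_comp[OF R, of "\<lambda>p. (fst (fst (fst (fst p))), snd (fst p), snd p)", simplified])
  moreover have "(\<exists>S. ?sep x a b S) \<longleftrightarrow> \<not> (R x)\<^sup>*\<^sup>* a b" for x a b
  proof
    assume "\<exists>S. ?sep x a b S"
    then obtain S where S: "?sep x a b S" by blast
    have "c \<in> set S" if "(R x)\<^sup>*\<^sup>* a c" for c
      using that by (induction rule: rtranclp_induct) (use S W(2) in blast)+
    then show "\<not> (R x)\<^sup>*\<^sup>* a b" using S by blast
  next
    assume n: "\<not> (R x)\<^sup>*\<^sup>* a b"
    have "c \<in> insert a (set (W x))" if "(R x)\<^sup>*\<^sup>* a c" for c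
      using that by (induction rule: rtranclp_induct) (use W(2) in blast)+
    then have "{c. (R x)\<^sup>*\<^sup>* a c} \<subseteq> insert a (set (W x))" by blast
    then have "finite {c. (R x)\<^sup>*\<^sup>* a c}" by (rule finite_subset) simp
    then obtain S where S: "set S = {c. (R x)\<^sup>*\<^sup>* a c}" using finite_list by blast
    have "?sep x a b S" unfolding S using n by (auto intro: rtranclp.rtrancl_into_rtrancl)
    then show "\<exists>S. ?sep x a b S" by blast
  qed
  ultimately show "semidec (\<lambda>p. \<not> (R (fst p))\<^sup>*\<^sup>* (fst (snd p)) (snd (snd p)))" by simp
qed (rule semidec_rtranclp[OF decidable_imp_semidec[OF R]])

section \<open>Finite levels of a diagonal transducer\<close>

text \<open>Words are stored in reverse: the head of a list is the letter read last, and \<open>w @ u\<close> is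
  the word \<open>u\<close> followed by \<open>w\<close>.\<close>

fun step :: "('q \<times> ('a \<times> 'a) \<times> 'q) set \<Rightarrow> 'a list \<Rightarrow> 'a list \<Rightarrow> 'q set \<Rightarrow> 'q set" where
  "step E [] [] X = X"
| "step E (a # u) (b # v) X = {q'. \<exists>q \<in> step E u v X. (q, (a, b), q') \<in> E}"
| "step E _ _ X = {}"

lemma step_length: "q \<in> step E u v X \<Longrightarrow> length u = length v"
  by (induction E u v X arbitrary: q rule: step.induct) auto

lemma step_empty [simp]: "step E u v {} = {}"
  by (induction E u v "{} :: 'a set" rule: step.induct) auto

lemma step_append:
  "length w = length w' \<Longrightarrow> step E (w @ u) (w' @ v) X = step E w w' (step E u v X)"
  by (induction w w' rule: list_induct2) auto

lemma step_iff: "q \<in> step E u v X \<longleftrightarrow> (\<exists>p \<in> X. q \<in> step E u v {p})"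
  by (induction E u v X arbitrary: q rule: step.induct) (auto, blast+)

text \<open>\<open>D\<close> plays the role of the set of trivial states, so \<open>Y u v\<close> consists of the states in which the
  pair \<open>(u, v)\<close> has not yet become trivial. The parameter \<open>T \<subseteq> D\<close> stands for the set of states that
  accept the common tail of two words, and \<open>G T\<close> for the relation on their prefixes.\<close>

locale transducer =
  fixes E :: "('q \<times> ('a \<times> 'a) \<times> 'q) set" and I D :: "'q set"
begin

definition Y :: "'a list \<Rightarrow> 'a list \<Rightarrow> 'q set" where
  "Y u v = step E u v I - D"

definition G :: "'q set \<Rightarrow> 'a list \<Rightarrow> 'a list \<Rightarrow> bool" where
  "G T u v \<longleftrightarrow> step E u v I \<inter> T \<noteq> {}"

definition conn :: "'q set \<Rightarrow> 'a list \<Rightarrow> 'a list \<Rightarrow> bool" where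
  "conn T = (symclp (G T))\<^sup>*\<^sup>*"

text \<open>If \<open>T\<close> consists of the states that accept a common tail, these are the
  states of \<open>D\<close> that accept \<open>w\<close> followed by that tail. Both sides read the
  same \<open>w\<close>, because states of \<open>D\<close> will have only diagonal paths.\<close>

definition pullback :: "'a list \<Rightarrow> 'q set \<Rightarrow> 'q set" where
  "pullback w T = {q \<in> D. step E w w {q} \<inter> T \<noteq> {}}"

definition special :: "'a list \<Rightarrow> bool" where
  "special u \<longleftrightarrow> (\<exists>v. Y u v \<noteq> {} \<or> Y v u \<noteq> {})"

definition V :: "nat \<Rightarrow> 'a list set" where
  "V n = {u. length u = n \<and> special u}"

definition csize :: "'q set \<Rightarrow> 'a list \<Rightarrow> nat" where
  "csize T u = card {z. conn T u z}"

text \<open>All that longer words can observe of the special words of length \<open>n\<close>: by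
  which states a pair is still joined, and connectedness for each tail set. Component sizes are left
  out, because the growing case needs an isomorphism that does not preserve them.\<close>

definition iso :: "nat \<Rightarrow> nat \<Rightarrow> ('a list \<Rightarrow> 'a list) \<Rightarrow> bool" where
  "iso n m \<phi> \<longleftrightarrow> bij_betw \<phi> (V n) (V m) \<and>
     (\<forall>u \<in> V n. \<forall>v \<in> V n. Y u v = Y (\<phi> u) (\<phi> v)) \<and>
     (\<forall>T \<subseteq> D. \<forall>u \<in> V n. \<forall>v \<in> V n. conn T u v \<longleftrightarrow> conn T (\<phi> u) (\<phi> v))"

lemma conn_refl [simp]: "conn T u u"
  by (simp add: conn_def)

lemma conn_trans [trans]: "conn T u v \<Longrightarrow> conn T v w \<Longrightarrow> conn T u w"
  by (simp add: conn_def)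

lemma conn_sym: "conn T u v \<Longrightarrow> conn T v u"
  unfolding conn_def by (rule rtranclp_symclp_sym)

lemma conn_edge: "symclp (G T) u v \<Longrightarrow> conn T u v"
  by (auto simp: conn_def)

lemma conn_step: "conn T u v \<Longrightarrow> symclp (G T) v w \<Longrightarrow> conn T u w"
  by (auto simp: conn_def)

lemma conn_induct [consumes 1, case_names refl step]:
  "conn T u v \<Longrightarrow> P u \<Longrightarrow> (\<And>y z. conn T u y \<Longrightarrow> symclp (G T) y z \<Longrightarrow> P y \<Longrightarrow> P z) \<Longrightarrow> P v"
  unfolding conn_def by (erule rtranclp_induct) auto

lemma G_length: "symclp (G T) u v \<Longrightarrow> length u = length v"
  by (auto simp: symclp_def G_def dest: step_length)

lemma conn_length: "conn T u v \<Longrightarrow> length v = length u"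
  by (induction rule: conn_induct) (auto dest: G_length)

lemma conn_class_eq: "conn T u v \<Longrightarrow> {z. conn T u z} = {z. conn T v z}"
  by (meson conn_sym conn_trans)

lemma csize_cong: "conn T u v \<Longrightarrow> csize T u = csize T v"
  unfolding csize_def by (simp add: conn_class_eq)

lemma special_if_Y: "q \<in> Y u v \<Longrightarrow> special u" "q \<in> Y u v \<Longrightarrow> special v"
  by (auto simp: special_def)

lemma Y_length: "q \<in> Y u v \<Longrightarrow> length u = length v"
  by (auto simp: Y_def dest: step_length)

lemma pullback_subset: "pullback w T \<subseteq> D"
  by (auto simp: pullback_def)

end

section \<open>How paths split when words are prolonged\<close>

locale diagonal_transducer = transducer E I D
  for E :: "('q \<times> ('a \<times> 'a) \<times> 'q) set" and I D +
  assumes closed: "(q, (a, b), q') \<in> E \<Longrightarrow> q \<in> D \<Longrightarrow> a = b \<and> q' \<in> D"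
begin

lemma step_diagonal: "q' \<in> step E w w' {q} \<Longrightarrow> q \<in> D \<Longrightarrow> w = w' \<and> q' \<in> D"
proof (induction w arbitrary: w' q')
  case Nil
  then show ?case by (cases w') auto
next
  case (Cons a w)
  obtain b v where w': "w' = b # v" using Cons.prems(1) by (cases w') auto
  then obtain p where "p \<in> step E w v {q}" "(p, (a, b), q') \<in> E" using Cons.prems(1) by auto
  with Cons.IH[of p v] Cons.prems(2) closed[of p a b q'] w' show ?case by blast
qed

text \<open>\<open>D\<close> is closed under edges, so a path ending outside \<open>D\<close> has
  avoided it all along since reading \<open>(u, v)\<close>.\<close>

lemma Y_append: "length w = length w' \<Longrightarrow> Y (w @ u) (w' @ v) = step E w w' (Y u v) - D"
proof -
  have "q \<in> step E w w' X - D \<longleftrightarrow> q \<in> step E w w' (X - D) - D" for q X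
    unfolding Diff_iff step_iff[of q E w w' X] step_iff[of q E w w' "X - D"]
    using step_diagonal by blast
  then show "length w = length w' \<Longrightarrow> ?thesis"
    unfolding Y_def by (simp only: step_append) blast
qed

text \<open>Cut the path at the state reached after \<open>(u, v)\<close>. If it lies in
  \<open>D\<close>, the rest is diagonal, which forces \<open>w = w'\<close> and turns
  \<open>T\<close> into its pullback; otherwise it lies in \<open>Y u v\<close>, and both
  \<open>u\<close> and \<open>v\<close> are special. So edges between copies attach only at special
  words.\<close>

lemma G_append:
  assumes "length w = length w'"
  shows "G T (w @ u) (w' @ v) \<longleftrightarrow>
    (w = w' \<and> G (pullback w T) u v) \<or> (\<exists>q \<in> Y u v. step E w w' {q} \<inter> T \<noteq> {})"
proof -
  have "G T (w @ u) (w' @ v) \<longleftrightarrow> (\<exists>q \<in> step E u v I. step E w w' {q} \<inter> T \<noteq> {})"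
    using step_iff[of _ E w w' "step E u v I"] by (auto simp: G_def step_append assms)
  also have "\<dots> \<longleftrightarrow> (\<exists>q \<in> step E u v I \<inter> D. step E w w' {q} \<inter> T \<noteq> {}) \<or> (\<exists>q \<in> Y u v. step E w w' {q} \<inter> T \<noteq> {})"
    by (auto simp: Y_def)
  also have "(\<exists>q \<in> step E u v I \<inter> D. step E w w' {q} \<inter> T \<noteq> {}) \<longleftrightarrow> w = w' \<and> G (pullback w T) u v"
    using step_diagonal by (auto simp: G_def pullback_def) fast+
  finally show ?thesis .
qed

lemma symclp_G_append:
  assumes "length w = length w'" "symclp (G T) (w @ u) (w' @ v)"
  obtains "w = w'" "symclp (G (pullback w T)) u v"
  | q where "q \<in> Y u v" "step E w w' {q} \<inter> T \<noteq> {}"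
  | q where "q \<in> Y v u" "step E w' w {q} \<inter> T \<noteq> {}"
  using assms by (auto simp: symclp_def G_append)

lemma conn_append: "conn (pullback w T) u v \<Longrightarrow> conn T (w @ u) (w @ v)"
proof (induction rule: conn_induct)
  case (step y z)
  then have "symclp (G T) (w @ y) (w @ z)" by (auto simp: symclp_def G_append)
  with step show ?case using conn_step by blast
qed simp

lemma Y_split:
  assumes "Y (w @ u) v \<noteq> {} \<or> Y v (w @ u) \<noteq> {}"
  obtains w' v' where "v = w' @ v'" "length w' = length w" "Y u v' \<noteq> {} \<or> Y v' u \<noteq> {}"
proof
  let ?w' = "take (length w) v" and ?v' = "drop (length w) v"
  show v: "v = ?w' @ ?v'" by simp
  show l: "length ?w' = length w" using assms Y_length by fastforce
  have "Y (w @ u) (?w' @ ?v') \<noteq> {} \<or> Y (?w' @ ?v') (w @ u) \<noteq> {}" using assms by simp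
  then show "Y u ?v' \<noteq> {} \<or> Y ?v' u \<noteq> {}"
    unfolding Y_append[OF l] Y_append[OF l[symmetric]] by auto
qed

lemma special_suffix: "special (w @ u) \<Longrightarrow> special u"
  unfolding special_def using Y_split by metis

text \<open>Leaving the copy \<open>w @ C\<close> of a component \<open>C\<close> requires a special word in \<open>C\<close>.\<close>

lemma conn_append_cases:
  assumes "conn T (w @ u) z"
  shows "(\<exists>z0. z = w @ z0 \<and> conn (pullback w T) u z0) \<or> (\<exists>u0. special u0 \<and> conn (pullback w T) u u0)"
  using assms
proof (induction rule: conn_induct)
  case (step y z)
  show ?case
  proof (cases "\<exists>u0. special u0 \<and> conn (pullback w T) u u0")
    case False
    with step obtain y0 where y: "y = w @ y0" "conn (pullback w T) u y0" by blast
    obtain w' z0 where z: "z = w' @ z0" "length w = length w'"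
      using G_length[OF step(2)] y
      by (metis append_take_drop_id length_append length_take min_absorb2 le_add1)
    from z(2) step(2)[unfolded y z(1)] show ?thesis
    proof (cases rule: symclp_G_append)
      case 1
      with y z show ?thesis using conn_step[OF y(2)] by blast
    next
      case (2 q)
      with False y(2) special_if_Y(1) show ?thesis by blast
    next
      case (3 q)
      with False y(2) special_if_Y(2) show ?thesis by blast
    qed
  qed simp
qed auto

section \<open>Isomorphisms between levels\<close>

lemma iso_bij: "iso n m \<phi> \<Longrightarrow> bij_betw \<phi> (V n) (V m)"
  and iso_Y: "iso n m \<phi> \<Longrightarrow> u \<in> V n \<Longrightarrow> v \<in> V n \<Longrightarrow> Y (\<phi> u) (\<phi> v) = Y u v"
  and iso_conn: "iso n m \<phi> \<Longrightarrow> u \<in> V n \<Longrightarrow> v \<in> V n \<Longrightarrow> T \<subseteq> D \<Longrightarrow> conn T (\<phi> u) (\<phi> v) \<longleftrightarrow> conn T u v"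
  by (auto simp: iso_def)

lemma iso_in: "iso n m \<phi> \<Longrightarrow> u \<in> V n \<Longrightarrow> \<phi> u \<in> V m"
  by (meson bij_betwE iso_def)

lemma iso_inv:
  assumes "iso n m \<phi>"
  shows "iso m n (inv_into (V n) \<phi>)"
proof -
  let ?\<psi> = "inv_into (V n) \<phi>"
  have b: "bij_betw ?\<psi> (V m) (V n)" using assms iso_bij bij_betw_inv_into by blast
  have 1: "?\<psi> u \<in> V n" "\<phi> (?\<psi> u) = u" if "u \<in> V m" for u
    using that b bij_betw_inv_into_right[OF iso_bij[OF assms]] bij_betwE by blast+
  show ?thesis
    unfolding iso_def using b 1 iso_Y[OF assms] iso_conn[OF assms] by metis
qed

text \<open>A path from \<open>w @ u\<close> is replayed from \<open>w @ \<phi> u\<close>. A vertex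
  \<open>w' @ z0\<close> of it may have a nonspecial \<open>z0\<close>, for which
  \<open>\<phi> z0\<close> is meaningless; so the invariant remembers a special \<open>u'\<close> in
  the component of \<open>z0\<close>. Edges inside a copy leave \<open>u'\<close> unchanged; the
  others join special words by a state of \<open>Y\<close>, which \<open>\<phi>\<close> preserves,
  and there \<open>z0\<close> becomes the new \<open>u'\<close>.\<close>

lemma transport:
  assumes iso: "iso n m \<phi>" and u: "u \<in> V n" and c: "conn T (w @ u) z"
  shows "\<exists>w' u' z0. z = w' @ z0 \<and> length w' = length w \<and> u' \<in> V n \<and> conn (pullback w' T) u' z0 \<and>
     conn T (w @ u) (w' @ u') \<and> conn T (w @ \<phi> u) (w' @ \<phi> u')"
  using c
proof (induction rule: conn_induct)
  case refl
  then show ?case using u by (metis conn_refl)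
next
  case (step y z)
  then obtain w' u' y0 where y: "y = w' @ y0" "length w' = length w" "u' \<in> V n"
    "conn (pullback w' T) u' y0" "conn T (w @ u) (w' @ u')" "conn T (w @ \<phi> u) (w' @ \<phi> u')" by blast
  obtain w'' z0 where z: "z = w'' @ z0" "length w' = length w''"
    using G_length[OF step(2)] y
    by (metis append_take_drop_id length_append length_take min_absorb2 le_add1)
  have n: "length y0 = n" using y conn_length by (fastforce simp: V_def)
  then have n': "length z0 = n" using y z G_length[OF step(2)] by auto
  have uz: "conn T (w @ u) z" using step conn_step by blast
  have *: ?case if sp: "special y0" "special z0"
    and e: "symclp (G T) (w' @ \<phi> y0) (w'' @ \<phi> z0)"
  proof -
    have V: "y0 \<in> V n" "z0 \<in> V n" using sp n n' by (auto simp: V_def)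
    have "conn (pullback w' T) (\<phi> u') (\<phi> y0)"
      using iso_conn[OF iso y(3) V(1) pullback_subset] y by blast
    then have "conn T (w @ \<phi> u) (w'' @ \<phi> z0)"
      using conn_append e y conn_trans conn_edge by meson
    with V z y uz show ?thesis by (intro exI[of _ w''] exI[of _ z0]) auto
  qed
  from z(2) step(2)[unfolded y z(1)] show ?case
  proof (cases rule: symclp_G_append)
    case 1
    then have "conn (pullback w' T) u' z0" using y conn_step by blast
    with 1 y z show ?thesis by (intro exI[of _ w'] exI[of _ u'] exI[of _ z0]) auto
  next
    case (2 q)
    have V: "y0 \<in> V n" "z0 \<in> V n" using 2 special_if_Y n n' by (auto simp: V_def)
    then have "q \<in> Y (\<phi> y0) (\<phi> z0)" using iso_Y[OF iso] 2 by auto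
    then show ?thesis
      using 2 z(2) by (intro *) (auto simp: symclp_def G_append special_if_Y)
  next
    case (3 q)
    have V: "y0 \<in> V n" "z0 \<in> V n" using 3 special_if_Y n n' by (auto simp: V_def)
    then have "q \<in> Y (\<phi> z0) (\<phi> y0)" using iso_Y[OF iso] 3 by auto
    then show ?thesis
      using 3 z(2) by (intro *) (auto simp: symclp_def G_append special_if_Y)
  qed
qed

text \<open>\<open>transport\<close> ends at some special \<open>u1\<close> in the pulled back
  component of \<open>u'\<close>; since \<open>\<phi>\<close> respects connectedness for the
  pullback, the last stretch from \<open>\<phi> u1\<close> to \<open>\<phi> u'\<close> can be
  added.\<close>

lemma conn_iso_append:
  assumes "iso n m \<phi>" "u \<in> V n" "u' \<in> V n" "length w = length w'" "conn T (w @ u) (w' @ u')"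
  shows "conn T (w @ \<phi> u) (w' @ \<phi> u')"
proof -
  obtain w1 u1 z where *: "w' @ u' = w1 @ z" "length w1 = length w" "u1 \<in> V n"
    "conn (pullback w1 T) u1 z" "conn T (w @ \<phi> u) (w1 @ \<phi> u1)"
    using transport[OF assms(1,2,5)] by blast
  then have "w1 = w'" "z = u'" using assms by auto
  then show ?thesis
    using * iso_conn[OF assms(1) *(3) assms(3) pullback_subset] conn_append conn_trans by blast
qed

lemma special_iso_append:
  assumes iso: "iso n m \<phi>" and u: "u \<in> V n" and s: "special (w @ u)"
  shows "special (w @ \<phi> u)"
proof -
  obtain v where v: "Y (w @ u) v \<noteq> {} \<or> Y v (w @ u) \<noteq> {}" using s by (auto simp: special_def)
  then obtain w' v0 where w: "v = w' @ v0" "length w' = length w" "Y u v0 \<noteq> {} \<or> Y v0 u \<noteq> {}"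
    by (rule Y_split)
  then have "v0 \<in> V n" using u by (auto simp: V_def dest: special_if_Y Y_length)
  then have "Y (\<phi> u) (\<phi> v0) = Y u v0" "Y (\<phi> v0) (\<phi> u) = Y v0 u" using iso_Y[OF iso] u by auto
  then have "Y (w @ \<phi> u) (w' @ \<phi> v0) \<noteq> {} \<or> Y (w' @ \<phi> v0) (w @ \<phi> u) \<noteq> {}"
    using v w by (simp add: Y_append)
  then show ?thesis by (auto simp: special_def)
qed

lemma V_add:
  "z \<in> V (n + j) \<Longrightarrow> take j z @ drop j z = z \<and> length (take j z) = j \<and> drop j z \<in> V n"
  using special_suffix[of "take j z" "drop j z"] by (auto simp: V_def)

text \<open>Lists are reversed, so \<open>drop j z\<close> is the beginning of the word:
  \<open>\<phi>\<close> rewrites the first \<open>n\<close> letters and the \<open>j\<close> letters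
  read later are kept. Connectedness is also reflected, because the inverse of \<open>\<phi>\<close>
  lifts in the same way.\<close>

lemma iso_lift:
  assumes iso: "iso n m \<phi>"
  shows "iso (n + j) (m + j) (\<lambda>z. take j z @ \<phi> (drop j z))"
proof -
  let ?\<psi> = "inv_into (V n) \<phi>"
  let ?F = "\<lambda>f z. take j z @ f (drop j z)"
  note inv = iso_inv[OF iso]
  have 1: "?F f z \<in> V (m + j)" if "iso n m f" "z \<in> V (n + j)" for n m f z
  proof -
    have "special (take j z @ f (drop j z))"
      by (rule special_iso_append[OF that(1)]) (use V_add[OF that(2)] that(2) in \<open>auto simp: V_def\<close>)
    then show ?thesis using iso_in[OF that(1)] V_add[OF that(2)] by (auto simp: V_def)
  qed
  have inv_eq: "?F ?\<psi> (?F \<phi> u) = u" if "u \<in> V (n + j)" for u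
    using V_add[OF that] bij_betw_inv_into_left[OF iso_bij[OF iso]] by auto
  have inv_eq': "?F \<phi> (?F ?\<psi> u) = u" if "u \<in> V (m + j)" for u
    using V_add[OF that] bij_betw_inv_into_right[OF iso_bij[OF iso]] by auto
  have b: "bij_betw (?F \<phi>) (V (n + j)) (V (m + j))"
    by (rule bij_betw_byWitness[where f' = "?F ?\<psi>"])
       (use 1[OF iso] 1[OF inv] inv_eq inv_eq' in blast)+
  have Y: "Y u v = Y (?F \<phi> u) (?F \<phi> v)" if "u \<in> V (n + j)" "v \<in> V (n + j)" for u v
  proof -
    note U = V_add[OF that(1)] V_add[OF that(2)]
    have "Y (take j u @ drop j u) (take j v @ drop j v) = Y (?F \<phi> u) (?F \<phi> v)"
      using iso_Y[OF iso] U by (subst (1 2) Y_append) auto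
    then show ?thesis by simp
  qed
  have C: "conn T (?F f u) (?F f v)" if "iso n m f" "u \<in> V (n + j)" "v \<in> V (n + j)" "conn T u v" for n m f u v T
    using conn_iso_append[OF that(1), of "drop j u" "drop j v" "take j u" "take j v" T]
      V_add[OF that(2)] V_add[OF that(3)] that(4) by auto
  show ?thesis
    unfolding iso_def
  proof (intro conjI b ballI allI impI)
    fix T u v assume uv: "u \<in> V (n + j)" "v \<in> V (n + j)"
    then show "Y u v = Y (?F \<phi> u) (?F \<phi> v)" by (rule Y)
    show "conn T u v = conn T (?F \<phi> u) (?F \<phi> v)"
      using C[OF iso uv, of T] C[OF inv 1[OF iso uv(1)] 1[OF iso uv(2)], of T]
      unfolding inv_eq[OF uv(1)] inv_eq[OF uv(2)] by blast
  qed
qed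

end

section \<open>Growing and nongrowing isomorphisms\<close>

context transducer
begin

definition letters :: "'a set" where
  "letters = {a. \<exists>q b q'. (q, (a, b), q') \<in> E \<or> (q, (b, a), q') \<in> E}"

abbreviation words :: "nat \<Rightarrow> 'a list set" where
  "words n \<equiv> {u. set u \<subseteq> letters \<and> length u = n}"

definition nonexpanding :: "nat \<Rightarrow> nat \<Rightarrow> ('a list \<Rightarrow> 'a list) \<Rightarrow> bool" where
  "nonexpanding n m \<phi> \<longleftrightarrow> n < m \<and> iso n m \<phi> \<and> (\<forall>T \<subseteq> D. \<forall>u \<in> V n. csize T (\<phi> u) \<le> csize T u)"

text \<open>As \<open>pullback v T = T\<close>, the words \<open>v @ z\<close> with \<open>z\<close>
  connected to \<open>u\<close> form a copy of the component of \<open>u\<close> inside that of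
  \<open>v @ u\<close>; the last two clauses provide an element \<open>w @ u'\<close> outside this
  copy. By \<open>conn T (v @ u) (\<phi> u)\<close> the situation recurs \<open>j\<close> letters
  later; \<open>u'\<close> is special so that \<open>\<phi>\<close> can carry it along.\<close>

definition expanding :: "nat \<Rightarrow> nat \<Rightarrow> ('a list \<Rightarrow> 'a list) \<Rightarrow> 'q set \<Rightarrow> 'a list \<Rightarrow> 'a list \<Rightarrow> 'a list \<Rightarrow> 'a list \<Rightarrow> bool" where
  "expanding n j \<phi> T v w u u' \<longleftrightarrow> iso n (n + j) \<phi> \<and> u \<in> V n \<and> u' \<in> V n \<and> length v = j \<and> length w = j \<and>
     pullback v T = T \<and> conn T (v @ u) (\<phi> u) \<and> conn T (v @ u) (w @ u') \<and> \<not> (w = v \<and> conn T u u')"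

lemma step_letters: "q \<in> step E u v X \<Longrightarrow> set u \<subseteq> letters \<and> set v \<subseteq> letters"
  by (induction E u v X arbitrary: q rule: step.induct) (auto simp: transducer.letters_def, blast+)

lemma conn_letters: "conn T u v \<Longrightarrow> u = v \<or> (set u \<subseteq> letters \<and> set v \<subseteq> letters)"
  by (induction rule: conn_induct) (auto simp: symclp_def G_def dest!: step_letters)

lemma V_letters: "u \<in> V n \<Longrightarrow> set u \<subseteq> letters \<and> length u = n"
  by (auto simp: V_def special_def Y_def dest: step_letters)

definition grow :: "'q set \<Rightarrow> 'a \<Rightarrow> 'a list \<Rightarrow> bool" where
  "grow T a u \<longleftrightarrow> (\<exists>z. conn T (a # u) z \<and> \<not> (\<exists>z0. z = a # z0 \<and> conn (pullback [a] T) u z0))"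

text \<open>Removing the letter read last hands it over to the tail, hence the pullback in the
  recursion.\<close>

fun growths :: "'q set \<Rightarrow> 'a list \<Rightarrow> nat" where
  "growths T [] = 0"
| "growths T (a # u) = growths (pullback [a] T) u + (if grow T a u then 1 else 0)"

end

section \<open>Component sizes at all levels\<close>

locale finite_transducer = diagonal_transducer +
  assumes finite_E: "finite E"
begin

lemma finite_letters: "finite letters"
proof -
  have "letters \<subseteq> (\<lambda>e. fst (fst (snd e))) ` E \<union> (\<lambda>e. snd (fst (snd e))) ` E"
    by (force simp: letters_def)
  then show ?thesis using finite_E finite_subset by blast
qed

lemma finite_words: "finite (words n)"
  by (rule finite_lists_length_eq[OF finite_letters])

lemma finite_V: "finite (V n)"
  by (rule finite_subset[OF _ finite_words[of n]]) (use V_letters in blast)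

lemma component_subset: "{z. conn T u z} \<subseteq> insert u (words (length u))"
  using conn_letters conn_length by blast

lemma finite_component: "finite {z. conn T u z}"
  by (rule finite_subset[OF component_subset]) (simp add: finite_words)

lemma csize_le: "csize T u \<le> Suc (card (words (length u)))"
proof -
  have "csize T u \<le> card (insert u (words (length u)))"
    unfolding csize_def by (rule card_mono) (use component_subset finite_words in auto)
  also have "\<dots> \<le> Suc (card (words (length u)))"
    by (simp add: card_insert_if finite_words)
  finally show ?thesis .
qed

text \<open>By \<open>transport\<close>, the component of \<open>w @ \<phi> u\<close> is covered by
  pieces \<open>w' @ C'\<close> that correspond to pieces \<open>w' @ C\<close> of the component of
  \<open>w @ u\<close>, where \<open>C\<close> and \<open>C'\<close> are the components of special
  words \<open>u'\<close> and \<open>\<phi> u'\<close> for a pullback of \<open>T\<close>. Each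
  \<open>C'\<close> is at most as large as \<open>C\<close>, so surjections between pieces are glued
  into one map \<open>F\<close>.\<close>

lemma csize_iso_append:
  assumes iso: "iso n m \<phi>" and le: "\<And>T u. T \<subseteq> D \<Longrightarrow> u \<in> V n \<Longrightarrow> csize T (\<phi> u) \<le> csize T u"
    and u: "u \<in> V n"
  shows "csize T (w @ \<phi> u) \<le> csize T (w @ u)"
proof -
  \<comment> \<open>Chosen from the two sets alone, so that the surjection depends on a piece and
    not on the element that describes it.\<close>
  define h where "h A B = (SOME f. B \<subseteq> f ` A)" for A B :: "'b list set"
  have h: "B \<subseteq> h A B ` A" if AB: "card B \<le> card A" "finite A" "finite B" for A B
  proof -
    obtain f where f: "f ` B \<subseteq> A" "inj_on f B"
      using card_le_inj[OF AB(3,2,1)] by blast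
    have "B \<subseteq> inv_into B f ` A"
      using f by (force simp: image_iff intro: bexI[of _ "f _"])
    then show ?thesis unfolding h_def by (rule someI[where P = "\<lambda>f. B \<subseteq> f ` A"])
  qed
  define C where "C w' z = {y. conn (pullback w' T) z y}" for w' z
  \<comment> \<open>A piece may contain several special words; fixing one makes the target piece a
    function of the source piece.\<close>
  define r where "r A = (SOME x. x \<in> V n \<inter> A)" for A
  define F where "F z = (let w' = take (length w) z; A = C w' (drop (length w) z)
      in w' @ h A (C w' (\<phi> (r A))) (drop (length w) z))" for z
  have "{z. conn T (w @ \<phi> u) z} \<subseteq> F ` {z. conn T (w @ u) z}"
  proof (intro subsetI, clarify)
    fix y assume y: "conn T (w @ \<phi> u) y"
    note \<psi> = iso_inv[OF iso]
    have left: "inv_into (V n) \<phi> (\<phi> x) = x" if "x \<in> V n" for x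
      using that iso_bij[OF iso] bij_betw_inv_into_left by fast
    obtain w' x y0 where x: "y = w' @ y0" "length w' = length w" "x \<in> V m" "conn (pullback w' T) x y0"
        "conn T (w @ inv_into (V n) \<phi> (\<phi> u)) (w' @ inv_into (V n) \<phi> x)"
      using transport[OF \<psi> iso_in[OF iso u] y] by blast
    define u' where "u' = inv_into (V n) \<phi> x"
    have u': "u' \<in> V n" "\<phi> u' = x" "conn T (w @ u) (w' @ u')"
      using x(3,5) left[OF u] iso_in[OF \<psi>] bij_betw_inv_into_right[OF iso_bij[OF iso]] by (auto simp: u'_def)
    let ?A = "C w' u'"
    have "u' \<in> V n \<inter> ?A" using u' by (simp add: C_def)
    then have rA: "r ?A \<in> V n \<inter> ?A" unfolding r_def by (rule someI)
    then have "conn (pullback w' T) (\<phi> u') (\<phi> (r ?A))"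
      using iso_conn[OF iso u'(1), of "r ?A" "pullback w' T"] pullback_subset by (auto simp: C_def)
    then have y0: "y0 \<in> C w' (\<phi> (r ?A))"
      unfolding C_def mem_Collect_eq u'(2) using x(4) conn_sym conn_trans by blast
    have "conn (pullback w' T) u' (r ?A)" using rA by (simp add: C_def)
    then have A: "?A = C w' (r ?A)" unfolding C_def by (rule conn_class_eq)
    have "card (C w' (\<phi> x)) \<le> card (C w' x)" if "x \<in> V n" for x
      using le[OF pullback_subset that] by (simp add: csize_def C_def)
    then have "card (C w' (\<phi> (r ?A))) \<le> card ?A" using rA A by (metis IntD1)
    then have "C w' (\<phi> (r ?A)) \<subseteq> h ?A (C w' (\<phi> (r ?A))) ` ?A"
      by (rule h) (auto simp: C_def finite_component)
    then obtain z0 where z0: "z0 \<in> ?A" "y0 = h ?A (C w' (\<phi> (r ?A))) z0" using y0 by blast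
    have "conn (pullback w' T) u' z0" using z0(1) by (simp add: C_def)
    then have "C w' z0 = ?A" unfolding C_def by (rule conn_class_eq[symmetric])
    then have "F (w' @ z0) = y" using x z0 by (simp add: F_def Let_def)
    moreover have "conn T (w @ u) (w' @ z0)"
      using u'(3) z0(1) conn_append conn_trans by (auto simp: C_def)
    ultimately show "y \<in> F ` {z. conn T (w @ u) z}" by blast
  qed
  then show ?thesis
    unfolding csize_def using finite_component surj_card_le by blast
qed

text \<open>Level \<open>m + j\<close> is the image of level \<open>n + j\<close> under the lifted
  isomorphism, which does not enlarge components, so by strong induction the levels below
  \<open>m\<close> bound all others.\<close>

lemma nonexpanding_bound:
  assumes "nonexpanding n m \<phi>"
  shows "\<exists>B. \<forall>k. card (V k) \<le> B \<and> (\<forall>T. \<forall>u \<in> V k. csize T u \<le> B)"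
proof -
  have nm: "n < m" and iso: "iso n m \<phi>" and le: "\<And>T u. T \<subseteq> D \<Longrightarrow> u \<in> V n \<Longrightarrow> csize T (\<phi> u) \<le> csize T u"
    using assms by (auto simp: nonexpanding_def)
  define B where "B = (\<Sum>k<m. Suc (card (words k)))"
  have small: "Suc (card (words k)) \<le> B" if "k < m" for k
    unfolding B_def using that by (intro member_le_sum) auto
  have "card (V k) \<le> B \<and> (\<forall>T. \<forall>u \<in> V k. csize T u \<le> B)" for k
  proof (induction k rule: less_induct)
    case (less k)
    show ?case
    proof (cases "k < m")
      case True
      have "card (V k) \<le> card (words k)"
        by (rule card_mono[OF finite_words]) (use V_letters in blast)
      moreover have "csize T u \<le> B" if "u \<in> V k" for T u
        using csize_le[of T u] V_letters[OF that] small[OF True] by simp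
      ultimately show ?thesis using small[OF True] by fastforce
    next
      case False
      define j where "j = k - m"
      have k: "k = m + j" "n + j < k" using False nm by (auto simp: j_def)
      let ?F = "\<lambda>z. take j z @ \<phi> (drop j z)"
      have b: "bij_betw ?F (V (n + j)) (V (m + j))" using iso_lift[OF iso] iso_bij by blast
      have "csize T u \<le> B" if "u \<in> V k" for T u
      proof -
        have "u \<in> ?F ` V (n + j)"
          using bij_betw_imp_surj_on[OF b] \<open>u \<in> V k\<close> k(1) by simp
        then obtain z where z: "u = ?F z" "z \<in> V (n + j)" by (rule imageE)
        have "csize T u \<le> csize T (take j z @ drop j z)"
          using csize_iso_append[OF iso le, of "drop j z" T "take j z"] V_add[OF z(2)] z(1) by auto
        also have "\<dots> \<le> B" using less.IH[OF k(2)] z(2) by auto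
        finally show ?thesis .
      qed
      moreover have "card (V k) \<le> B" using bij_betw_same_card[OF b] less.IH[OF k(2)] k by auto
      ultimately show ?thesis by blast
    qed
  qed
  then show ?thesis by blast
qed

text \<open>\<open>conn_iso_append\<close> moves both connections from \<open>u\<close>,
  \<open>u'\<close> to their images; \<open>v\<close>, \<open>w\<close> and \<open>T\<close> stay
  the same, so the step can be repeated forever.\<close>

lemma expanding_next:
  assumes "expanding n j \<phi> T v w u u'"
  shows "expanding (n + j) j (\<lambda>z. take j z @ \<phi> (drop j z)) T v w (\<phi> u) (\<phi> u')"
proof -
  let ?F = "\<lambda>z. take j z @ \<phi> (drop j z)"
  from assms have iso: "iso n (n + j) \<phi>" and u: "u \<in> V n" "u' \<in> V n" and l: "length v = j" "length w = j"
    and T: "pullback v T = T" and c: "conn T (v @ u) (\<phi> u)" "conn T (v @ u) (w @ u')"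
    and ne: "\<not> (w = v \<and> conn T u u')"
    by (auto simp: expanding_def)
  have TD: "T \<subseteq> D" using T pullback_subset by blast
  have in': "\<phi> u \<in> V (n + j)" "\<phi> u' \<in> V (n + j)" using iso_in[OF iso] u by auto
  have "conn T (v @ u) (take j (\<phi> u) @ drop j (\<phi> u))" using c by simp
  then have "conn T (v @ \<phi> u) (?F (\<phi> u))"
    using conn_iso_append[OF iso u(1), of "drop j (\<phi> u)" v "take j (\<phi> u)" T] V_add[OF in'(1)] l by auto
  moreover have "conn T (v @ \<phi> u) (w @ \<phi> u')"
    using conn_iso_append[OF iso u, of v w T] l c by auto
  moreover have "\<not> (w = v \<and> conn T (\<phi> u) (\<phi> u'))" using ne iso_conn[OF iso u TD] by auto
  ultimately show ?thesis
    unfolding expanding_def using iso_lift[OF iso] in' l T by (auto simp: add_ac)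
qed

text \<open>Invariant: the component of \<open>u\<close> followed by \<open>k\<close> copies of
  \<open>v\<close> contains a special word \<open>x\<close> from which the growing situation starts
  again. One more \<open>v\<close> copies the component and adds \<open>w @ x'\<close>, which is
  outside the copy because \<open>x\<close> and \<open>x'\<close> are not connected if
  \<open>w = v\<close>.\<close>

lemma expanding_unbounded:
  assumes "expanding n j \<phi> T v w u u'"
  shows "k < csize T (((@) v ^^ k) u)"
proof -
  have "\<exists>n \<phi> x x'. expanding n j \<phi> T v w x x' \<and> conn T (((@) v ^^ k) u) x \<and> k < csize T (((@) v ^^ k) u)"
  proof (induction k)
    case 0
    have "card {u} \<le> csize T u" unfolding csize_def by (rule card_mono[OF finite_component]) auto
    then show ?case using assms by (intro exI[of _ n] exI[of _ \<phi>] exI[of _ u] exI[of _ u']) auto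
  next
    case (Suc k)
    then obtain n \<phi> x x' where *: "expanding n j \<phi> T v w x x'" "conn T (((@) v ^^ k) u) x"
      "k < csize T (((@) v ^^ k) u)" by blast
    let ?z = "((@) v ^^ k) u"
    from *(1) have l: "length v = j" "length w = j"
      and T: "pullback v T = T" and c: "conn T (v @ x) (\<phi> x)" "conn T (v @ x) (w @ x')"
      and ne: "\<not> (w = v \<and> conn T x x')"
      by (auto simp: expanding_def)
    have vz: "conn T (v @ ?z) (v @ y)" if "conn T ?z y" for y
      using conn_append[of v T ?z y] that T by simp
    have "insert (w @ x') ((@) v ` {y. conn T ?z y}) \<subseteq> {y. conn T (v @ ?z) y}"
      using vz c(2) vz[OF *(2)] conn_trans by blast
    then have "card (insert (w @ x') ((@) v ` {y. conn T ?z y})) \<le> csize T (v @ ?z)"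
      unfolding csize_def by (rule card_mono[OF finite_component])
    moreover have "w @ x' \<notin> (@) v ` {y. conn T ?z y}"
    proof
      assume "w @ x' \<in> (@) v ` {y. conn T ?z y}"
      then have "w = v" "conn T ?z x'" using l by auto
      then show False using ne *(2) conn_sym conn_trans by blast
    qed
    moreover have "card ((@) v ` {y. conn T ?z y}) = csize T ?z"
      unfolding csize_def by (rule card_image) (auto simp: inj_on_def)
    ultimately have "Suc k < csize T (v @ ?z)"
      using *(3) finite_component by (simp add: card_insert_if)
    moreover have "conn T (v @ ?z) (\<phi> x)" using vz[OF *(2)] c(1) conn_trans by blast
    ultimately show ?case using expanding_next[OF *(1)] by auto
  qed
  then show ?thesis by blast
qed

section \<open>Counting growths\<close>

lemma pullback_append: "pullback (w @ w') T = pullback w' (pullback w T)"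
proof -
  have "step E (w @ w') (w @ w') {q} \<inter> T \<noteq> {} \<longleftrightarrow> step E w' w' {q} \<inter> pullback w T \<noteq> {}" if "q \<in> D" for q
    using step_diagonal[OF _ that, of _ w' w'] step_iff[of _ E w w "step E w' w' {q}"]
    unfolding step_append[OF refl] pullback_def by blast
  then show ?thesis by (auto simp: pullback_def)
qed

lemma pullback_Nil: "T \<subseteq> D \<Longrightarrow> pullback [] T = T"
  by (auto simp: pullback_def)

lemma grow_special:
  assumes "grow T a u"
  obtains u0 where "special u0" "conn (pullback [a] T) u u0" "a \<in> letters"
proof -
  obtain z where z: "conn T (a # u) z" "\<not> (\<exists>z0. z = a # z0 \<and> conn (pullback [a] T) u z0)"
    using assms by (auto simp: grow_def)
  then have "z \<noteq> a # u" by auto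
  then have "a \<in> letters" using conn_letters[OF z(1)] by auto
  with that show ?thesis using conn_append_cases[of T "[a]" u z] z by auto
qed

text \<open>Growth depends on the component only: were \<open>b # v\<close> not growing, its
  component would be a copy containing \<open>a # u\<close>, so \<open>a = b\<close>, and
  \<open>a # u\<close> would not grow either.\<close>

lemma grow_conn:
  assumes "conn T (a # u) (b # v)" "grow T a u"
  shows "grow T b v"
proof (rule ccontr)
  assume n: "\<not> grow T b v"
  then have *: "\<exists>z0. z = b # z0 \<and> conn (pullback [b] T) v z0" if "conn T (b # v) z" for z
    using that by (auto simp: grow_def)
  have "a = b" "conn (pullback [b] T) v u" using *[OF conn_sym[OF assms(1)]] by auto
  moreover obtain z where z: "conn T (a # u) z" "\<not> (\<exists>z0. z = a # z0 \<and> conn (pullback [a] T) u z0)"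
    using assms by (auto simp: grow_def)
  moreover have "\<exists>z0. z = b # z0 \<and> conn (pullback [b] T) v z0"
    using * assms(1) z(1) conn_sym conn_trans by blast
  ultimately show False using conn_sym conn_trans by blast
qed

text \<open>Without growth the component is a copy of one for shorter words. At a growth every
  element \<open>b # y\<close> grows too, so \<open>y\<close> is connected to a special
  \<open>x\<close>; the pairs \<open>(b, x)\<close> index at most \<open>card letters * K\<close>
  pieces that cover the component, each with one growth less. The summand 1 keeps the powers
  positive for the empty word.\<close>

lemma csize_le_growths:
  assumes K: "\<And>n. card (V n) \<le> K"
  shows "(\<And>z. conn T u z \<Longrightarrow> growths T z \<le> r) \<Longrightarrow> csize T u \<le> (card letters * K + 1) ^ r"
proof (induction "length u" arbitrary: u T r)
  case 0
  have "{z. conn T [] z} = {[]}" using conn_length by force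
  then show ?case using 0 by (simp add: csize_def)
next
  case (Suc n)
  obtain a t where ux: "u = a # t" "length t = n" using Suc.hyps(2) by (cases u) auto
  have IH: "csize T x \<le> (card letters * K + 1) ^ r" if "length x = n" "\<And>z. conn T x z \<Longrightarrow> growths T z \<le> r" for T x r
    using Suc.hyps(1)[of x T r] that by blast
  have prems: "growths T z \<le> r" if "conn T (a # t) z" for z using Suc.prems that ux by blast
  let ?M = "card letters * K + 1"
  show ?case
  proof (cases "grow T a t")
    case False
    then have *: "\<exists>z0. z = a # z0 \<and> conn (pullback [a] T) t z0" if "conn T (a # t) z" for z
      using that by (auto simp: grow_def)
    have up: "conn T (a # t) (a # z)" if "conn (pullback [a] T) t z" for z
      using conn_append[OF that] by simp
    have "{z. conn T (a # t) z} = Cons a ` {z. conn (pullback [a] T) t z}" using * up by auto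
    then have "csize T (a # t) = csize (pullback [a] T) t"
      unfolding csize_def by (simp add: card_image)
    moreover have "growths (pullback [a] T) z \<le> r" if "conn (pullback [a] T) t z" for z
      using prems[OF up[OF that]] by simp
    ultimately show ?thesis using IH[OF ux(2), of "pullback [a] T" r] ux by simp
  next
    case True
    then obtain r' where r: "r = Suc r'" using prems[of "a # t"] by (cases r) auto
    define P where "P = {(b, x). b \<in> letters \<and> x \<in> V (length t) \<and> conn T (a # t) (b # x)}"
    have P: "P \<subseteq> letters \<times> V (length t)" by (auto simp: P_def)
    then have fP: "finite P" using finite_letters finite_V finite_subset by blast
    have "card P \<le> card letters * card (V (length t))"
      using card_mono[OF _ P] finite_letters finite_V by (simp add: card_cartesian_product)
    then have cP: "card P \<le> card letters * K" using K by (meson le_trans mult_le_mono2)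
    let ?C = "\<lambda>p. Cons (fst p) ` {z. conn (pullback [fst p] T) (snd p) z}"
    have cov: "{z. conn T (a # t) z} \<subseteq> (\<Union>p \<in> P. ?C p)"
    proof
      fix z assume "z \<in> {z. conn T (a # t) z}"
      then have z: "conn T (a # t) z" by simp
      then obtain b y where y: "z = b # y" using conn_length by (cases z) fastforce+
      obtain x where x: "special x" "conn (pullback [b] T) y x" "b \<in> letters"
        using grow_special grow_conn z True y by metis
      have "conn T (b # y) (b # x)" using conn_append[OF x(2)] by simp
      then have "conn T (a # t) (b # x)" using z y conn_trans by blast
      moreover have "length x = length t" using conn_length[OF x(2)] conn_length[OF z] y by simp
      ultimately have "(b, x) \<in> P" using x by (auto simp: P_def V_def)
      moreover have "z \<in> ?C (b, x)" using x conn_sym y by auto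
      ultimately show "z \<in> (\<Union>p \<in> P. ?C p)" by blast
    qed
    have piece: "card (?C p) \<le> ?M ^ r'" if "p \<in> P" for p
    proof -
      obtain b x where p: "p = (b, x)" "conn T (a # t) (b # x)" "length x = length t"
        using \<open>p \<in> P\<close> by (auto simp: P_def V_def)
      have "growths (pullback [b] T) z \<le> r'" if "conn (pullback [b] T) x z" for z
      proof -
        have "conn T (b # x) (b # z)" using conn_append[OF that] by simp
        then have c: "conn T (a # t) (b # z)" using p conn_trans by blast
        with True grow_conn have "grow T b z" by blast
        then show ?thesis using prems[OF c] r by simp
      qed
      then have "csize (pullback [b] T) x \<le> ?M ^ r'"
        using IH[of x] p(3) ux(2) by simp
      then show ?thesis by (simp add: card_image p csize_def)
    qed
    have "csize T (a # t) \<le> card (\<Union>p \<in> P. ?C p)"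
      unfolding csize_def by (rule card_mono) (use cov fP finite_component in auto)
    also have "\<dots> \<le> (\<Sum>p \<in> P. card (?C p))" by (rule card_UN_le[OF fP])
    also have "\<dots> \<le> card P * ?M ^ r'" using sum_bounded_above[of P "\<lambda>p. card (?C p)"] piece by simp
    also have "\<dots> \<le> ?M * ?M ^ r'" using cP by (intro mult_le_mono1) auto
    finally show ?thesis using r ux by simp
  qed
qed

lemma growths_card:
  "T \<subseteq> D \<Longrightarrow> growths T z = card {i. i < length z \<and> grow (pullback (take i z) T) (z ! i) (drop (Suc i) z)}"
proof (induction z arbitrary: T)
  case (Cons a z)
  let ?S = "\<lambda>T z. {i. i < length z \<and> grow (pullback (take i z) T) (z ! i) (drop (Suc i) z)}"
  have "?S T (a # z) = (if grow T a z then {0} else {}) \<union> Suc ` ?S (pullback [a] T) z"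
    (is "_ = ?R")
  proof (intro set_eqI)
    fix i
    show "i \<in> ?S T (a # z) \<longleftrightarrow> i \<in> ?R"
    proof (cases i)
      case 0
      then show ?thesis using pullback_Nil[OF Cons.prems] by auto
    next
      case (Suc k)
      then show ?thesis using pullback_append[of "[a]" "take k z" T] by auto
    qed
  qed
  moreover have "card ?R = (if grow T a z then 1 else 0) + card (Suc ` ?S (pullback [a] T) z)"
    by (subst card_Un_disjoint) auto
  ultimately show ?case using Cons.IH[OF pullback_subset] by (simp add: card_image)
qed simp

end

section \<open>Repetition of configurations\<close>

text \<open>The names \<open>\<nu> n\<close> turn the finite structure on the special words of length \<open>n\<close>
  into an element of a finite set that does not depend on \<open>n\<close>.\<close>

locale named_transducer = finite_transducer +
  fixes K :: nat and \<nu> :: "nat \<Rightarrow> 'b list \<Rightarrow> nat"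
  assumes finite_I: "finite I" and finite_D: "finite D"
    and name_inj: "inj_on (\<nu> n) (V n)" and name_less: "\<nu> n ` V n \<subseteq> {..<K}"
begin

definition config where
  "config n = (\<nu> n ` V n, {(\<nu> n u, \<nu> n v, q) | u v q. u \<in> V n \<and> v \<in> V n \<and> q \<in> Y u v},
     {(T, \<nu> n u, \<nu> n v) | T u v. T \<subseteq> D \<and> u \<in> V n \<and> v \<in> V n \<and> conn T u v})"

text \<open>Words with equal names are matched. That names are kept is recorded because it later
  identifies the image of a chosen special word.\<close>

lemma config_iso:
  assumes "config n = config m"
  obtains \<phi> where "iso n m \<phi>" "\<And>u. u \<in> V n \<Longrightarrow> \<nu> m (\<phi> u) = \<nu> n u"
proof
  let ?\<phi> = "inv_into (V m) (\<nu> m) \<circ> \<nu> n"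
  have im: "\<nu> n ` V n = \<nu> m ` V m"
    and Y: "{(\<nu> n u, \<nu> n v, q) | u v q. u \<in> V n \<and> v \<in> V n \<and> q \<in> Y u v} =
      {(\<nu> m u, \<nu> m v, q) | u v q. u \<in> V m \<and> v \<in> V m \<and> q \<in> Y u v}" (is "?Y n = ?Y m")
    and C: "{(T, \<nu> n u, \<nu> n v) | T u v. T \<subseteq> D \<and> u \<in> V n \<and> v \<in> V n \<and> conn T u v} =
      {(T, \<nu> m u, \<nu> m v) | T u v. T \<subseteq> D \<and> u \<in> V m \<and> v \<in> V m \<and> conn T u v}" (is "?C n = ?C m")
    using assms by (auto simp: config_def)
  have b: "bij_betw (\<nu> n) (V n) (\<nu> n ` V n)" for n
    using name_inj by (auto simp: bij_betw_def)
  have bij: "bij_betw ?\<phi> (V n) (V m)"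
    using bij_betw_trans[OF b[of n, unfolded im] bij_betw_inv_into[OF b[of m]]] .
  show eq: "\<nu> m (?\<phi> u) = \<nu> n u" if "u \<in> V n" for u
    using that im by (auto intro!: f_inv_into_f)
  have Y': "(\<nu> n u, \<nu> n v, q) \<in> ?Y n \<longleftrightarrow> q \<in> Y u v" if "u \<in> V n" "v \<in> V n" for n u v q
    using that by (auto dest!: inj_onD[OF name_inj])
  have C': "(T, \<nu> n u, \<nu> n v) \<in> ?C n \<longleftrightarrow> conn T u v" if "u \<in> V n" "v \<in> V n" "T \<subseteq> D" for n u v T
    using that by (auto dest!: inj_onD[OF name_inj])
  have \<phi>: "?\<phi> u \<in> V m" if "u \<in> V n" for u using that bij bij_betwE by blast
  show "iso n m ?\<phi>"
    unfolding iso_def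
  proof (intro conjI bij ballI allI impI)
    fix u v assume uv: "u \<in> V n" "v \<in> V n"
    show "Y u v = Y (?\<phi> u) (?\<phi> v)"
    proof (rule set_eqI)
      fix q
      have "q \<in> Y u v \<longleftrightarrow> (\<nu> n u, \<nu> n v, q) \<in> ?Y n" by (rule Y'[OF uv, symmetric])
      also have "\<dots> \<longleftrightarrow> (\<nu> m (?\<phi> u), \<nu> m (?\<phi> v), q) \<in> ?Y m"
        by (simp only: eq[OF uv(1)] eq[OF uv(2)] Y)
      also have "\<dots> \<longleftrightarrow> q \<in> Y (?\<phi> u) (?\<phi> v)" by (rule Y'[OF \<phi>[OF uv(1)] \<phi>[OF uv(2)]])
      finally show "q \<in> Y u v \<longleftrightarrow> q \<in> Y (?\<phi> u) (?\<phi> v)" .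
    qed
    show "conn T u v \<longleftrightarrow> conn T (?\<phi> u) (?\<phi> v)" if T: "T \<subseteq> D" for T
    proof -
      have "conn T u v \<longleftrightarrow> (T, \<nu> n u, \<nu> n v) \<in> ?C n" by (rule C'[OF uv T, symmetric])
      also have "\<dots> \<longleftrightarrow> (T, \<nu> m (?\<phi> u), \<nu> m (?\<phi> v)) \<in> ?C m"
        by (simp only: eq[OF uv(1)] eq[OF uv(2)] C)
      also have "\<dots> \<longleftrightarrow> conn T (?\<phi> u) (?\<phi> v)" by (rule C'[OF \<phi>[OF uv(1)] \<phi>[OF uv(2)] T])
      finally show ?thesis .
    qed
  qed
qed

lemma finite_config: "finite (range config)"
proof -
  let ?Q = "I \<union> (\<lambda>e. snd (snd e)) ` E"
  have "q \<in> ?Q" if "q \<in> step E u v I" for u v q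
    using that by (induction E u v I arbitrary: q rule: step.induct) force+
  then have "Y u v \<subseteq> ?Q" for u v by (auto simp: Y_def)
  then have "range config \<subseteq> Pow {..<K} \<times> Pow ({..<K} \<times> {..<K} \<times> ?Q) \<times> Pow (Pow D \<times> {..<K} \<times> {..<K})"
    using name_less by (fastforce simp: config_def image_subset_iff)
  moreover have "finite ?Q" using finite_I finite_E by simp
  ultimately show ?thesis using finite_D by (meson finite_Pow_iff finite_SigmaI finite_lessThan finite_subset)
qed

lemma card_V_le: "card (V n) \<le> K"
  using card_inj_on_le[OF name_inj name_less] by simp

text \<open>Pigeonhole over the growth positions \<open>S\<close>. The letters read before position
  \<open>i\<close> form \<open>drop (Suc i) z\<close>, of length \<open>L i\<close>, with tail set
  \<open>T' i\<close> and a special word \<open>r i\<close> in its component. Let positions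
  \<open>i < i'\<close> have equal data and let \<open>v\<close> be the factor between them. Equal
  tail sets give \<open>pullback v (T' i) = T' i\<close>, equal configurations give
  \<open>\<phi>\<close> from level \<open>L i'\<close> to level \<open>L i\<close>, and equal names
  give \<open>\<phi> (r i') = r i\<close>.\<close>

lemma growths_expanding:
  assumes T: "T \<subseteq> D" and large: "card (range config \<times> Pow D \<times> {..<K}) < growths T z"
  shows "\<exists>n j \<phi> T v w u u'. expanding n j \<phi> T v w u u'"
proof -
  define S where "S = {i. i < length z \<and> grow (pullback (take i z) T) (z ! i) (drop (Suc i) z)}"
  define L where "L i = length z - Suc i" for i
  define T' where "T' i = pullback (take (Suc i) z) T" for i
  have T'': "T' i = pullback [z ! i] (pullback (take i z) T)" if "i < length z" for i
    unfolding T'_def using that by (simp add: take_Suc_conv_app_nth pullback_append)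
  define r where "r i = (SOME x. special x \<and> conn (T' i) (drop (Suc i) z) x)" for i
  have r: "r i \<in> V (L i) \<and> conn (T' i) (drop (Suc i) z) (r i)" if "i \<in> S" for i
  proof -
    have "\<exists>x. special x \<and> conn (T' i) (drop (Suc i) z) x"
      using that grow_special T'' unfolding S_def by (metis (mono_tags, lifting) mem_Collect_eq)
    then have "special (r i) \<and> conn (T' i) (drop (Suc i) z) (r i)"
      unfolding r_def by (rule someI_ex)
    then show ?thesis using conn_length by (fastforce simp: V_def L_def)
  qed
  define f where "f i = (config (L i), T' i, \<nu> (L i) (r i))" for i
  have "f ` S \<subseteq> range config \<times> Pow D \<times> {..<K}"
    using r name_less pullback_subset by (fastforce simp: f_def T'_def)
  then have "card (f ` S) \<le> card (range config \<times> Pow D \<times> {..<K})"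
    by (intro card_mono) (auto simp: finite_config finite_D)
  also have "\<dots> < card S" using large growths_card[OF T] by (simp add: S_def)
  finally have "\<not> inj_on f S" using card_image by fastforce
  then obtain i i' where S: "i \<in> S" "i' \<in> S" "f i = f i'" "i < i'"
    unfolding inj_on_def by (metis linorder_neqE_nat)
  have len: "i' < length z" using S by (auto simp: S_def)
  define j where "j = i' - i"
  define v where "v = take j (drop (Suc i) z)"
  \<comment> \<open>\<open>v\<close> without its first letter in reading order, which is the growing
    letter \<open>z ! i'\<close>.\<close>
  define v2 where "v2 = take (j - 1) (drop (Suc i) z)"
  define x where "x = drop (Suc i') z"
  have dv: "drop (Suc i) z = v @ x"
  proof -
    have "x = drop j (drop (Suc i) z)" using S(4) by (simp add: x_def j_def)
    then show ?thesis unfolding v_def by (simp only: append_take_drop_id)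
  qed
  have lv: "length v = j" unfolding v_def j_def using len by simp
  have vv2: "v = v2 @ [z ! i']"
  proof -
    have "j = Suc (j - 1)" using S(4) by (simp add: j_def)
    moreover have "drop (Suc i) z ! (j - 1) = z ! i'" using S(4) len by (simp add: j_def)
    moreover have "j - 1 < length (drop (Suc i) z)" using len S(4) by (simp add: j_def)
    ultimately show ?thesis
      unfolding v_def v2_def using take_Suc_conv_app_nth[of "j - 1" "drop (Suc i) z"] by simp
  qed
  have ti: "take i' z = take (Suc i) z @ v2"
    unfolding v2_def take_add[symmetric] using S(4) by (simp add: j_def)
  have Teq: "T' i = T' i'" and conf: "config (L i') = config (L i)" and neq: "\<nu> (L i) (r i) = \<nu> (L i') (r i')"
    using S(3) by (auto simp: f_def)
  have T1: "pullback (take i' z) T = pullback v2 (T' i)" by (simp add: ti pullback_append T'_def)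
  have pT: "pullback v (T' i) = T' i"
    using T''[OF len] T1 Teq vv2 by (simp add: pullback_append)
  obtain \<phi> where iso: "iso (L i') (L i) \<phi>" and \<phi>: "\<And>u. u \<in> V (L i') \<Longrightarrow> \<nu> (L i) (\<phi> u) = \<nu> (L i') u"
    using config_iso[OF conf] by blast
  note ri = r[OF S(1)] r[OF S(2)]
  have \<phi>r: "\<phi> (r i') = r i"
    using inj_onD[OF name_inj, of "L i"] \<phi> neq ri iso_in[OF iso] by metis
  have Li: "L i = L i' + j" using S(4) len by (simp add: L_def j_def)
  let ?T1 = "pullback (take i' z) T"
  \<comment> \<open>The growth at \<open>i'\<close> reaches some \<open>b # y0\<close> outside the
    copy. Growth is shared by the component, so \<open>y0\<close> is connected to a special word
    \<open>u'\<close>; replacing the first letter of \<open>v\<close> by \<open>b\<close> gives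
    \<open>w\<close>.\<close>
  have g: "grow ?T1 (z ! i') x" using S(2) by (simp add: S_def x_def)
  then obtain y where y: "conn ?T1 (z ! i' # x) y" "\<not> (\<exists>z0. y = z ! i' # z0 \<and> conn (pullback [z ! i'] ?T1) x z0)"
    by (auto simp: grow_def)
  obtain b y0 where yb: "y = b # y0" using conn_length[OF y(1)] by (cases y) auto
  then obtain u' where u': "special u'" "conn (pullback [b] ?T1) y0 u'"
    using grow_special grow_conn y(1) g by metis
  have "conn ?T1 (b # y0) (b # u')" using conn_append[OF u'(2)] by simp
  then have cu': "conn (pullback v2 (T' i)) (z ! i' # x) (b # u')" using y(1) yb T1 conn_trans by metis
  define w where "w = v2 @ [b]"
  have lw: "length w = j" using lv vv2 by (simp add: w_def)
  have lu': "u' \<in> V (L i')"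
    using u' conn_length[OF u'(2)] conn_length[OF y(1)] yb len by (simp add: V_def L_def x_def)
  have rx: "conn (T' i) x (r i')" using ri(2) Teq by (simp add: x_def)
  have vx: "conn (T' i) (v @ r i') (v @ x)"
    by (rule conn_append) (use pT rx conn_sym in simp)
  have "conn (T' i) (v @ r i') (\<phi> (r i'))"
    using vx ri(1) conn_trans \<phi>r unfolding dv by metis
  moreover have "conn (T' i) (v @ r i') (w @ u')"
    using conn_trans[OF vx, of "w @ u'"] conn_append[OF cu'] by (simp add: vv2 w_def)
  moreover have "\<not> (w = v \<and> conn (T' i) (r i') u')"
  proof
    assume a: "w = v \<and> conn (T' i) (r i') u'"
    then have b: "b = z ! i'" by (simp add: vv2 w_def)
    have "pullback [b] ?T1 = T' i" using T''[OF len] Teq b by simp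
    then have "conn (pullback [b] ?T1) x y0" using u' a rx conn_trans conn_sym by metis
    then show False using y(2) yb b by auto
  qed
  ultimately have "expanding (L i') j \<phi> (T' i) v w (r i') u'"
    unfolding expanding_def using iso Li ri lu' lv lw pT by auto
  then show ?thesis by blast
qed

text \<open>With bounded sizes, configurations decorated by the sizes still range over a finite set.
  If those of two levels agree, the isomorphism that keeps names also preserves sizes.\<close>

lemma nonexpanding_exists:
  assumes B: "\<And>T u. T \<subseteq> D \<Longrightarrow> csize T u \<le> B"
  shows "\<exists>n m \<phi>. nonexpanding n m \<phi>"
proof -
  define g where "g n = (config n, {(T, \<nu> n u, csize T u) | T u. T \<subseteq> D \<and> u \<in> V n})" for n
  have "range g \<subseteq> range config \<times> Pow (Pow D \<times> {..<K} \<times> {..B})"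
    using B name_less by (fastforce simp: g_def)
  moreover have "finite (range config \<times> Pow (Pow D \<times> {..<K} \<times> {..B}))"
    using finite_config finite_D by simp
  ultimately have "\<not> inj g" using finite_subset infinite_UNIV_nat finite_imageD by blast
  then obtain n m where nm: "n < m" "g n = g m"
    unfolding inj_on_def by (metis linorder_neqE_nat)
  then obtain \<phi> where iso: "iso n m \<phi>" and \<phi>: "\<And>u. u \<in> V n \<Longrightarrow> \<nu> m (\<phi> u) = \<nu> n u"
    using config_iso[of n m] by (auto simp: g_def)
  have "csize T (\<phi> u) = csize T u" if "T \<subseteq> D" "u \<in> V n" for T u
  proof -
    have "(T, \<nu> n u, csize T u) \<in> {(T, \<nu> n u, csize T u) | T u. T \<subseteq> D \<and> u \<in> V n}" using that by blast
    also have "\<dots> = {(T, \<nu> m u, csize T u) | T u. T \<subseteq> D \<and> u \<in> V m}" using nm by (auto simp: g_def)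
    finally obtain u' where u': "u' \<in> V m" "\<nu> m u' = \<nu> n u" "csize T u' = csize T u" by auto
    then have "\<phi> u = u'" using \<phi>[OF that(2)] iso_in[OF iso that(2)] inj_onD[OF name_inj[of m]] by auto
    then show ?thesis using u' by simp
  qed
  then have "nonexpanding n m \<phi>" using nm iso by (simp add: nonexpanding_def)
  then show ?thesis by blast
qed

theorem expanding_or_nonexpanding: "(\<exists>n j \<phi> T v w u u'. expanding n j \<phi> T v w u u') \<or> (\<exists>n m \<phi>. nonexpanding n m \<phi>)"
proof (cases "\<exists>T z. T \<subseteq> D \<and> card (range config \<times> Pow D \<times> {..<K}) < growths T z")
  case True
  then show ?thesis using growths_expanding by blast
next
  case False
  then have "csize T u \<le> (card letters * K + 1) ^ card (range config \<times> Pow D \<times> {..<K})" if "T \<subseteq> D" for T u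
    using that by (intro csize_le_growths card_V_le) (meson not_le)
  then show ?thesis using nonexpanding_exists by blast
qed

end

section \<open>Infinite words\<close>

definition rprefix :: "(nat \<Rightarrow> 'a) \<Rightarrow> nat \<Rightarrow> 'a list" where
  "rprefix x n = rev (map x [0..<n])"

definition shift :: "nat \<Rightarrow> (nat \<Rightarrow> 'a) \<Rightarrow> nat \<Rightarrow> 'a" where
  "shift n x i = x (n + i)"

text \<open>\<open>u\<close> is reversed, so \<open>conc (w @ u) x\<close> reads \<open>u\<close>,
  then \<open>w\<close>, then \<open>x\<close>.\<close>

definition conc :: "'a list \<Rightarrow> (nat \<Rightarrow> 'a) \<Rightarrow> nat \<Rightarrow> 'a" where
  "conc u x i = (if i < length u then rev u ! i else x (i - length u))"

lemma rprefix_0 [simp]: "rprefix x 0 = []" and rprefix_Suc: "rprefix x (Suc n) = x n # rprefix x n"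
  and length_rprefix [simp]: "length (rprefix x n) = n"
  by (auto simp: rprefix_def)

lemma rprefix_eq_iff: "rprefix x n = rprefix y n \<longleftrightarrow> (\<forall>i<n. x i = y i)"
  by (induction n) (auto simp: rprefix_Suc less_Suc_eq)

lemma rprefix_add: "rprefix x (n + k) = rprefix (shift n x) k @ rprefix x n"
  by (induction k) (auto simp: rprefix_Suc shift_def)

lemma shift_0 [simp]: "shift 0 x = x"
  by (auto simp: shift_def)

lemma shift_shift: "shift n (shift m x) = shift (m + n) x"
  by (auto simp: shift_def add_ac)

lemma conc_Nil [simp]: "conc [] x = x"
  by (auto simp: conc_def)

lemma conc_Cons: "conc (a # u) x = conc u (case_nat a x)"
proof
  fix i
  consider "i < length u" | "i = length u" | j where "i = Suc (length u + j)"
    by (metis less_iff_Suc_add linorder_neqE_nat)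
  then show "conc (a # u) x i = conc u (case_nat a x) i"
    by cases (auto simp: conc_def nth_append)
qed

lemma conc_append: "conc (w @ u) x = conc u (conc w x)"
  by (induction w arbitrary: x) (auto simp: conc_Cons)

lemma conc_rprefix: "conc (rprefix x n) (shift n x) = x"
  by (auto simp: conc_def rprefix_def shift_def rev_nth fun_eq_iff)

lemma conc_inj: "length u = length v \<Longrightarrow> conc u x = conc v x \<Longrightarrow> u = v"
proof -
  assume l: "length u = length v" and e: "conc u x = conc v x"
  have "rev u ! i = rev v ! i" if "i < length u" for i
    using fun_cong[OF e, of i] that l by (auto simp: conc_def)
  then have "rev u = rev v" by (intro nth_equalityI) (auto simp: l)
  then show ?thesis by simp
qed

lemma finite_inj_rprefix:
  assumes "finite F"
  shows "\<exists>n. \<forall>N\<ge>n. inj_on (\<lambda>x. rprefix x N) F"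
proof -
  \<comment> \<open>The first difference of two words; for equal words \<open>LEAST\<close> has an
    arbitrary value, which can only enlarge the bound.\<close>
  let ?d = "\<lambda>p. LEAST i. fst p i \<noteq> snd p i"
  have "finite (?d ` (F \<times> F))" using assms by simp
  then obtain n where n: "\<And>p. p \<in> F \<times> F \<Longrightarrow> ?d p < n"
    unfolding finite_nat_set_iff_bounded by blast
  have "x = y" if "x \<in> F" "y \<in> F" "rprefix x N = rprefix y N" "n \<le> N" for x y N
  proof (rule ccontr)
    assume "x \<noteq> y"
    then have "\<exists>i. x i \<noteq> y i" by auto
    then have "x (?d (x, y)) \<noteq> y (?d (x, y))" unfolding fst_conv snd_conv by (rule LeastI_ex)
    then show False using n[of "(x, y)"] that by (auto simp: rprefix_eq_iff)
  qed
  then show ?thesis by (auto simp: inj_on_def)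
qed

section \<open>Runs over pairs of infinite words\<close>

definition run :: "('q \<times> ('a \<times> 'a) \<times> 'q) set \<Rightarrow> 'q \<Rightarrow> (nat \<Rightarrow> 'a) \<Rightarrow> (nat \<Rightarrow> 'a) \<Rightarrow> bool" where
  "run E q x y \<longleftrightarrow> (\<exists>s. s 0 = q \<and> (\<forall>i. (s i, (x i, y i), s (Suc i)) \<in> E))"

definition rel :: "('q \<times> ('a \<times> 'a) \<times> 'q) set \<Rightarrow> 'q set \<Rightarrow> (nat \<Rightarrow> 'a) \<Rightarrow> (nat \<Rightarrow> 'a) \<Rightarrow> bool" where
  "rel E I x y \<longleftrightarrow> (\<exists>q \<in> I. run E q x y)"

abbreviation component :: "('x \<Rightarrow> 'x \<Rightarrow> bool) \<Rightarrow> 'x \<Rightarrow> 'x set" where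
  "component R x \<equiv> {y. (symclp R)\<^sup>*\<^sup>* x y}"

lemma run_Cons: "(p, (a, b), q) \<in> E \<Longrightarrow> run E q x y \<Longrightarrow> run E p (case_nat a x) (case_nat b y)"
proof -
  assume e: "(p, (a, b), q) \<in> E" and "run E q x y"
  then obtain s where s: "s 0 = q" "\<And>i. (s i, (x i, y i), s (Suc i)) \<in> E" by (auto simp: run_def)
  show ?thesis
    unfolding run_def by (rule exI[of _ "case_nat p s"]) (use e s in \<open>auto split: nat.split\<close>)
qed

lemma run_conc:
  "q \<in> step E u v X \<Longrightarrow> run E q x y \<Longrightarrow> \<exists>p \<in> X. run E p (conc u x) (conc v y)"
proof (induction E u v X arbitrary: q x y rule: step.induct)
  case (2 E a u b v X)
  then obtain p where "p \<in> step E u v X" "(p, (a, b), q) \<in> E" by auto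
  then show ?case using 2 run_Cons unfolding conc_Cons by metis
qed auto

lemma run_step:
  assumes "\<And>i. (s i, (x i, y i), s (Suc i)) \<in> E" "s 0 \<in> X"
  shows "s n \<in> step E (rprefix x n) (rprefix y n) X"
  by (induction n) (use assms in \<open>auto simp: rprefix_Suc\<close>)

lemma run_shift:
  "\<forall>i. (s i, (x i, y i), s (Suc i)) \<in> E \<Longrightarrow> run E (s n) (shift n x) (shift n y)"
  unfolding run_def by (rule exI[of _ "\<lambda>i. s (n + i)"]) (auto simp: shift_def)

lemma run_coinduct:
  assumes Q: "Q q x y"
    and closed: "\<And>q x y. Q q x y \<Longrightarrow> \<exists>q'. (q, (x 0, y 0), q') \<in> E \<and> Q q' (shift 1 x) (shift 1 y)"
  shows "run E q x y"
proof -
  define P where "P n p \<longleftrightarrow> (n = 0 \<longrightarrow> p = q) \<and> Q p (shift n x) (shift n y)" for n p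
  have "\<exists>s. \<forall>n. P n (s n) \<and> (s n, (x n, y n), s (Suc n)) \<in> E"
  proof (rule dependent_nat_choice)
    show "\<exists>p. P 0 p" using Q by (auto simp: P_def)
  next
    fix p n assume "P n p"
    then obtain p' where "(p, (shift n x 0, shift n y 0), p') \<in> E" "Q p' (shift 1 (shift n x)) (shift 1 (shift n y))"
      using closed[of p "shift n x" "shift n y"] unfolding P_def by blast
    then show "\<exists>p'. P (Suc n) p' \<and> (p, (x n, y n), p') \<in> E"
      unfolding shift_shift by (auto simp: P_def shift_def)
  qed
  then show ?thesis unfolding run_def by (auto simp: P_def)
qed

text \<open>Paths from \<open>T\<close> to \<open>T\<close> over \<open>v\<close> are strung
  together letter by letter. The invariant \<open>Q\<close> says that a finite word \<open>r\<close>
  leading into \<open>T\<close> is still to be read before \<open>\<omega>\<close>; when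
  \<open>r\<close> is used up, another copy of \<open>v\<close> is taken from
  \<open>\<omega>\<close>.\<close>

lemma run_periodic:
  assumes T: "\<And>q. q \<in> T \<Longrightarrow> \<exists>q' \<in> T. q' \<in> step E v v {q}" and v: "v \<noteq> []"
    and q: "q \<in> T" and om: "conc v \<omega> = \<omega>"
  shows "run E q \<omega> \<omega>"
proof -
  define Q where "Q q x y \<longleftrightarrow> x = y \<and> (\<exists>r. \<exists>t \<in> T. t \<in> step E r r {q} \<and> x = conc r \<omega>)" for q x y
  show ?thesis
  proof (rule run_coinduct[of Q])
    show "Q q \<omega> \<omega>" unfolding Q_def using q by (intro conjI refl exI[of _ "[]"]) auto
  next
    fix q x y assume "Q q x y"
    then obtain r t where *: "x = y" "t \<in> T" "t \<in> step E r r {q}" "x = conc r \<omega>" by (auto simp: Q_def)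
    have "\<exists>r t. r \<noteq> [] \<and> t \<in> T \<and> t \<in> step E r r {q} \<and> x = conc r \<omega>"
    proof (cases "r = []")
      case True
      with * have "q \<in> T" "x = conc v \<omega>" using om by auto
      then show ?thesis using T v by blast
    qed (use * in blast)
    then obtain r t where r: "r \<noteq> []" "t \<in> T" "t \<in> step E r r {q}" "x = conc r \<omega>" by blast
    obtain r' a where r': "r = r' @ [a]" using r(1) by (metis append_butlast_last_id)
    have "t \<in> step E r' r' (step E [a] [a] {q})" using r(3) by (simp add: r' step_append)
    then obtain q' where q': "q' \<in> step E [a] [a] {q}" "t \<in> step E r' r' {q'}" using step_iff by metis
    have x: "x = case_nat a (conc r' \<omega>)" using r(4) by (simp add: r' conc_append conc_Cons)
    have "shift 1 x = conc r' \<omega>" by (auto simp: x shift_def fun_eq_iff)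
    then show "\<exists>q'. (q, (x 0, y 0), q') \<in> E \<and> Q q' (shift 1 x) (shift 1 y)"
      using q' r(2) *(1) x by (intro exI[of _ q']) (auto simp: Q_def)
  qed
qed

context diagonal_transducer
begin

lemma run_diagonal: "run E q x y \<Longrightarrow> q \<in> D \<Longrightarrow> x = y"
proof -
  assume "run E q x y" "q \<in> D"
  then obtain s where s: "s 0 = q" "\<And>i. (s i, (x i, y i), s (Suc i)) \<in> E" by (auto simp: run_def)
  have "s i \<in> D" for i
    by (induction i) (use s \<open>q \<in> D\<close> closed in blast)+
  then show "x = y" using s(2) closed by blast
qed

lemma conn_conc:
  assumes "conn T z z'" "\<And>q. q \<in> T \<Longrightarrow> run E q \<omega> \<omega>"
  shows "(symclp (rel E I))\<^sup>*\<^sup>* (conc z \<omega>) (conc z' \<omega>)"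
  using assms(1)
proof (induction rule: conn_induct)
  case (step y z)
  have "rel E I (conc u \<omega>) (conc v \<omega>)" if "G T u v" for u v
    using that run_conc[of _ E u v I \<omega> \<omega>] assms(2) unfolding G_def rel_def by blast
  then have "symclp (rel E I) (conc y \<omega>) (conc z \<omega>)" using step(2) by (auto simp: symclp_def)
  then show ?case using step.IH by (rule rtranclp.rtrancl_into_rtrancl[rotated])
qed simp

end

section \<open>From finite levels to infinite words\<close>

context finite_transducer
begin

text \<open>The word \<open>x\<close> that reads \<open>u\<close> and then repeats \<open>v\<close>
  does not change when copies of \<open>v\<close> are inserted after \<open>u\<close>. So for every
  \<open>k\<close> its component contains the distinct words \<open>conc z \<omega>\<close>, with
  \<open>z\<close> in the component of \<open>u\<close> followed by \<open>k\<close> copies of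
  \<open>v\<close>, and these are more than \<open>k\<close>.\<close>

theorem expanding_infinite:
  assumes "expanding n j \<phi> T v w u u'"
  shows "\<exists>x. infinite (component (rel E I) x)"
proof -
  have c: "length v = j" "length w = j" "pullback v T = T" "\<not> (w = v \<and> conn T u u')" "conn T (v @ u) (w @ u')"
    using assms by (auto simp: expanding_def)
  \<comment> \<open>Otherwise \<open>w\<close> is empty too, and the connection to
    \<open>w @ u'\<close> is the one excluded by the last clause of
    \<open>expanding\<close>.\<close>
  have v: "v \<noteq> []"
  proof
    assume "v = []"
    then show False using c by auto
  qed
  define \<omega> where "\<omega> i = rev v ! (i mod length v)" for i
  have om: "conc v \<omega> = \<omega>" using v by (auto simp: conc_def \<omega>_def fun_eq_iff le_mod_geq)
  have "\<exists>q' \<in> T. q' \<in> step E v v {q}" if "q \<in> T" for q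
    using that c(3) unfolding pullback_def by blast
  then have run: "run E q \<omega> \<omega>" if "q \<in> T" for q using run_periodic v om that by metis
  define x where "x = conc u \<omega>"
  let ?z = "\<lambda>k. ((@) v ^^ k) u"
  have x: "conc (?z k) \<omega> = x" for k by (induction k) (auto simp: x_def conc_append om)
  have "k < card (component (rel E I) x)" if fin: "finite (component (rel E I) x)" for k
  proof -
    have "k < card {z. conn T (?z k) z}" using expanding_unbounded[OF assms] by (simp add: csize_def)
    also have "\<dots> = card ((\<lambda>z. conc z \<omega>) ` {z. conn T (?z k) z})"
      by (rule card_image[symmetric], rule inj_onI, rule conc_inj[of _ _ \<omega>]) (auto dest!: conn_length)
    also have "\<dots> \<le> card (component (rel E I) x)"
      using conn_conc[OF _ run] x by (intro card_mono fin) fastforce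
    finally show ?thesis .
  qed
  then show ?thesis by blast
qed

text \<open>The value of the parameter \<open>T\<close> for the prefix of length \<open>n\<close> of
  an actual word. In this locale the type variables are renamed: \<open>'a\<close> is the type of
  states, \<open>'b\<close> that of letters.\<close>

definition tail_type :: "nat \<Rightarrow> (nat \<Rightarrow> 'b) \<Rightarrow> 'a set" where
  "tail_type n x = {q \<in> D. run E q (shift n x) (shift n x)}"

text \<open>Joined by a chain of pairs all of which have become trivial after \<open>n\<close>
  letters.\<close>

definition cofinal :: "nat \<Rightarrow> (nat \<Rightarrow> 'b) \<Rightarrow> (nat \<Rightarrow> 'b) \<Rightarrow> bool" where
  "cofinal n x y \<longleftrightarrow> shift n x = shift n y \<and> conn (tail_type n x) (rprefix x n) (rprefix y n)"

lemma tail_type_pullback: "tail_type n x = pullback (rprefix (shift n x) k) (tail_type (n + k) x)"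
proof (intro set_eqI iffI)
  fix q assume "q \<in> tail_type n x"
  then obtain s where q: "q \<in> D" and s: "s 0 = q" "\<And>i. (s i, (shift n x i, shift n x i), s (Suc i)) \<in> E"
    by (auto simp: tail_type_def run_def)
  have state: "s k \<in> step E (rprefix (shift n x) k) (rprefix (shift n x) k) {q}"
    by (rule run_step) (use s in auto)
  moreover have "run E (s k) (shift (n + k) x) (shift (n + k) x)"
    using run_shift[of s "shift n x" "shift n x" E k] s(2) by (simp add: shift_shift)
  ultimately show "q \<in> pullback (rprefix (shift n x) k) (tail_type (n + k) x)"
    using step_diagonal[OF state q] q by (auto simp: pullback_def tail_type_def)
next
  fix q assume "q \<in> pullback (rprefix (shift n x) k) (tail_type (n + k) x)"
  then obtain q' where q: "q \<in> D" "q' \<in> step E (rprefix (shift n x) k) (rprefix (shift n x) k) {q}"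
    "run E q' (shift (n + k) x) (shift (n + k) x)" by (auto simp: pullback_def tail_type_def)
  have "conc (rprefix (shift n x) k) (shift (n + k) x) = shift n x"
    using conc_rprefix[of "shift n x" k] by (simp add: shift_shift)
  then show "q \<in> tail_type n x" using run_conc[OF q(2,3)] q(1) by (auto simp: tail_type_def)
qed

lemma cofinal_refl: "cofinal n x x"
  by (simp add: cofinal_def)

lemma cofinal_add: "cofinal n x y \<Longrightarrow> cofinal (n + k) x y"
proof -
  assume c: "cofinal n x y"
  have "conn (pullback (rprefix (shift n x) k) (tail_type (n + k) x)) (rprefix x n) (rprefix y n)"
    using c unfolding cofinal_def tail_type_pullback[of n x k, symmetric] by blast
  note conn_append[OF this]
  moreover have "shift (n + k) x = shift (n + k) y" using c by (metis cofinal_def shift_shift)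
  ultimately show ?thesis using c by (simp add: cofinal_def rprefix_add)
qed

lemma cofinal_mono: "cofinal n x y \<Longrightarrow> n \<le> N \<Longrightarrow> cofinal N x y"
  using cofinal_add[of n x y "N - n"] by simp

lemma tail_type_cong: "shift n x = shift n y \<Longrightarrow> tail_type n x = tail_type n y"
  by (simp add: tail_type_def)

lemma cofinal_sym: "cofinal n x y \<Longrightarrow> cofinal n y x"
  by (auto simp: cofinal_def conn_sym tail_type_cong[of n x y])

lemma cofinal_trans: "cofinal n x y \<Longrightarrow> cofinal n y z \<Longrightarrow> cofinal n x z"
  unfolding cofinal_def using tail_type_cong[of n x y] conn_trans by metis

text \<open>Either the run enters \<open>D\<close>, from where on both words agree and the state
  reached belongs to the tail set, or it stays outside forever and witnesses that all prefixes of
  both words are special.\<close>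

lemma rel_cases:
  assumes "rel E I x y"
  shows "(\<exists>n. cofinal n x y) \<or> (\<forall>n. rprefix x n \<in> V n \<and> rprefix y n \<in> V n)"
proof -
  obtain s where s: "s 0 \<in> I" "\<And>i. (s i, (x i, y i), s (Suc i)) \<in> E"
    using assms by (auto simp: rel_def run_def)
  have state: "s n \<in> step E (rprefix x n) (rprefix y n) I" for n by (rule run_step[OF s(2,1)])
  show ?thesis
  proof (cases "\<exists>n. s n \<in> D")
    case True
    then obtain n where n: "s n \<in> D" by blast
    have r: "run E (s n) (shift n x) (shift n y)" using run_shift[of s x y E n] s(2) by blast
    then have e: "shift n x = shift n y" using run_diagonal n by blast
    then have "s n \<in> tail_type n x" using r n by (simp add: tail_type_def)
    then have "G (tail_type n x) (rprefix x n) (rprefix y n)" using state by (auto simp: G_def)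
    then have "cofinal n x y" using e conn_edge by (auto simp: cofinal_def)
    then show ?thesis by blast
  next
    case False
    then have "s n \<in> Y (rprefix x n) (rprefix y n)" for n using state by (auto simp: Y_def)
    then show ?thesis using special_if_Y by (fastforce simp: V_def)
  qed
qed

text \<open>If the component of every prefix of \<open>x\<close> contains a special word, its size
  is at most \<open>B\<close> at each level, and long prefixes separate finitely many cofinal words.
  Otherwise some level \<open>n\<close> has no special word in it; from then on components are mere
  copies, and a cofinal word differs from \<open>x\<close> at most in the first \<open>n\<close>
  letters.\<close>

lemma finite_cofinal:
  assumes B: "\<And>k T u. u \<in> V k \<Longrightarrow> csize T u \<le> B"
  shows "finite {y. \<exists>n. cofinal n x y}"
proof (cases "\<forall>n. \<exists>u. special u \<and> conn (tail_type n x) (rprefix x n) u")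
  case True
  have "card F \<le> B" if F: "F \<subseteq> {y. \<exists>n. cofinal n x y}" "finite F" for F
  proof -
    have "\<exists>n. \<forall>y \<in> F. cofinal n x y"
      using F(2,1)
    proof (induction F rule: finite_induct)
      case (insert y F)
      then obtain n k where "\<forall>y \<in> F. cofinal n x y" "cofinal k x y" by auto
      then show ?case using cofinal_mono by (intro exI[of _ "max n k"]) auto
    qed auto
    then obtain n where n: "\<forall>y \<in> F. cofinal n x y" by blast
    obtain n' where n': "\<And>N. n' \<le> N \<Longrightarrow> inj_on (\<lambda>x. rprefix x N) F" using finite_inj_rprefix[OF F(2)] by blast
    define N where "N = max n n'"
    obtain u where u: "special u" "conn (tail_type N x) (rprefix x N) u" using True by blast
    have "(\<lambda>y. rprefix y N) ` F \<subseteq> {z. conn (tail_type N x) (rprefix x N) z}"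
      using n cofinal_mono[of n x _ N] by (auto simp: N_def cofinal_def)
    then have "card F \<le> csize (tail_type N x) (rprefix x N)"
      unfolding csize_def using n'[of N] finite_component by (intro card_inj_on_le) (auto simp: N_def)
    also have "\<dots> = csize (tail_type N x) u" using csize_cong[OF u(2)] .
    also have "\<dots> \<le> B" using B[of u N] u conn_length[OF u(2)] by (auto simp: V_def)
    finally show ?thesis .
  qed
  then show ?thesis using finite_if_finite_subsets_card_bdd by blast
next
  case False
  then obtain n where n: "\<And>u. special u \<Longrightarrow> \<not> conn (tail_type n x) (rprefix x n) u" by blast
  have "y \<in> (\<lambda>z. conc z (shift n x)) ` {z. conn (tail_type n x) (rprefix x n) z}" if "cofinal k x y" for k y
  proof -
    let ?w = "rprefix (shift n x) k"
    have c: "cofinal (n + k) x y" using cofinal_mono[OF that] by simp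
    then have "conn (tail_type (n + k) x) (?w @ rprefix x n) (rprefix y (n + k))" by (simp add: cofinal_def rprefix_add)
    from conn_append_cases[OF this] n obtain z where z: "rprefix y (n + k) = ?w @ z" "conn (tail_type n x) (rprefix x n) z"
      unfolding tail_type_pullback[of n x k, symmetric] by blast
    have "y = conc (rprefix y (n + k)) (shift (n + k) y)" by (simp add: conc_rprefix)
    also have "\<dots> = conc z (conc ?w (shift (n + k) x))" using c by (simp add: z conc_append cofinal_def)
    also have "conc ?w (shift (n + k) x) = shift n x" using conc_rprefix[of "shift n x" k] by (simp add: shift_shift)
    finally show ?thesis using z by blast
  qed
  then have "{y. \<exists>n. cofinal n x y} \<subseteq> (\<lambda>z. conc z (shift n x)) ` {z. conn (tail_type n x) (rprefix x n) z}" by blast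
  then show ?thesis using finite_component finite_subset by blast
qed

text \<open>An edge between infinite words is either cofinal or has both ends in \<open>S\<close>,
  the words all of whose prefixes are special. As \<open>V k\<close> is bounded, \<open>S\<close> is
  finite, and the component of \<open>x\<close> is covered by the cofinality classes of
  \<open>x\<close> and of the elements of \<open>S\<close>.\<close>

theorem nonexpanding_finite:
  assumes "nonexpanding n m \<phi>"
  shows "finite (component (rel E I) x)"
proof -
  obtain B where V: "\<And>k. card (V k) \<le> B" and B: "\<And>k T u. u \<in> V k \<Longrightarrow> csize T u \<le> B"
    using nonexpanding_bound[OF assms] by blast
  define S where "S = {x. \<forall>n. rprefix x n \<in> V n}"
  have "card F \<le> B" if F: "F \<subseteq> S" "finite F" for F
  proof -
    obtain N where "inj_on (\<lambda>x. rprefix x N) F" using finite_inj_rprefix[OF F(2)] by blast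
    then have "card F \<le> card (V N)" using F finite_V by (intro card_inj_on_le) (auto simp: S_def)
    then show ?thesis using V le_trans by blast
  qed
  then have S: "finite S" using finite_if_finite_subsets_card_bdd by blast
  have "\<exists>s \<in> insert x S. \<exists>n. cofinal n s y" if "(symclp (rel E I))\<^sup>*\<^sup>* x y" for y
    using that
  proof (induction rule: rtranclp_induct)
    case base
    then show ?case using cofinal_refl by blast
  next
    case (step y z)
    then obtain s n where s: "s \<in> insert x S" "cofinal n s y" by blast
    have "(\<exists>n. cofinal n y z) \<or> z \<in> S"
      using step(2) rel_cases cofinal_sym unfolding symclp_def S_def by blast
    then show ?case
    proof
      assume "\<exists>k. cofinal k y z"
      then obtain k where "cofinal k y z" by blast
      then have "cofinal (max n k) s z" using s(2) cofinal_mono cofinal_trans by (meson max.cobounded1 max.cobounded2)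
      then show ?thesis using s by blast
    qed (use cofinal_refl in blast)
  qed
  then have "component (rel E I) x \<subseteq> (\<Union>s \<in> insert x S. {y. \<exists>n. cofinal n s y})" by blast
  moreover have "finite (\<Union>s \<in> insert x S. {y. \<exists>n. cofinal n s y})"
    using S finite_cofinal[of B] B by blast
  ultimately show ?thesis using finite_subset by blast
qed

end

section \<open>Bounded automata\<close>

text \<open>An edge of a dead list can be followed only by earlier edges of the list, so it lies on no
  infinite path. Dead lists certify that edges can be discarded.\<close>

definition dead_list :: "('q \<times> 'l \<times> 'q) set \<Rightarrow> ('q \<times> 'l \<times> 'q) list \<Rightarrow> bool" where
  "dead_list E ds \<longleftrightarrow> (\<forall>i < length ds. \<forall>e \<in> E. source e = target (ds ! i) \<longrightarrow> (\<exists>k < i. e = ds ! k))"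

text \<open>Edges all of whose successors are already listed are appended until none is left; then
  each remaining edge has a remaining successor.\<close>

lemma exists_dead_list:
  assumes "finite E"
  shows "\<exists>E' ds. E = E' \<union> set ds \<and> dead_list E ds \<and> (\<forall>e \<in> E'. \<exists>e' \<in> E'. source e' = target e)"
proof -
  have "\<exists>ds'. set ds' \<subseteq> E \<and> dead_list E ds' \<and> (\<forall>e \<in> E - set ds'. \<exists>e' \<in> E - set ds'. source e' = target e)"
    if "set ds \<subseteq> E" "dead_list E ds" for ds
    using that
  proof (induction "card (E - set ds)" arbitrary: ds rule: less_induct)
    case less
    show ?case
    proof (cases "\<forall>e \<in> E - set ds. \<exists>e' \<in> E - set ds. source e' = target e")
      case False
      then obtain e where e: "e \<in> E - set ds" "\<And>e'. e' \<in> E \<Longrightarrow> source e' = target e \<Longrightarrow> e' \<in> set ds"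
        by blast
      have "card (E - set (ds @ [e])) < card (E - set ds)"
        using assms e(1) by (intro psubset_card_mono) auto
      moreover have "dead_list E (ds @ [e])"
        unfolding dead_list_def
      proof (intro allI impI ballI)
        fix i e' assume i: "i < length (ds @ [e])" "e' \<in> E" "source e' = target ((ds @ [e]) ! i)"
        show "\<exists>k<i. e' = (ds @ [e]) ! k"
        proof (cases "i = length ds")
          case True
          then show ?thesis using e(2)[OF i(2)] i(3) by (metis in_set_conv_nth nth_append nth_append_length)
        next
          case False
          then have "i < length ds" using i by simp
          moreover from this obtain k where "k < i" "e' = ds ! k"
            using less.prems(2) i(2,3) unfolding dead_list_def nth_append by force
          ultimately show ?thesis by (intro exI[of _ k]) (auto simp: nth_append)
        qed
      qed
      ultimately show ?thesis using less.hyps[of "ds @ [e]"] less.prems(1) e(1) by auto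
    qed (use less.prems in blast)
  qed
  from this[of "[]"] obtain ds where "set ds \<subseteq> E" "dead_list E ds"
    "\<forall>e \<in> E - set ds. \<exists>e' \<in> E - set ds. source e' = target e" by (auto simp: dead_list_def)
  then show ?thesis by (intro exI[of _ "E - set ds"] exI[of _ ds]) auto
qed

lemma run_mono: "run E q x y \<Longrightarrow> E \<subseteq> E' \<Longrightarrow> run E' q x y"
  unfolding run_def by blast

text \<open>A run through \<open>ds ! k\<close> continues with some \<open>ds ! k'\<close> where
  \<open>k' < k\<close>, so induction on \<open>k\<close> excludes all of them.\<close>

lemma run_not_dead:
  assumes "run E q x y" "dead_list E ds" "E \<subseteq> E' \<union> set ds"
  shows "run E' q x y"
proof -
  obtain s where s: "s 0 = q" "\<And>i. (s i, (x i, y i), s (Suc i)) \<in> E" using assms(1) by (auto simp: run_def)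
  let ?e = "\<lambda>i. (s i, (x i, y i), s (Suc i))"
  have "?e i \<noteq> ds ! k" if "k < length ds" for k i
    using that
  proof (induction k arbitrary: i rule: less_induct)
    case (less k)
    show ?case
    proof
      assume "?e i = ds ! k"
      then have "source (?e (Suc i)) = target (ds ! k)" by (metis fst_conv snd_conv)
      then obtain k' where "k' < k" "?e (Suc i) = ds ! k'"
        using assms(2) less.prems s(2) unfolding dead_list_def by blast
      then show False using less.IH[of k' "Suc i"] less.prems by auto
    qed
  qed
  then have "?e i \<notin> set ds" for i unfolding in_set_conv_nth by metis
  then have "?e i \<in> E'" for i using s(2)[of i] assms(3) by blast
  then show ?thesis using s(1) by (auto simp: run_def)
qed

section \<open>Bounding the number of special words\<close>

context finite_transducer
begin

definition avoiding :: "('a \<times> ('b \<times> 'b) \<times> 'a) set" where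
  "avoiding = {e \<in> E. source e \<notin> D \<and> target e \<notin> D}"

lemma step_avoiding: "q \<in> step E w w' X \<Longrightarrow> q \<notin> D \<Longrightarrow> q \<in> step avoiding w w' X"
proof (induction w arbitrary: w' q)
  case Nil
  then show ?case by (cases w') auto
next
  case (Cons a w)
  obtain b v where w': "w' = b # v" using Cons.prems(1) by (cases w') auto
  then obtain p where p: "p \<in> step E w v X" "(p, (a, b), q) \<in> E" using Cons.prems(1) by auto
  then have "p \<notin> D" using closed Cons.prems(2) by blast
  then show ?case using Cons.IH[OF p(1)] p(2) Cons.prems(2) w' by (auto simp: avoiding_def)
qed

text \<open>To be turned into an infinite run outside \<open>D\<close> by Koenig's lemma.\<close>

definition long_lived :: "'a \<Rightarrow> bool" where
  "long_lived q \<longleftrightarrow> (\<forall>n. \<exists>w w'. length w = n \<and> step avoiding w w' {q} \<noteq> {})"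

lemma step_avoiding_shorter:
  assumes "step avoiding w w' {q} \<noteq> {}" "n \<le> length w"
  shows "\<exists>w w'. length w = n \<and> step avoiding w w' {q} \<noteq> {}"
proof -
  have l: "length w = length w'" using assms(1) step_length[of _ avoiding w w' "{q}"] by blast
  let ?k = "length w - n"
  have "step avoiding (take ?k w @ drop ?k w) (take ?k w' @ drop ?k w') {q} =
      step avoiding (take ?k w) (take ?k w') (step avoiding (drop ?k w) (drop ?k w') {q})"
    by (rule step_append) (use l in auto)
  then have "step avoiding (drop ?k w) (drop ?k w') {q} \<noteq> {}" using assms(1) by auto
  then show ?thesis using assms(2) by (intro exI[of _ "drop ?k w"] exI[of _ "drop ?k w'"]) auto
qed

text \<open>States of \<open>P\<close> that are not long lived die at some length
  \<open>b p\<close>; past the sum of these lengths all of them are dead.\<close>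

lemma uniform_long_lived:
  assumes "finite P"
  shows "\<exists>h. \<forall>p \<in> P. \<forall>w w'. h \<le> length w \<longrightarrow> step avoiding w w' {p} \<noteq> {} \<longrightarrow> long_lived p"
proof -
  define b where "b p = (SOME n. \<forall>w w'. length w = n \<longrightarrow> step avoiding w w' {p} = {})" for p
  have b: "step avoiding w w' {p} = {}" if "\<not> long_lived p" "length w = b p" for p w w'
  proof -
    have "\<exists>n. \<forall>w w'. length w = n \<longrightarrow> step avoiding w w' {p} = {}" using that(1) unfolding long_lived_def by blast
    then have "\<forall>w w'. length w = b p \<longrightarrow> step avoiding w w' {p} = {}" unfolding b_def by (rule someI_ex)
    then show ?thesis using that(2) by blast
  qed
  have "long_lived p" if p: "p \<in> P" "(\<Sum>p\<in>P. b p) \<le> length w" "step avoiding w w' {p} \<noteq> {}" for p w w'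
  proof (rule ccontr)
    assume "\<not> long_lived p"
    moreover have "b p \<le> length w" using member_le_sum[of p P b] p assms by simp
    ultimately show False using step_avoiding_shorter[OF p(3)] b by blast
  qed
  then show ?thesis by blast
qed

text \<open>The Koenig step: \<open>q\<close> reads \<open>Suc h\<close> letters, so the state after
  the first letter still reads \<open>h\<close> letters and is long lived by the choice of
  \<open>h\<close>. The first letter read is the last list element, whence
  \<open>v @ [a]\<close>.\<close>

lemma long_lived_next:
  assumes "long_lived q"
  shows "\<exists>l q'. (q, l, q') \<in> avoiding \<and> long_lived q'"
proof -
  have "finite (target ` E)" using finite_E by simp
  from uniform_long_lived[OF this] obtain h
    where h: "\<And>p w w'. p \<in> target ` E \<Longrightarrow> h \<le> length w \<Longrightarrow> step avoiding w w' {p} \<noteq> {} \<Longrightarrow> long_lived p" by blast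
  obtain w w' where w: "length w = Suc h" "step avoiding w w' {q} \<noteq> {}" using assms long_lived_def by blast
  have l: "length w' = Suc h" using w step_length by (metis all_not_in_conv)
  obtain v a where v: "w = v @ [a]" "length v = h" using w(1) by (metis length_Suc_conv_rev)
  obtain v' b where v': "w' = v' @ [b]" "length v' = h" using l by (metis length_Suc_conv_rev)
  have "step avoiding v v' (step avoiding [a] [b] {q}) \<noteq> {}" using w(2) v v' by (simp add: step_append)
  then obtain r q' where q': "q' \<in> step avoiding [a] [b] {q}" "r \<in> step avoiding v v' {q'}" using step_iff[of _ avoiding v v'] by blast
  then have e: "(q, (a, b), q') \<in> avoiding" by auto
  then have "q' \<in> target ` E" by (force simp: avoiding_def)
  then have "long_lived q'" using h[of q' v v'] q'(2) v(2) by blast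
  then show ?thesis using e by blast
qed

lemma long_lived_run:
  assumes "long_lived q"
  shows "\<exists>x y. run avoiding q x y"
proof -
  have "\<exists>s. \<forall>n. ((n = 0 \<longrightarrow> s n = q) \<and> long_lived (s n)) \<and> (\<exists>l. (s n, l, s (Suc n)) \<in> avoiding)"
  proof (rule dependent_nat_choice)
    show "\<exists>p. (0 = (0::nat) \<longrightarrow> p = q) \<and> long_lived p" using assms by blast
  qed (use long_lived_next in blast)
  then obtain s where s: "s 0 = q" "\<forall>n. \<exists>l. (s n, l, s (Suc n)) \<in> avoiding" by blast
  obtain l where l: "\<forall>n. (s n, l n, s (Suc n)) \<in> avoiding" using s(2) by metis
  have "\<forall>n. (s n, (fst (l n), snd (l n)), s (Suc n)) \<in> avoiding" using l by simp
  then show ?thesis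
    using s(1) unfolding run_def
    by (intro exI[of _ "\<lambda>n. fst (l n)"] exI[of _ "\<lambda>n. snd (l n)"] exI[of _ s]) auto
qed

text \<open>Cut \<open>h\<close> letters off the end of a long special word. The state reached
  before them survives \<open>h\<close> letters outside \<open>D\<close>, hence is long lived, so
  the part before the cut is a prefix of one of the finitely many words on infinite runs that avoid
  \<open>D\<close>. Only the last \<open>h\<close> letters are free.\<close>

lemma bounded_V:
  assumes "finite I" and X: "finite {x. \<exists>y. \<exists>q \<in> I - D. run avoiding q x y \<or> run avoiding q y x}" (is "finite ?X")
  shows "\<exists>K. \<forall>n. card (V n) \<le> K"
proof -
  have "finite (I \<union> target ` E)" using finite_E assms by simp
  from uniform_long_lived[OF this] obtain h
    where h: "\<And>p w w'. p \<in> I \<union> target ` E \<Longrightarrow> h \<le> length w \<Longrightarrow> step avoiding w w' {p} \<noteq> {} \<Longrightarrow> long_lived p" by blast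
  have mem: "\<exists>w x y. \<exists>p \<in> I - D. u = w @ rprefix x n \<and> u' = w' @ rprefix y n \<and> length w = h \<and> run avoiding p x y"
    if q: "q \<in> Y u u'" and n: "length u = n + h" and w': "w' = take h u'" for q u u' w' n
  proof -
    have l: "length u' = n + h" using q Y_length n by metis
    let ?w = "take h u" and ?v = "drop h u" and ?v' = "drop h u'"
    have lw: "length ?w = length w'" "length ?v = n" "length ?v' = n" using n l w' by auto
    have "q \<in> Y (?w @ ?v) (w' @ ?v')" using q w' by simp
    then have "q \<in> step E ?w w' (Y ?v ?v') - D" using Y_append[OF lw(1)] by blast
    then obtain p where p: "p \<in> Y ?v ?v'" "q \<in> step E ?w w' {p}" "q \<notin> D"
      using step_iff[of q E ?w w'] by blast
    have "\<exists>b \<in> I. p \<in> step E ?v ?v' {b}" using p(1) step_iff[of p E ?v ?v' I] by (auto simp: Y_def)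
    then obtain b where b: "b \<in> I" "p \<in> step E ?v ?v' {b}" by blast
    have "p \<notin> D" using p(1) by (auto simp: Y_def)
    then have bD: "b \<notin> D" using step_diagonal[OF b(2)] by blast
    have "p \<in> I \<union> target ` E" using b by (cases "(E, ?v, ?v', {b})" rule: step.cases) force+
    moreover have "step avoiding ?w w' {p} \<noteq> {}" using step_avoiding[OF p(2,3)] by blast
    ultimately have "long_lived p" using h[of p ?w w'] lw n by auto
    then obtain x y where "run avoiding p x y" using long_lived_run by blast
    moreover have "p \<in> step avoiding ?v ?v' {b}" using step_avoiding[OF b(2) \<open>p \<notin> D\<close>] .
    ultimately have r: "run avoiding b (conc ?v x) (conc ?v' y)" using run_conc by fastforce
    have pc: "rprefix (conc v z) n = v" if "length v = n" for v and z :: "nat \<Rightarrow> 'b"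
      using that by (intro nth_equalityI) (auto simp: rprefix_def conc_def rev_nth)
    show ?thesis
      by (intro exI[of _ ?w] exI[of _ "conc ?v x"] exI[of _ "conc ?v' y"] bexI[of _ b])
         (use b bD lw r n w' pc in auto)
  qed
  have large: "card (V n) \<le> card (words h) * card ?X" if "h \<le> n" for n
  proof -
    obtain k where k: "n = k + h" using \<open>h \<le> n\<close> by (metis le_add_diff_inverse2)
    have "V n \<subseteq> (\<lambda>(w, x). w @ rprefix x k) ` (words h \<times> ?X)"
    proof
      fix u assume u: "u \<in> V n"
      then obtain v q where v: "q \<in> Y u v \<or> q \<in> Y v u" and lu: "length u = k + h"
        unfolding V_def special_def k by blast
      have "\<exists>w x. length w = h \<and> x \<in> ?X \<and> u = w @ rprefix x k"
        using v
      proof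
        assume "q \<in> Y u v"
        from mem[OF this lu refl] show ?thesis by blast
      next
        assume q: "q \<in> Y v u"
        then have "length v = k + h" using Y_length lu by metis
        from mem[OF q this refl] obtain w x y p where p: "p \<in> I - D" "v = w @ rprefix x k"
          "u = take h u @ rprefix y k" "length w = h" "run avoiding p x y" by blast
        then show ?thesis using lu by (intro exI[of _ "take h u"] exI[of _ y]) auto
      qed
      then obtain w x where w: "length w = h" "x \<in> ?X" "u = w @ rprefix x k" by blast
      then have "w \<in> words h" using V_letters[OF u] by auto
      then show "u \<in> (\<lambda>(w, x). w @ rprefix x k) ` (words h \<times> ?X)" using w by force
    qed
    then have "card (V n) \<le> card (words h \<times> ?X)"
      using surj_card_le finite_words X by (metis (no_types, lifting) finite_SigmaI)
    then show ?thesis by (simp add: card_cartesian_product)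
  qed
  have small: "card (V n) \<le> (\<Sum>n<h. card (V n))" if "n < h" for n
    using that by (intro member_le_sum) auto
  have "card (V n) \<le> card (words h) * card ?X + (\<Sum>n<h. card (V n))" for n
    using large[of n] small[of n] by (cases "n < h") auto
  then show ?thesis by blast
qed

end

section \<open>The generators as one transducer\<close>

text \<open>A disjoint union: states are tagged by the position of their automaton, so that the
  relation obtained is the union of the generators.\<close>

definition edges_of :: "(nat, nat \<times> nat) buchi list \<Rightarrow> ((nat \<times> nat) \<times> (nat \<times> nat) \<times> (nat \<times> nat)) set" where
  "edges_of Bs = {((j, q), l, (j, q')) | j q l q'. j < length Bs \<and> (q, l, q') \<in> edges (Bs ! j)}"

definition initial_of :: "(nat, nat \<times> nat) buchi list \<Rightarrow> (nat \<times> nat) set" where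
  "initial_of Bs = {(j, q). j < length Bs \<and> q \<in> initial (Bs ! j)}"

lemma run_edges_of:
  "run (edges_of Bs) (j, q) x y \<longleftrightarrow>
    j < length Bs \<and> (\<exists>p. infinite_path (Bs ! j) q p \<and> (\<forall>i. label (p i) = (x i, y i)))"
proof
  assume "run (edges_of Bs) (j, q) x y"
  then obtain s where s: "s 0 = (j, q)" "\<And>i. (s i, (x i, y i), s (Suc i)) \<in> edges_of Bs"
    by (auto simp: run_def)
  have fs: "fst (s i) = j" for i
  proof (induction i)
    case (Suc i)
    then show ?case using s(2)[of i] by (auto simp: edges_of_def)
  qed (simp add: s)
  have e: "j < length Bs \<and> (snd (s i), (x i, y i), snd (s (Suc i))) \<in> edges (Bs ! j)" for i
    using s(2)[of i] fs[of i] by (auto simp: edges_of_def)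
  show "j < length Bs \<and> (\<exists>p. infinite_path (Bs ! j) q p \<and> (\<forall>i. label (p i) = (x i, y i)))"
    using e s(1) by (intro conjI exI[of _ "\<lambda>i. (snd (s i), (x i, y i), snd (s (Suc i)))"])
      (auto simp: infinite_path_def)
next
  assume "j < length Bs \<and> (\<exists>p. infinite_path (Bs ! j) q p \<and> (\<forall>i. label (p i) = (x i, y i)))"
  then obtain p where p: "j < length Bs" "source (p 0) = q" "\<And>i. p i \<in> edges (Bs ! j)"
    "\<And>i. target (p i) = source (p (Suc i))" "\<And>i. label (p i) = (x i, y i)"
    by (auto simp: infinite_path_def)
  have "((j, source (p i)), (x i, y i), (j, source (p (Suc i)))) \<in> edges_of Bs" for i
    using p(1) p(3)[of i] p(4)[of i] p(5)[of i]
    by (auto simp: edges_of_def intro!: exI[of _ "source (p i)"]) (metis prod.collapse)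
  then show "run (edges_of Bs) (j, q) x y"
    unfolding run_def using p(2) by (intro exI[of _ "\<lambda>i. (j, source (p i))"]) auto
qed

lemma language_safety:
  assumes "safety_automaton \<Sigma> B"
  shows "language B = {w. \<exists>v \<in> initial B. \<exists>p. infinite_path B v p \<and> (\<forall>i. label (p i) = w i)}"
proof -
  have "source (p i) \<in> residual B" if "infinite_path B v p" for v p i
  proof -
    have "p i \<in> edges B" using that by (simp add: infinite_path_def)
    moreover have "edges B \<subseteq> states B \<times> \<Sigma> \<times> states B"
      using assms by (simp add: safety_automaton_def buchi_automaton_def)
    ultimately have "p i \<in> states B \<times> \<Sigma> \<times> states B" by (rule rev_subsetD)
    then have "source (p i) \<in> states B" by (simp add: mem_Times_iff)
    then show ?thesis using assms by (simp add: safety_automaton_def)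
  qed
  then have "\<exists>\<^sub>\<infinity>i. source (p i) \<in> residual B" if "infinite_path B v p" for v p
    using that by (auto simp: INFM_nat)
  then show ?thesis unfolding language_def by blast
qed

lemma rel_edges_of:
  assumes "\<And>B. B \<in> set Bs \<Longrightarrow> safety_automaton \<Sigma> B"
  shows "rel (edges_of Bs) (initial_of Bs) x y \<longleftrightarrow> (\<exists>B \<in> set Bs. (x, y) \<in> accepted_relation B)"
proof -
  have "(x, y) \<in> accepted_relation B \<longleftrightarrow>
      (\<exists>v \<in> initial B. \<exists>p. infinite_path B v p \<and> (\<forall>i. label (p i) = (x i, y i)))" if "B \<in> set Bs" for B
    by (simp add: accepted_relation_def language_safety[OF assms[OF that]])
  then have "(\<exists>B \<in> set Bs. (x, y) \<in> accepted_relation B) \<longleftrightarrow> (\<exists>j < length Bs. \<exists>v \<in> initial (Bs ! j).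
      \<exists>p. infinite_path (Bs ! j) v p \<and> (\<forall>i. label (p i) = (x i, y i)))"
    by (metis in_set_conv_nth)
  also have "\<dots> \<longleftrightarrow> (\<exists>q \<in> initial_of Bs. run (edges_of Bs) q x y)"
    unfolding initial_of_def by (auto simp: run_edges_of)
  finally show ?thesis unfolding rel_def by blast
qed

text \<open>Transitive closure without reflexivity: \<open>x\<close> belongs to its own orbit only
  if some element of the semigroup is defined at \<open>x\<close>. The induction over the semigroup
  carries both directions because of inversion.\<close>

lemma orbit_eq: "orbit (inverse_semigroup S) x = {y. (symclp (\<lambda>x y. \<exists>g \<in> S. (x, y) \<in> g))\<^sup>+\<^sup>+ x y}"
proof (intro set_eqI iffI)
  let ?R = "symclp (\<lambda>x y. \<exists>g \<in> S. (x, y) \<in> g)"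
  have "?R\<^sup>+\<^sup>+ x y \<and> ?R\<^sup>+\<^sup>+ y x" if "g \<in> inverse_semigroup S" "(x, y) \<in> g" for g x y
    using that
  proof (induction arbitrary: x y)
    case (generator g)
    then have "?R x y" "?R y x" by (auto simp: symclp_def)
    then show ?case by blast
  next
    case (composition g h)
    from composition.prems obtain z where "(x, z) \<in> g" "(z, y) \<in> h" by (rule relcompE) auto
    with composition.IH have "?R\<^sup>+\<^sup>+ x z \<and> ?R\<^sup>+\<^sup>+ z x" "?R\<^sup>+\<^sup>+ z y \<and> ?R\<^sup>+\<^sup>+ y z" by blast+
    then show ?case using tranclp_trans[of ?R] by blast
  qed auto
  then show "y \<in> {y. ?R\<^sup>+\<^sup>+ x y}" if "y \<in> orbit (inverse_semigroup S) x" for y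
    using that by (auto simp: orbit_def)
  have s: "\<exists>g \<in> inverse_semigroup S. (y, z) \<in> g" if "?R y z" for y z
    using that unfolding symclp_def
    by (meson converse_iff inverse_semigroup.generator inverse_semigroup.inversion)
  show "y \<in> orbit (inverse_semigroup S) x" if "y \<in> {y. ?R\<^sup>+\<^sup>+ x y}" for y
  proof -
    have "?R\<^sup>+\<^sup>+ x y" using that by simp
    then have "\<exists>g \<in> inverse_semigroup S. (x, y) \<in> g"
    proof (induction rule: tranclp_induct)
      case (step y z)
      then show ?case using s[OF step(2)] by (meson inverse_semigroup.composition relcompI)
    qed (use s in blast)
    then show ?thesis by (auto simp: orbit_def)
  qed
qed

text \<open>Adding \<open>x\<close> itself does not affect infinity, and an infinite orbit is
  nonempty, so some partial bijection of \<open>L\<close> is defined at \<open>x\<close>, which puts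
  \<open>x\<close> into \<open>L\<close>.\<close>

lemma infinite_orbit_iff:
  assumes "\<And>B. B \<in> set Bs \<Longrightarrow> safety_automaton \<Sigma> B"
    and "\<And>B. B \<in> set Bs \<Longrightarrow> partial_bijection L (accepted_relation B)"
  shows "(\<exists>x \<in> L. infinite (orbit (inverse_semigroup (accepted_relation ` set Bs)) x)) \<longleftrightarrow>
    (\<exists>x. infinite (component (rel (edges_of Bs) (initial_of Bs)) x))"
proof -
  let ?R = "symclp (rel (edges_of Bs) (initial_of Bs))"
  have "(\<lambda>x y. \<exists>g \<in> accepted_relation ` set Bs. (x, y) \<in> g) = rel (edges_of Bs) (initial_of Bs)"
    using rel_edges_of[OF assms(1)] by (auto simp: fun_eq_iff)
  then have o: "orbit (inverse_semigroup (accepted_relation ` set Bs)) x = {y. ?R\<^sup>+\<^sup>+ x y}" for x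
    by (simp add: orbit_eq)
  have "{y. ?R\<^sup>*\<^sup>* x y} = insert x {y. ?R\<^sup>+\<^sup>+ x y}" for x
    by (auto dest: rtranclpD tranclp_into_rtranclp)
  then have "infinite {y. ?R\<^sup>*\<^sup>* x y} \<longleftrightarrow> infinite {y. ?R\<^sup>+\<^sup>+ x y}" for x by simp
  moreover have "x \<in> L" if inf: "infinite {y. ?R\<^sup>+\<^sup>+ x y}" for x
  proof -
    have "orbit (inverse_semigroup (accepted_relation ` set Bs)) x \<noteq> {}" using inf o by force
    then obtain g y where "g \<in> inverse_semigroup (accepted_relation ` set Bs)" "(x, y) \<in> g"
      by (auto simp: orbit_def)
    then show ?thesis
      using inverse_semigroup_partial_bijection[of g "accepted_relation ` set Bs" L] assms(2)
      by (auto simp: partial_bijection_def)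
  qed
  ultimately show ?thesis unfolding o by blast
qed

lemma extensible_run:
  assumes ext: "\<forall>e \<in> E. \<exists>e' \<in> E. source e' = target e" and e: "e \<in> E"
  shows "\<exists>x y. run E (target e) x y"
proof -
  have "\<exists>f. \<forall>n. (f n \<in> E \<and> (n = 0 \<longrightarrow> source (f n) = target e)) \<and> source (f (Suc n)) = target (f n)"
  proof (rule dependent_nat_choice)
    show "\<exists>e'. e' \<in> E \<and> (0 = (0::nat) \<longrightarrow> source e' = target e)" using assms by blast
  qed (use ext in blast)
  then obtain f where f: "\<And>n. f n \<in> E" "source (f 0) = target e" "\<And>n. source (f (Suc n)) = target (f n)"
    by blast
  have "(source (f n), (fst (label (f n)), snd (label (f n))), source (f (Suc n))) \<in> E" for n
    using f(1)[of n] by (simp add: f(3))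
  then show ?thesis
    unfolding run_def using f(2)
    by (intro exI[of _ "\<lambda>n. fst (label (f n))"] exI[of _ "\<lambda>n. snd (label (f n))"]
      exI[of _ "\<lambda>n. source (f n)"]) auto
qed

text \<open>Here \<open>D\<close> is chosen. Dead edges are trimmed beforehand, since a finite path
  with different labels on its two sides may be a dead end and then says nothing about triviality.
  After trimming, every such path continues forever, so states of \<open>Q\<close> outside
  \<open>D\<close> are not trivial, and infinite runs avoiding \<open>D\<close> are among the
  finitely many paths allowed by boundedness.\<close>

theorem dichotomy:
  assumes bounded: "\<forall>B \<in> set Bs. bounded_automaton B"
    and fin: "finite (edges_of Bs)" "finite (initial_of Bs)"
  shows "\<exists>E D ds. E \<subseteq> edges_of Bs \<and> edges_of Bs = E \<union> set ds \<and> dead_list (edges_of Bs) ds \<and> finite D \<and>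
    diagonal_transducer E D \<and>
    ((\<exists>n j \<phi> T v w u u'. transducer.expanding E (initial_of Bs) D n j \<phi> T v w u u') \<or>
     (\<exists>n m \<phi>. transducer.nonexpanding E (initial_of Bs) D n m \<phi>))"
proof -
  obtain E ds where E: "edges_of Bs = E \<union> set ds" and ds: "dead_list (edges_of Bs) ds"
    and ext: "\<forall>e \<in> E. \<exists>e' \<in> E. source e' = target e"
    using exists_dead_list[OF fin(1)] by blast
  let ?I = "initial_of Bs"
  have fE: "finite E" using E fin by auto
  define Q where "Q = ?I \<union> source ` E \<union> target ` E"
  define D where "D = {q \<in> Q. \<forall>w w'. step E w w' {q} \<noteq> {} \<longrightarrow> w = w'}"
  have fQ: "finite Q" using fin fE by (simp add: Q_def)
  interpret finite_transducer E ?I D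
  proof
    fix q a b q' assume e: "(q, (a, b), q') \<in> E" and q: "q \<in> D"
    have one: "q' \<in> step E [a] [b] {q}" using e by simp
    have "a = b"
    proof -
      have "step E [a] [b] {q} \<noteq> {}" using one by blast
      then have "[a] = [b]" using q unfolding D_def by blast
      then show ?thesis by simp
    qed
    moreover have "w = w'" if "step E w w' {q'} \<noteq> {}" for w w'
    proof -
      have "length w = length w'" using that step_length[of _ E w w' "{q'}"] by blast
      then have "step E (w @ [a]) (w' @ [b]) {q} = step E w w' (step E [a] [b] {q})" by (rule step_append)
      moreover have "\<dots> \<noteq> {}" using that one step_iff[of _ E w w' "step E [a] [b] {q}"] by blast
      ultimately have "w @ [a] = w' @ [b]" using q unfolding D_def by auto
      then show ?thesis by simp
    qed
    moreover have "q' \<in> Q" using e by (force simp: Q_def)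
    ultimately show "a = b \<and> q' \<in> D" by (auto simp: D_def)
  qed (rule fE)
  have nontriv: "\<not> trivial_state (Bs ! j) q" if q: "(j, q) \<in> Q - D" for j q
  proof -
    obtain w w' where w: "step E w w' {(j, q)} \<noteq> {}" "w \<noteq> w'" using q by (auto simp: D_def)
    then obtain p where p: "p \<in> step E w w' {(j, q)}" by blast
    have len: "length w = length w'" by (rule step_length[OF p])
    \<comment> \<open>\<open>w\<close> is nonempty, as it differs from \<open>w'\<close> and has the
      same length; so \<open>p\<close> is the target of a trimmed edge, which can be
      prolonged.\<close>
    have "\<exists>x y. run E p x y"
      using p w(2)
    proof (cases w)
      case (Cons a u)
      then obtain b v where "w' = b # v" using len by (cases w') auto
      with p Cons obtain r where "(r, (a, b), p) \<in> E" by auto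
      then show ?thesis using extensible_run[OF ext, of "(r, (a, b), p)"] by simp
    qed (use len in auto)
    then obtain x y where "run E p x y" by blast
    from run_conc[OF p this] have "run E (j, q) (conc w x) (conc w' y)" by simp
    then have "run (edges_of Bs) (j, q) (conc w x) (conc w' y)"
      by (rule run_mono) (simp add: E)
    then obtain f where f: "infinite_path (Bs ! j) q f" "\<forall>i. label (f i) = (conc w x i, conc w' y i)"
      unfolding run_edges_of by blast
    have "conc w x \<noteq> conc w' y"
    proof
      assume eq: "conc w x = conc w' y"
      have "rev w ! i = rev w' ! i" if "i < length w" for i
        using fun_cong[OF eq, of i] that len by (simp add: conc_def)
      then have "rev w = rev w'" using len by (intro nth_equalityI) auto
      then show False using w(2) by simp
    qed
    then obtain i where "conc w x i \<noteq> conc w' y i" by blast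
    then show ?thesis using f unfolding trivial_state_def by (metis prod.inject)
  qed
  let ?P = "\<lambda>B. {p. \<exists>v \<in> initial B. infinite_path B v p \<and> (\<forall>i. \<not> trivial_state B (source (p i)))}"
  let ?PP = "\<Union>B \<in> set Bs. ?P B"
  have fP: "finite ?PP" using bounded by (auto simp: bounded_automaton_def)
  have path: "\<exists>p \<in> ?PP. \<forall>i. label (p i) = (x i, y i)" if r: "run avoiding q x y" "q \<in> ?I - D" for q x y
  proof -
    obtain s where s: "s 0 = q" "\<And>i. (s i, (x i, y i), s (Suc i)) \<in> avoiding" using r by (auto simp: run_def)
    have sQ: "s i \<in> Q - D" for i using s(2)[of i] by (force simp: avoiding_def Q_def)
    have e: "(s i, (x i, y i), s (Suc i)) \<in> edges_of Bs" for i using s(2)[of i] E by (auto simp: avoiding_def)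
    obtain j q0 where q: "q = (j, q0)" "j < length Bs" "q0 \<in> initial (Bs ! j)" using r(2) by (auto simp: initial_of_def)
    have fs: "fst (s i) = j" for i
    proof (induction i)
      case (Suc i)
      then show ?case using e[of i] by (auto simp: edges_of_def)
    qed (simp add: s q)
    let ?p = "\<lambda>i. (snd (s i), (x i, y i), snd (s (Suc i)))"
    have "?p i \<in> edges (Bs ! j)" for i using e[of i] fs[of i] by (auto simp: edges_of_def)
    then have "infinite_path (Bs ! j) q0 ?p" using s(1) q by (auto simp: infinite_path_def)
    moreover have "\<not> trivial_state (Bs ! j) (source (?p i))" for i
      using nontriv[of j "snd (s i)"] sQ[of i] fs[of i] by (metis fst_conv prod.collapse)
    ultimately have "?p \<in> ?P (Bs ! j)" using q(3) by blast
    then show ?thesis using q(2) by (intro bexI[of _ ?p]) auto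
  qed
  have "{x. \<exists>y. \<exists>q \<in> ?I - D. run avoiding q x y \<or> run avoiding q y x} \<subseteq>
      (\<lambda>p i. fst (label (p i))) ` ?PP \<union> (\<lambda>p i. snd (label (p i))) ` ?PP"
  proof
    fix x assume "x \<in> {x. \<exists>y. \<exists>q \<in> ?I - D. run avoiding q x y \<or> run avoiding q y x}"
    then obtain y q where q: "q \<in> ?I - D" "run avoiding q x y \<or> run avoiding q y x" by blast
    from q(2) show "x \<in> (\<lambda>p i. fst (label (p i))) ` ?PP \<union> (\<lambda>p i. snd (label (p i))) ` ?PP"
    proof
      assume "run avoiding q x y"
      from path[OF this q(1)] obtain p where p: "p \<in> ?PP" "\<forall>i. label (p i) = (x i, y i)" by blast
      then have "x = (\<lambda>i. fst (label (p i)))" by auto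
      then show ?thesis using p(1) by blast
    next
      assume "run avoiding q y x"
      from path[OF this q(1)] obtain p where p: "p \<in> ?PP" "\<forall>i. label (p i) = (y i, x i)" by blast
      then have "x = (\<lambda>i. snd (label (p i)))" by auto
      then show ?thesis using p(1) by blast
    qed
  qed
  then have "finite {x. \<exists>y. \<exists>q \<in> ?I - D. run avoiding q x y \<or> run avoiding q y x}"
    by (rule finite_subset) (use fP in blast)
  from bounded_V[OF fin(2) this] obtain K where K: "\<And>n. card (V n) \<le> K" by blast
  have "\<exists>f. inj_on f (V n) \<and> f ` V n \<subseteq> {..<K}" for n
    using card_le_inj[of "V n" "{..<K}"] finite_V K by auto
  then obtain \<nu> where \<nu>: "\<And>n. inj_on (\<nu> n) (V n)" "\<And>n. \<nu> n ` V n \<subseteq> {..<K}" by metis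
  have fD: "finite D" by (rule finite_subset[OF _ fQ]) (auto simp: D_def)
  interpret named_transducer E ?I D K \<nu>
    by unfold_locales (use fin fD \<nu> in auto)
  show ?thesis
    using expanding_or_nonexpanding E ds fD diagonal_transducer_axioms
    by (intro exI[of _ E] exI[of _ D] exI[of _ ds]) auto
qed

section \<open>Certificates\<close>

type_synonym state = "nat \<times> nat"
type_synonym edge = "state \<times> (nat \<times> nat) \<times> state"

fun step_list :: "edge list \<Rightarrow> nat list \<Rightarrow> nat list \<Rightarrow> state list \<Rightarrow> state list" where
  "step_list E [] [] X = X"
| "step_list E (a # u) (b # v) X =
    map (\<lambda>e. snd (snd e)) (filter (\<lambda>e. fst (snd e) = (a, b) \<and> fst e \<in> set (step_list E u v X)) E)"
| "step_list E _ _ X = []"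

lemma set_step_list [simp]: "set (step_list E u v X) = step (set E) u v (set X)"
  by (induction E u v X rule: step_list.induct) (force simp: image_iff)+

lemma computable_step_list [comp_rules]:
  assumes "computable e" "computable u" "computable v" "computable s"
  shows "computable (\<lambda>x. step_list (e x) (u x) (v x) (s x))"
proof -
  define F where "F p = step_list (fst p) (fst (snd p)) (fst (snd (snd p))) (snd (snd (snd p)))" for p
  have "computable F"
  proof (rule computable_linear_recursion[where m = "\<lambda>p. length (fst (snd p))" and
      b = "\<lambda>p. fst (snd p) = [] \<or> fst (snd (snd p)) = []" and
      g = "\<lambda>p. if fst (snd p) = [] \<and> fst (snd (snd p)) = [] then snd (snd (snd p)) else []" and
      d = "\<lambda>p. (fst p, tl (fst (snd p)), tl (fst (snd (snd p))), snd (snd (snd p)))" and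
      h = "\<lambda>p r. map (\<lambda>e. snd (snd e)) (filter (\<lambda>e. fst (snd e) = (hd (fst (snd p)), hd (fst (snd (snd p))))
        \<and> fst e \<in> set r) (fst p))"])
    show "F p = (if fst (snd p) = [] \<or> fst (snd (snd p)) = [] then
        if fst (snd p) = [] \<and> fst (snd (snd p)) = [] then snd (snd (snd p)) else []
      else map (\<lambda>e. snd (snd e)) (filter (\<lambda>e. fst (snd e) = (hd (fst (snd p)), hd (fst (snd (snd p))))
        \<and> fst e \<in> set (F (fst p, tl (fst (snd p)), tl (fst (snd (snd p))), snd (snd (snd p))))) (fst p)))" for p
      unfolding F_def by (cases "(fst p, fst (snd p), fst (snd (snd p)), snd (snd (snd p)))" rule: step_list.cases) auto
    show "length (fst (snd (fst p, tl (fst (snd p)), tl (fst (snd (snd p))), snd (snd (snd p))))) < length (fst (snd p))"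
      if "\<not> (fst (snd p) = [] \<or> fst (snd (snd p)) = [])" for p :: "edge list \<times> nat list \<times> nat list \<times> state list"
      using that by (cases "fst (snd p)") auto
  qed (intro comp_rules)+
  from computable_comp[OF this, of "\<lambda>x. (e x, u x, v x, s x)"] show ?thesis
    using assms by (simp add: F_def computable_pair)
qed

lemma computable_remdups [comp_rules]: "computable f \<Longrightarrow> computable (\<lambda>x. remdups (f x))"
proof -
  assume "computable f"
  then have "computable (\<lambda>x. rec_list [] (\<lambda>y ys r. if y \<in> set ys then r else y # r) (f x))" by (intro comp_rules)
  moreover have "rec_list [] (\<lambda>y ys r. if y \<in> set ys then r else y # r) a = remdups a" for a :: "'b list"
    by (induction a) auto
  ultimately show ?thesis by simp
qed

definition words_list :: "edge list \<Rightarrow> nat \<Rightarrow> nat list list" where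
  "words_list E n = List.n_lists n (concat (map (\<lambda>e. [fst (fst (snd e)), snd (fst (snd e))]) E))"

lemma set_words_list: "set (words_list E n) = {u. set u \<subseteq> transducer.letters (set E) \<and> length u = n}"
proof -
  have "(\<Union>e \<in> set E. {fst (fst (snd e)), snd (fst (snd e))}) = transducer.letters (set E)"
    by (force simp: transducer.letters_def)
  then show ?thesis by (auto simp: words_list_def set_n_lists)
qed

lemma step_words_list:
  "q \<in> step (set E) u v X \<Longrightarrow>
    length u = length v \<and> u \<in> set (words_list E (length u)) \<and> v \<in> set (words_list E (length u))"
  unfolding set_words_list using transducer.step_letters[of q "set E" u v X] step_length[of q "set E" u v X] by simp

lemma computable_words_list [comp_rules]:
  assumes "computable e" "computable n"
  shows "computable (\<lambda>x. words_list (e x) (n x))"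
proof -
  have "computable (\<lambda>p. words_list (fst p) (snd p))" unfolding words_list_def by (intro comp_rules)
  from computable_comp[OF this computable_pair[OF assms]] show ?thesis by simp
qed

text \<open>The length is part of the parameter \<open>p\<close>, because
  \<open>decidable_rtranclp\<close> needs a finite set of targets computed from the parameter
  alone.\<close>

definition linked :: "edge list \<times> state list \<times> state list \<times> nat \<Rightarrow> nat list \<Rightarrow> nat list \<Rightarrow> bool" where
  "linked p u v \<longleftrightarrow> length u = snd (snd (snd p)) \<and>
    ((\<exists>q \<in> set (step_list (fst p) u v (fst (snd p))). q \<in> set (fst (snd (snd p)))) \<or>
     (\<exists>q \<in> set (step_list (fst p) v u (fst (snd p))). q \<in> set (fst (snd (snd p)))))"

definition conn_list :: "edge list \<Rightarrow> state list \<Rightarrow> state list \<Rightarrow> nat list \<Rightarrow> nat list \<Rightarrow> bool" where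
  "conn_list E I T u v \<longleftrightarrow> (linked (E, I, T, length u))\<^sup>*\<^sup>* u v"

lemma conn_list_iff: "conn_list E I T u v \<longleftrightarrow> transducer.conn (set E) (set I) (set T) u v"
proof -
  interpret transducer "set E" "set I" "{}" .
  have 1: "linked (E, I, T, n) a b \<longleftrightarrow> length a = n \<and> symclp (transducer.G (set E) (set I) (set T)) a b" for n a b
    by (auto simp: linked_def symclp_def transducer.G_def)
  have "transducer.conn (set E) (set I) (set T) u b" if "conn_list E I T u b" for b
    using that unfolding conn_list_def transducer.conn_def
    by (induction rule: rtranclp_induct) (auto simp: 1 intro: rtranclp.rtrancl_into_rtrancl)
  moreover have "conn_list E I T u b" if "transducer.conn (set E) (set I) (set T) u b" for b
    using that
  proof (induction rule: conn_induct)
    case (step y z)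
    then have "linked (E, I, T, length u) y z" using conn_length[of "set T" u y] by (simp add: 1)
    with step show ?case unfolding conn_list_def by (meson rtranclp.rtrancl_into_rtrancl)
  qed (simp add: conn_list_def)
  ultimately show ?thesis by blast
qed

lemma decidable_conn_list [comp_rules]:
  assumes "computable e" "computable i" "computable t" "computable u" "computable v"
  shows "decidable (\<lambda>x. conn_list (e x) (i x) (t x) (u x) (v x))"
proof -
  have "decidable (\<lambda>p. linked (fst p) (fst (snd p)) (snd (snd p)))" unfolding linked_def by (intro comp_rules)
  moreover have "computable (\<lambda>p. words_list (fst p) (snd (snd (snd p))) :: nat list list)" by (intro comp_rules)
  moreover have "b \<in> set (words_list (fst p) (snd (snd (snd p))))" if "linked p a b" for p a b
    using that step_words_list unfolding linked_def set_step_list by metis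
  ultimately have "decidable (\<lambda>p. (linked (fst p))\<^sup>*\<^sup>* (fst (snd p)) (snd (snd p)))" by (rule decidable_rtranclp)
  from decidable_comp[OF this, of "\<lambda>x. ((e x, i x, t x, length (u x)), u x, v x)"]
  show ?thesis unfolding conn_list_def using assms by (simp add: comp_rules)
qed

definition special_list :: "edge list \<Rightarrow> state list \<Rightarrow> state list \<Rightarrow> nat list \<Rightarrow> bool" where
  "special_list E I D u \<longleftrightarrow> (\<exists>v \<in> set (words_list E (length u)).
    (\<exists>q \<in> set (step_list E u v I). q \<notin> set D) \<or> (\<exists>q \<in> set (step_list E v u I). q \<notin> set D))"

lemma special_list_iff: "special_list E I D u \<longleftrightarrow> transducer.special (set E) (set I) (set D) u"
proof -
  have "v \<in> set (words_list E (length u))" if "q \<in> step (set E) u v X \<or> q \<in> step (set E) v u X" for q v X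
    using that step_words_list by metis
  then show ?thesis
    unfolding special_list_def transducer.special_def transducer.Y_def by fastforce
qed

lemma decidable_special_list [comp_rules]:
  assumes "computable e" "computable i" "computable d" "computable u"
  shows "decidable (\<lambda>x. special_list (e x) (i x) (d x) (u x))"
proof -
  have "decidable (\<lambda>p. special_list (fst p) (fst (snd p)) (fst (snd (snd p))) (snd (snd (snd p))))"
    unfolding special_list_def by (intro comp_rules)
  from decidable_comp[OF this, of "\<lambda>x. (e x, i x, d x, u x)"] show ?thesis using assms by (simp add: comp_rules)
qed

text \<open>\<open>words_list\<close> takes a letter as often as it occurs on edges, hence
  \<open>remdups\<close>. The whole component is listed when \<open>u\<close> is over these letters,
  as special words are.\<close>

definition comp_size_list :: "edge list \<Rightarrow> state list \<Rightarrow> state list \<Rightarrow> nat list \<Rightarrow> nat" where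
  "comp_size_list E I T u = length (remdups (filter (conn_list E I T u) (words_list E (length u))))"

lemma comp_size_list_eq:
  assumes "set u \<subseteq> transducer.letters (set E)"
  shows "comp_size_list E I T u = transducer.csize (set E) (set I) (set T) u"
proof -
  have "set (filter (conn_list E I T u) (words_list E (length u))) = {z. transducer.conn (set E) (set I) (set T) u z}"
    using assms transducer.conn_letters[of "set E" "set I" "set T" u] transducer.conn_length[of "set E" "set I" "set T" u]
    by (auto simp: conn_list_iff set_words_list)
  then show ?thesis unfolding comp_size_list_def transducer.csize_def length_remdups_card_conv by simp
qed

lemma computable_comp_size_list [comp_rules]:
  assumes "computable e" "computable i" "computable t" "computable u"
  shows "computable (\<lambda>x. comp_size_list (e x) (i x) (t x) (u x))"
proof -
  have "computable (\<lambda>p. comp_size_list (fst p) (fst (snd p)) (fst (snd (snd p))) (snd (snd (snd p))))"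
    unfolding comp_size_list_def by (intro comp_rules)
  from computable_comp[OF this, of "\<lambda>x. (e x, i x, t x, u x)"] show ?thesis using assms by (simp add: comp_rules)
qed

text \<open>An isomorphism is stored as the list of its pairs on special words. Equality of the sets
  \<open>Y\<close> is written as two inclusions of states outside \<open>D\<close>, and
  \<open>subseqs\<close> supplies all subsets of \<open>D\<close>.\<close>

definition iso_list :: "edge list \<Rightarrow> state list \<Rightarrow> state list \<Rightarrow> nat \<Rightarrow> nat \<Rightarrow> (nat list \<times> nat list) list \<Rightarrow> bool" where
  "iso_list E I D n m F \<longleftrightarrow>
    (\<forall>u \<in> set (words_list E n). special_list E I D u \<longrightarrow> (\<exists>p \<in> set F. fst p = u)) \<and>
    (\<forall>u \<in> set (words_list E m). special_list E I D u \<longrightarrow> (\<exists>p \<in> set F. snd p = u)) \<and>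
    (\<forall>p \<in> set F. length (fst p) = n \<and> special_list E I D (fst p) \<and> length (snd p) = m \<and> special_list E I D (snd p)) \<and>
    (\<forall>p \<in> set F. \<forall>p' \<in> set F. (fst p = fst p' \<longleftrightarrow> snd p = snd p') \<and>
       (\<forall>q \<in> set (step_list E (fst p) (fst p') I). q \<notin> set D \<longrightarrow> q \<in> set (step_list E (snd p) (snd p') I)) \<and>
       (\<forall>q \<in> set (step_list E (snd p) (snd p') I). q \<notin> set D \<longrightarrow> q \<in> set (step_list E (fst p) (fst p') I)) \<and>
       (\<forall>T \<in> set (subseqs D). conn_list E I T (fst p) (fst p') \<longleftrightarrow> conn_list E I T (snd p) (snd p')))"

lemma decidable_iso_list [comp_rules]:
  assumes "computable e" "computable i" "computable d" "computable n" "computable m" "computable f"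
  shows "decidable (\<lambda>x. iso_list (e x) (i x) (d x) (n x) (m x) (f x))"
proof -
  have "decidable (\<lambda>p. iso_list (fst p) (fst (snd p)) (fst (snd (snd p))) (fst (snd (snd (snd p))))
      (fst (snd (snd (snd (snd p))))) (snd (snd (snd (snd (snd p))))))"
    unfolding iso_list_def by (intro comp_rules)
  from decidable_comp[OF this, of "\<lambda>x. (e x, i x, d x, n x, m x, f x)"] show ?thesis using assms by (simp add: comp_rules)
qed

lemma all_subseqs: "(\<forall>T \<in> set (subseqs D). P (set T)) \<longleftrightarrow> (\<forall>T \<subseteq> set D. P T)"
  using subseqs_powset[of D] by (metis (no_types, lifting) Pow_iff image_iff)

lemma iso_list_iso:
  assumes "iso_list E I D n m F"
  obtains \<phi> where "transducer.iso (set E) (set I) (set D) n m \<phi>"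
    "set F = (\<lambda>u. (u, \<phi> u)) ` transducer.V (set E) (set I) (set D) n"
proof
  interpret transducer "set E" "set I" "set D" .
  define \<phi> where "\<phi> u = (SOME v. (u, v) \<in> set F)" for u
  have V: "V k = {u \<in> set (words_list E k). special_list E I D u}" for k
    using V_letters[of _ k] by (auto simp: special_list_iff set_words_list V_def)
  have F: "p \<in> set F \<Longrightarrow> fst p \<in> V n \<and> snd p \<in> V m" for p
    using assms unfolding iso_list_def special_list_iff V_def by blast
  have inj: "p \<in> set F \<Longrightarrow> p' \<in> set F \<Longrightarrow> fst p = fst p' \<longleftrightarrow> snd p = snd p'" for p p'
    using assms unfolding iso_list_def by blast
  have dom: "\<exists>v. (u, v) \<in> set F" if "u \<in> V n" for u
    using assms that unfolding iso_list_def V by (metis (mono_tags, lifting) mem_Collect_eq prod.collapse)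
  have ran: "\<exists>u. (u, v) \<in> set F" if "v \<in> V m" for v
    using assms that unfolding iso_list_def V by (metis (mono_tags, lifting) mem_Collect_eq prod.collapse)
  have \<phi>: "(u, \<phi> u) \<in> set F" if "u \<in> V n" for u unfolding \<phi>_def using dom[OF that] by (rule someI_ex)
  show eq: "set F = (\<lambda>u. (u, \<phi> u)) ` V n"
  proof (intro set_eqI iffI)
    fix p assume p: "p \<in> set F"
    then have "fst p \<in> V n" using F by blast
    moreover from \<phi>[OF this] inj[OF p, of "(fst p, \<phi> (fst p))"] have "p = (fst p, \<phi> (fst p))" by (simp add: prod_eq_iff)
    ultimately show "p \<in> (\<lambda>u. (u, \<phi> u)) ` V n" by blast
  qed (use \<phi> in auto)
  have bij: "bij_betw \<phi> (V n) (V m)"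
    unfolding bij_betw_def
  proof
    show "inj_on \<phi> (V n)" using inj[OF \<phi> \<phi>] by (auto simp: inj_on_def)
    show "\<phi> ` V n = V m"
    proof (intro set_eqI iffI)
      fix v assume "v \<in> V m"
      then obtain u where "(u, v) \<in> set F" using ran by blast
      then show "v \<in> \<phi> ` V n" unfolding eq by auto
    qed (use F[OF \<phi>] in auto)
  qed
  have pairs: "(\<forall>q \<in> step (set E) u v (set I). q \<notin> set D \<longrightarrow> q \<in> step (set E) (\<phi> u) (\<phi> v) (set I)) \<and>
       (\<forall>q \<in> step (set E) (\<phi> u) (\<phi> v) (set I). q \<notin> set D \<longrightarrow> q \<in> step (set E) u v (set I)) \<and>
       (\<forall>T \<in> set (subseqs D). conn (set T) u v \<longleftrightarrow> conn (set T) (\<phi> u) (\<phi> v))"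
    if "u \<in> V n" "v \<in> V n" for u v
  proof -
    have "\<forall>p \<in> set F. \<forall>p' \<in> set F.
       (\<forall>q \<in> set (step_list E (fst p) (fst p') I). q \<notin> set D \<longrightarrow> q \<in> set (step_list E (snd p) (snd p') I)) \<and>
       (\<forall>q \<in> set (step_list E (snd p) (snd p') I). q \<notin> set D \<longrightarrow> q \<in> set (step_list E (fst p) (fst p') I)) \<and>
       (\<forall>T \<in> set (subseqs D). conn_list E I T (fst p) (fst p') \<longleftrightarrow> conn_list E I T (snd p) (snd p'))"
      using assms unfolding iso_list_def by (elim conjE) meson
    from bspec[OF bspec[OF this \<phi>[OF that(1)]] \<phi>[OF that(2)]] show ?thesis
      unfolding fst_conv snd_conv set_step_list conn_list_iff .
  qed
  have Y: "Y u v = Y (\<phi> u) (\<phi> v)" if "u \<in> V n" "v \<in> V n" for u v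
  proof -
    have "(\<forall>q \<in> step (set E) u v (set I). q \<notin> set D \<longrightarrow> q \<in> step (set E) (\<phi> u) (\<phi> v) (set I)) \<and>
       (\<forall>q \<in> step (set E) (\<phi> u) (\<phi> v) (set I). q \<notin> set D \<longrightarrow> q \<in> step (set E) u v (set I))"
      using pairs[OF that] by blast
    then show ?thesis by (auto simp: Y_def)
  qed
  have C: "\<forall>T \<subseteq> set D. conn T u v \<longleftrightarrow> conn T (\<phi> u) (\<phi> v)" if "u \<in> V n" "v \<in> V n" for u v
  proof -
    have "\<forall>T \<in> set (subseqs D). conn (set T) u v \<longleftrightarrow> conn (set T) (\<phi> u) (\<phi> v)"
      using pairs[OF that] by blast
    then show ?thesis unfolding all_subseqs[of D "\<lambda>T. conn T u v \<longleftrightarrow> conn T (\<phi> u) (\<phi> v)"] .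
  qed
  show "iso n m \<phi>" unfolding iso_def using bij Y C by blast
qed

lemma iso_iso_list:
  assumes iso: "transducer.iso (set E) (set I) (set D) n m \<phi>"
    and F: "set F = (\<lambda>u. (u, \<phi> u)) ` transducer.V (set E) (set I) (set D) n"
  shows "iso_list E I D n m F"
proof -
  interpret transducer "set E" "set I" "set D" .
  have bij: "bij_betw \<phi> (V n) (V m)"
    and Y: "\<And>u v. u \<in> V n \<Longrightarrow> v \<in> V n \<Longrightarrow> Y u v = Y (\<phi> u) (\<phi> v)"
    and C: "\<And>u v. u \<in> V n \<Longrightarrow> v \<in> V n \<Longrightarrow> \<forall>T \<subseteq> set D. conn T u v \<longleftrightarrow> conn T (\<phi> u) (\<phi> v)"
    using iso unfolding iso_def by blast+
  have V: "u \<in> V k \<longleftrightarrow> length u = k \<and> special_list E I D u" for u k by (simp add: V_def special_list_iff)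
  have img: "\<phi> ` V n = V m" using bij by (simp add: bij_betw_def)
  show ?thesis
    unfolding iso_list_def set_step_list
  proof (intro conjI ballI impI)
    fix u assume "u \<in> set (words_list E n)" "special_list E I D u"
    then have "u \<in> V n" by (simp add: V set_words_list)
    then show "\<exists>p \<in> set F. fst p = u" unfolding F by force
  next
    fix u assume "u \<in> set (words_list E m)" "special_list E I D u"
    then have "u \<in> \<phi> ` V n" unfolding img by (simp add: V set_words_list)
    then show "\<exists>p \<in> set F. snd p = u" unfolding F by force
  next
    fix p assume "p \<in> set F"
    then have "fst p \<in> V n \<and> snd p \<in> V m" unfolding F using img by auto
    then show "length (fst p) = n" "special_list E I D (fst p)" "length (snd p) = m" "special_list E I D (snd p)"
      by (auto simp: V)
  next
    fix p p' assume "p \<in> set F" "p' \<in> set F"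
    then obtain u v where p: "p = (u, \<phi> u)" "p' = (v, \<phi> v)" "u \<in> V n" "v \<in> V n" unfolding F by auto
    show "fst p = fst p' \<longleftrightarrow> snd p = snd p'" using p bij inj_onD[of \<phi> "V n" u v] by (auto simp: bij_betw_def)
    show "q \<in> step (set E) (snd p) (snd p') (set I)"
      if "q \<in> step (set E) (fst p) (fst p') (set I)" "q \<notin> set D" for q
      using that Y[OF p(3,4)] by (auto simp: p Y_def)
    show "q \<in> step (set E) (fst p) (fst p') (set I)"
      if "q \<in> step (set E) (snd p) (snd p') (set I)" "q \<notin> set D" for q
      using that Y[OF p(3,4)] by (auto simp: p Y_def)
    show "conn_list E I T (fst p) (fst p') \<longleftrightarrow> conn_list E I T (snd p) (snd p')" if T: "T \<in> set (subseqs D)" for T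
    proof -
      have "set T \<subseteq> set D" using T subseqs_powset[of D] by blast
      then show ?thesis using C[OF p(3,4)] by (simp add: conn_list_iff p)
    qed
  qed
qed

section \<open>The two certificates\<close>

definition diagonal_edges :: "edge list \<Rightarrow> state list \<Rightarrow> bool" where
  "diagonal_edges E D \<longleftrightarrow>
    (\<forall>e \<in> set E. fst e \<in> set D \<longrightarrow> fst (fst (snd e)) = snd (fst (snd e)) \<and> snd (snd e) \<in> set D)"

lemma diagonal_edges_iff: "diagonal_edges E D \<longleftrightarrow> diagonal_transducer (set E) (set D)"
  by (force simp: diagonal_edges_def diagonal_transducer_def)

definition dead_edges :: "edge list \<Rightarrow> edge list \<Rightarrow> bool" where
  "dead_edges E ds \<longleftrightarrow> (\<forall>i < length ds. \<forall>e \<in> set E. fst e = snd (snd (hd (drop i ds))) \<longrightarrow>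
    (\<exists>k < i. e = hd (drop k ds)))"

lemma dead_edges_iff: "dead_edges E ds \<longleftrightarrow> dead_list (set E) ds"
  by (simp add: dead_edges_def dead_list_def hd_drop_conv_nth cong: conj_cong)

definition pullback_fixed :: "edge list \<Rightarrow> state list \<Rightarrow> nat list \<Rightarrow> state list \<Rightarrow> bool" where
  "pullback_fixed E D v T \<longleftrightarrow> (\<forall>q \<in> set T. q \<in> set D) \<and>
    (\<forall>q \<in> set D. q \<in> set T \<longleftrightarrow> (\<exists>q' \<in> set (step_list E v v [q]). q' \<in> set T))"

lemma pullback_fixed_iff: "pullback_fixed E D v T \<longleftrightarrow> transducer.pullback (set E) (set D) v (set T) = set T"
  by (auto simp: pullback_fixed_def transducer.pullback_def)

text \<open>\<open>F\<close> is the graph of an isomorphism \<open>\<phi>\<close>; its elements \<open>a\<close> and \<open>b\<close> are \<open>(u, \<phi> u)\<close> and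
  \<open>(u', \<phi> u')\<close> in the notation of \<^term>\<open>transducer.expanding\<close>.\<close>

definition certify_infinite ::
  "edge list \<Rightarrow> state list \<Rightarrow> edge list \<Rightarrow> state list \<Rightarrow> nat \<Rightarrow> (nat list \<times> nat list) list \<Rightarrow> state list \<Rightarrow>
    nat list \<Rightarrow> nat list \<Rightarrow> nat list \<times> nat list \<Rightarrow> nat list \<times> nat list \<Rightarrow> bool" where
  "certify_infinite E0 I E D n F T v w a b \<longleftrightarrow>
    (\<forall>e \<in> set E. e \<in> set E0) \<and> diagonal_edges E D \<and> iso_list E I D n (n + length v) F \<and>
    a \<in> set F \<and> b \<in> set F \<and> length w = length v \<and> pullback_fixed E D v T \<and>
    conn_list E I T (v @ fst a) (snd a) \<and> conn_list E I T (v @ fst a) (w @ fst b) \<and>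
    \<not> (w = v \<and> conn_list E I T (fst a) (fst b))"

text \<open>\<open>E0\<close> holds the edges of the input. Here \<open>E\<close> may omit only dead
  edges, because finite components for \<open>E\<close> must remain finite for \<open>E0\<close>. An
  infinite component survives the addition of any edges, so \<open>certify_infinite\<close> just
  asks for a subset.\<close>

definition certify_finite ::
  "edge list \<Rightarrow> state list \<Rightarrow> edge list \<Rightarrow> state list \<Rightarrow> edge list \<Rightarrow> nat \<Rightarrow> nat \<Rightarrow> (nat list \<times> nat list) list \<Rightarrow> bool" where
  "certify_finite E0 I E D ds n m F \<longleftrightarrow>
    (\<forall>e \<in> set E0. e \<in> set E \<or> e \<in> set ds) \<and> (\<forall>e \<in> set E. e \<in> set E0) \<and> dead_edges E0 ds \<and> diagonal_edges E D \<and>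
    n < m \<and> iso_list E I D n m F \<and>
    (\<forall>T \<in> set (subseqs D). \<forall>p \<in> set F. comp_size_list E I T (snd p) \<le> comp_size_list E I T (fst p))"

lemma certify_infinite_iff:
  "(\<exists>F a b. certify_infinite E0 I E D n F T v w a b) \<longleftrightarrow>
    set E \<subseteq> set E0 \<and> diagonal_transducer (set E) (set D) \<and>
    (\<exists>\<phi> u u'. transducer.expanding (set E) (set I) (set D) n (length v) \<phi> (set T) v w u u')"
proof
  interpret transducer "set E" "set I" "set D" .
  assume "\<exists>F a b. certify_infinite E0 I E D n F T v w a b"
  then obtain F a b where *: "certify_infinite E0 I E D n F T v w a b" by blast
  then have "iso_list E I D n (n + length v) F" by (simp add: certify_infinite_def)
  then obtain \<phi> where \<phi>: "iso n (n + length v) \<phi>" "set F = (\<lambda>u. (u, \<phi> u)) ` V n"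
    by (rule iso_list_iso)
  obtain u u' where "a = (u, \<phi> u)" "b = (u', \<phi> u')" "u \<in> V n" "u' \<in> V n"
    using * unfolding certify_infinite_def \<phi>(2) by auto
  with * \<phi> have "expanding n (length v) \<phi> (set T) v w u u'"
    unfolding expanding_def certify_infinite_def by (simp add: conn_list_iff pullback_fixed_iff)
  then show "set E \<subseteq> set E0 \<and> diagonal_transducer (set E) (set D) \<and>
    (\<exists>\<phi> u u'. expanding n (length v) \<phi> (set T) v w u u')"
    using * by (auto simp: certify_infinite_def diagonal_edges_iff)
next
  interpret transducer "set E" "set I" "set D" .
  assume "set E \<subseteq> set E0 \<and> diagonal_transducer (set E) (set D) \<and>
    (\<exists>\<phi> u u'. expanding n (length v) \<phi> (set T) v w u u')"
  then obtain \<phi> u u' where *: "set E \<subseteq> set E0" "diagonal_transducer (set E) (set D)"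
    "expanding n (length v) \<phi> (set T) v w u u'" by blast
  interpret finite_transducer "set E" "set I" "set D"
    by (rule finite_transducer.intro[OF *(2)]) (simp add: finite_transducer_axioms_def)
  obtain l where l: "set l = V n" using finite_list[OF finite_V] by blast
  define F where "F = map (\<lambda>u. (u, \<phi> u)) l"
  have "iso_list E I D n (n + length v) F"
    using *(3) l by (intro iso_iso_list) (auto simp: expanding_def F_def)
  then have "certify_infinite E0 I E D n F T v w (u, \<phi> u) (u', \<phi> u')"
    using * l unfolding expanding_def certify_infinite_def
    by (auto simp: conn_list_iff pullback_fixed_iff diagonal_edges_iff F_def)
  then show "\<exists>F a b. certify_infinite E0 I E D n F T v w a b" by blast
qed

lemma certify_finite_iff:
  "(\<exists>F. certify_finite E0 I E D ds n m F) \<longleftrightarrow>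
    set E0 \<subseteq> set E \<union> set ds \<and> set E \<subseteq> set E0 \<and> dead_list (set E0) ds \<and> diagonal_transducer (set E) (set D) \<and>
    (\<exists>\<phi>. transducer.nonexpanding (set E) (set I) (set D) n m \<phi>)"
proof
  interpret transducer "set E" "set I" "set D" .
  assume "\<exists>F. certify_finite E0 I E D ds n m F"
  then obtain F where *: "certify_finite E0 I E D ds n m F" by blast
  then have "iso_list E I D n m F" by (simp add: certify_finite_def)
  then obtain \<phi> where \<phi>: "iso n m \<phi>" "set F = (\<lambda>u. (u, \<phi> u)) ` V n"
    by (rule iso_list_iso)
  have "csize (set T) (\<phi> u) \<le> csize (set T) u" if "T \<in> set (subseqs D)" "u \<in> V n" for T u
  proof -
    have "(u, \<phi> u) \<in> set F" using \<phi>(2) that(2) by blast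
    then have "comp_size_list E I T (\<phi> u) \<le> comp_size_list E I T u"
      using * that(1) unfolding certify_finite_def by fastforce
    moreover have "\<phi> u \<in> V m" using \<phi>(1) that(2) bij_betwE unfolding iso_def by blast
    ultimately show ?thesis using V_letters that(2) by (simp add: comp_size_list_eq)
  qed
  then have "\<forall>T \<subseteq> set D. \<forall>u \<in> V n. csize T (\<phi> u) \<le> csize T u"
    using all_subseqs[of D "\<lambda>T. \<forall>u \<in> V n. csize T (\<phi> u) \<le> csize T u"] by blast
  with * \<phi> have "nonexpanding n m \<phi>" by (simp add: nonexpanding_def certify_finite_def)
  then show "set E0 \<subseteq> set E \<union> set ds \<and> set E \<subseteq> set E0 \<and> dead_list (set E0) ds \<and>
    diagonal_transducer (set E) (set D) \<and> (\<exists>\<phi>. nonexpanding n m \<phi>)"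
    using * by (auto simp: certify_finite_def diagonal_edges_iff dead_edges_iff)
next
  interpret transducer "set E" "set I" "set D" .
  assume "set E0 \<subseteq> set E \<union> set ds \<and> set E \<subseteq> set E0 \<and> dead_list (set E0) ds \<and>
    diagonal_transducer (set E) (set D) \<and> (\<exists>\<phi>. nonexpanding n m \<phi>)"
  then obtain \<phi> where *: "set E0 \<subseteq> set E \<union> set ds" "set E \<subseteq> set E0" "dead_list (set E0) ds"
    "diagonal_transducer (set E) (set D)" "nonexpanding n m \<phi>" by blast
  interpret finite_transducer "set E" "set I" "set D"
    by (rule finite_transducer.intro[OF *(4)]) (simp add: finite_transducer_axioms_def)
  obtain l where l: "set l = V n" using finite_list[OF finite_V] by blast
  define F where "F = map (\<lambda>u. (u, \<phi> u)) l"
  have iso: "iso n m \<phi>" using *(5) by (simp add: nonexpanding_def)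
  then have "iso_list E I D n m F" using l by (intro iso_iso_list) (auto simp: F_def)
  moreover have "comp_size_list E I T (snd p) \<le> comp_size_list E I T (fst p)" if T: "T \<in> set (subseqs D)" and p: "p \<in> set F" for T p
  proof -
    obtain u where u: "p = (u, \<phi> u)" "u \<in> V n" using p l by (auto simp: F_def)
    have "set T \<subseteq> set D" using T subseqs_powset[of D] by blast
    then have "csize (set T) (\<phi> u) \<le> csize (set T) u" using *(5) u by (simp add: nonexpanding_def)
    then show ?thesis using u V_letters[OF u(2)] V_letters[OF iso_in[OF iso u(2)]] by (simp add: comp_size_list_eq)
  qed
  ultimately have "certify_finite E0 I E D ds n m F"
    using * unfolding certify_finite_def nonexpanding_def
    by (auto simp: diagonal_edges_iff dead_edges_iff)
  then show "\<exists>F. certify_finite E0 I E D ds n m F" by blast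
qed

section \<open>Decoding the input\<close>

definition field :: "nat \<Rightarrow> nat \<Rightarrow> nat" where
  "field i b = hd (drop i (list_decode b))"

text \<open>The elements of a set coded by a number are smaller than this number, so filtering the
  numbers below it lists the set. The offset 2 skips the alphabet size and the automaton of the
  language.\<close>

definition edges_list :: "nat list \<Rightarrow> edge list" where
  "edges_list inp = concat (map (\<lambda>j. map (\<lambda>c. ((j, fst (prod_decode c)),
        prod_decode (fst (prod_decode (snd (prod_decode c)))), (j, snd (prod_decode (snd (prod_decode c))))))
      (filter (\<lambda>c. c \<in> set_decode (field 1 (hd (drop (j + 2) inp)))) [0..<field 1 (hd (drop (j + 2) inp))]))
    [0..<length inp - 2])"

definition initial_list :: "nat list \<Rightarrow> state list" where
  "initial_list inp = concat (map (\<lambda>j. map (\<lambda>q. (j, q))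
      (filter (\<lambda>q. q \<in> set_decode (field 2 (hd (drop (j + 2) inp)))) [0..<field 2 (hd (drop (j + 2) inp))]))
    [0..<length inp - 2])"

lemma set_decode_less: "i \<in> set_decode n \<Longrightarrow> i < n"
proof -
  assume "i \<in> set_decode n"
  then have "n div 2 ^ i \<noteq> 0" by (auto simp: set_decode_def intro!: Nat.gr0I)
  then have "2 ^ i \<le> n" by (metis div_less not_le)
  then show "i < n" using less_exp[of i] by linarith
qed

lemma set_filter_set_decode: "set (filter (\<lambda>i. i \<in> set_decode n) [0..<n]) = set_decode n"
  using set_decode_less by auto

lemma computable_edges_list [comp_rules]: "computable f \<Longrightarrow> computable (\<lambda>x. edges_list (f x))"
proof (rule computable_comp[of edges_list])
  show "computable edges_list" unfolding edges_list_def field_def by (intro comp_rules)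
qed

lemma computable_initial_list [comp_rules]: "computable f \<Longrightarrow> computable (\<lambda>x. initial_list (f x))"
proof (rule computable_comp[of initial_list])
  show "computable initial_list" unfolding initial_list_def field_def by (intro comp_rules)
qed

definition input_list :: "nat \<Rightarrow> (nat, nat) buchi \<Rightarrow> (nat, nat \<times> nat) buchi list \<Rightarrow> nat list" where
  "input_list k A Bs = k # automaton_code id A # map (automaton_code prod_encode) Bs"

lemma encode_input_list: "encode (input_list k A Bs) = input_code k A Bs"
  by (simp add: input_list_def input_code_def encode_list_def comp_def)

lemma field_automaton_code:
  "j < length Bs \<Longrightarrow> field 1 (hd (drop (j + 2) (input_list k A Bs))) = set_encode (edge_code prod_encode ` edges (Bs ! j))"
  "j < length Bs \<Longrightarrow> field 2 (hd (drop (j + 2) (input_list k A Bs))) = set_encode (initial (Bs ! j))"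
  by (simp_all add: field_def input_list_def hd_drop_conv_nth automaton_code_def numeral_2_eq_2)

lemma set_edges_list:
  assumes "\<And>B. B \<in> set Bs \<Longrightarrow> finite (edges B)"
  shows "set (edges_list (input_list k A Bs)) = edges_of Bs"
proof -
  have len: "length (input_list k A Bs) - 2 = length Bs" by (simp add: input_list_def)
  let ?d = "\<lambda>j c. ((j, fst (prod_decode c)), prod_decode (fst (prod_decode (snd (prod_decode c)))),
      (j, snd (prod_decode (snd (prod_decode c)))))"
  have f: "set_decode (field 1 (hd (drop (j + 2) (input_list k A Bs)))) = edge_code prod_encode ` edges (Bs ! j)"
    if "j < length Bs" for j
    unfolding field_automaton_code(1)[OF that] using assms that by simp
  have d: "?d j (edge_code prod_encode e) = ((j, source e), label e, (j, target e))" for j :: nat and e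
    by (simp add: edge_code_def)
  have "set (edges_list (input_list k A Bs)) =
      (\<Union>j \<in> {..<length Bs}. ?d j ` set_decode (field 1 (hd (drop (j + 2) (input_list k A Bs)))))"
    unfolding edges_list_def len
    by (simp add: set_filter_set_decode atLeast0LessThan del: set_filter)
  also have "\<dots> = (\<Union>j \<in> {..<length Bs}. ?d j ` edge_code prod_encode ` edges (Bs ! j))"
    by (intro SUP_cong refl) (simp only: f lessThan_iff)
  also have "\<dots> = edges_of Bs"
    unfolding image_image d by (force simp: edges_of_def image_iff)
  finally show ?thesis .
qed

lemma set_initial_list:
  assumes "\<And>B. B \<in> set Bs \<Longrightarrow> finite (initial B)"
  shows "set (initial_list (input_list k A Bs)) = initial_of Bs"
proof -
  have len: "length (input_list k A Bs) - 2 = length Bs" by (simp add: input_list_def)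
  have f: "set_decode (field 2 (hd (drop (j + 2) (input_list k A Bs)))) = initial (Bs ! j)"
    if "j < length Bs" for j
    unfolding field_automaton_code(2)[OF that] using assms that by simp
  have "set (initial_list (input_list k A Bs)) =
      (\<Union>j \<in> {..<length Bs}. Pair j ` set_decode (field 2 (hd (drop (j + 2) (input_list k A Bs)))))"
    unfolding initial_list_def len
    by (simp add: set_filter_set_decode atLeast0LessThan del: set_filter)
  also have "\<dots> = (\<Union>j \<in> {..<length Bs}. Pair j ` initial (Bs ! j))"
    by (intro SUP_cong refl) (simp only: f lessThan_iff)
  also have "\<dots> = initial_of Bs" by (auto simp: initial_of_def)
  finally show ?thesis .
qed

section \<open>The decision procedure\<close>

lemma semidec_certify_infinite:
  "semidec (\<lambda>inp. \<exists>E D n T v w F a b. certify_infinite (edges_list inp) (initial_list inp) E D n F T v w a b)"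
  unfolding certify_infinite_def diagonal_edges_def pullback_fixed_def by (intro semidec_ex decidable_imp_semidec comp_rules)

lemma semidec_certify_finite:
  "semidec (\<lambda>inp. \<exists>E D ds n m F. certify_finite (edges_list inp) (initial_list inp) E D ds n m F)"
  unfolding certify_finite_def diagonal_edges_def dead_edges_def by (intro semidec_ex decidable_imp_semidec comp_rules)

lemma finite_components_mono:
  assumes "\<And>x y. rel E I x y \<Longrightarrow> rel E' I x y" "finite (component (rel E' I) x)"
  shows "finite (component (rel E I) x)"
proof -
  have "symclp (rel E I) \<le> symclp (rel E' I)" using assms(1) by (auto simp: symclp_def)
  then have "component (rel E I) x \<subseteq> component (rel E' I) x"
    using rtranclp_mono by blast
  then show ?thesis using assms(2) finite_subset by blast
qed

theorem corollary4p2: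
  "\<exists>algorithm :: recf. \<forall>k (A :: (nat, nat) buchi) (Bs :: (nat, nat \<times> nat) buchi list).
     valid_input k A Bs \<longrightarrow>
       evals algorithm [input_code k A Bs]
         (if \<exists>x \<in> language A. infinite (orbit (inverse_semigroup (accepted_relation ` set Bs)) x)
          then 1 else 0)"
proof -
  let ?P = "\<lambda>inp. \<exists>E D n T v w F a b. certify_infinite (edges_list inp) (initial_list inp) E D n F T v w a b"
  let ?Q = "\<lambda>inp. \<exists>E D ds n m F. certify_finite (edges_list inp) (initial_list inp) E D ds n m F"
  obtain r where r: "\<And>inp. (?P inp \<longleftrightarrow> \<not> ?Q inp) \<Longrightarrow> evals r [encode inp] (if ?P inp then 1 else 0)"
    using semidec_algorithm[OF semidec_certify_infinite semidec_certify_finite] by blast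
  have "evals r [input_code k A Bs]
      (if \<exists>x \<in> language A. infinite (orbit (inverse_semigroup (accepted_relation ` set Bs)) x) then 1 else 0)"
    if valid: "valid_input k A Bs" for k A Bs
  proof -
    define inp where "inp = input_list k A Bs"
    let ?R = "\<lambda>E. rel E (initial_of Bs)"
    have B: "safety_automaton ({..<k} \<times> {..<k}) B" "bounded_automaton B"
      "partial_bijection (language A) (accepted_relation B)" if "B \<in> set Bs" for B
      using valid that by (auto simp: valid_input_def)
    have fin: "finite (edges B)" "finite (initial B)" if "B \<in> set Bs" for B
    proof -
      have "finite (states B)" "edges B \<subseteq> states B \<times> ({..<k} \<times> {..<k}) \<times> states B" "initial B \<subseteq> states B"
        using B(1)[OF that] by (auto simp: safety_automaton_def buchi_automaton_def)
      then show "finite (edges B)" "finite (initial B)"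
        by (auto intro: finite_subset)
    qed
    have E: "set (edges_list inp) = edges_of Bs" and I: "set (initial_list inp) = initial_of Bs"
      unfolding inp_def using set_edges_list set_initial_list fin by blast+
    have finE: "finite (edges_of Bs)" "finite (initial_of Bs)"
      unfolding E[symmetric] I[symmetric] by simp_all
    have inf: "\<exists>x. infinite (component (?R (edges_of Bs)) x)" if P: "?P inp"
    proof -
      obtain E' D n T v w \<phi> u u' where *: "set E' \<subseteq> edges_of Bs" "diagonal_transducer (set E') (set D)"
        "transducer.expanding (set E') (initial_of Bs) (set D) n (length v) \<phi> (set T) v w u u'"
        using P unfolding certify_infinite_iff E I by blast
      interpret finite_transducer "set E'" "initial_of Bs" "set D"
        by (rule finite_transducer.intro[OF *(2)]) (simp add: finite_transducer_axioms_def)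
      obtain x where "infinite (component (?R (set E')) x)" using expanding_infinite[OF *(3)] by blast
      moreover have "rel (set E') (initial_of Bs) x y \<Longrightarrow> rel (edges_of Bs) (initial_of Bs) x y" for x y
        using run_mono[OF _ *(1)] unfolding rel_def by blast
      ultimately show ?thesis using finite_components_mono by blast
    qed
    have nof: "finite (component (?R (edges_of Bs)) x)" if Q: "?Q inp" for x
    proof -
      obtain E' D ds n m \<phi> where *: "edges_of Bs \<subseteq> set E' \<union> set ds" "dead_list (edges_of Bs) ds"
        "diagonal_transducer (set E') (set D)" "transducer.nonexpanding (set E') (initial_of Bs) (set D) n m \<phi>"
        using Q unfolding certify_finite_iff E I by blast
      interpret finite_transducer "set E'" "initial_of Bs" "set D"
        by (rule finite_transducer.intro[OF *(3)]) (simp add: finite_transducer_axioms_def)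
      have "rel (edges_of Bs) (initial_of Bs) x y \<Longrightarrow> rel (set E') (initial_of Bs) x y" for x y
        using run_not_dead[OF _ *(2,1)] unfolding rel_def by blast
      then show ?thesis using nonexpanding_finite[OF *(4)] finite_components_mono by blast
    qed
    \<comment> \<open>Completeness: the sets provided by the dichotomy are finite and can be
      replaced by lists.\<close>
    have "?P inp \<or> ?Q inp"
    proof -
      have "\<forall>B \<in> set Bs. bounded_automaton B" using B(2) by blast
      from dichotomy[OF this finE] obtain E' D ds where *: "E' \<subseteq> edges_of Bs" "edges_of Bs = E' \<union> set ds" "dead_list (edges_of Bs) ds"
        "finite D" "diagonal_transducer E' D"
        "(\<exists>n j \<phi> T v w u u'. transducer.expanding E' (initial_of Bs) D n j \<phi> T v w u u') \<or>
         (\<exists>n m \<phi>. transducer.nonexpanding E' (initial_of Bs) D n m \<phi>)"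
        by (elim exE conjE)
      obtain El Dl where l: "set El = E'" "set Dl = D"
        using finite_list[OF finite_subset[OF *(1) finE(1)]] finite_list[OF *(4)] by blast
      from *(6) show ?thesis
      proof
        assume "\<exists>n j \<phi> T v w u u'. transducer.expanding E' (initial_of Bs) D n j \<phi> T v w u u'"
        then obtain n j \<phi> T v w u u' where c: "transducer.expanding E' (initial_of Bs) D n j \<phi> T v w u u'" by blast
        then have "T \<subseteq> D" "j = length v" unfolding transducer.expanding_def transducer.pullback_def by blast+
        then obtain Tl where "set Tl = T" using finite_list[OF finite_subset[OF _ *(4)]] by blast
        with c \<open>j = length v\<close> have "transducer.expanding (set El) (set (initial_list inp)) (set Dl) n (length v) \<phi> (set Tl) v w u u'"
          by (simp add: l I)
        then have "\<exists>F a b. certify_infinite (edges_list inp) (initial_list inp) El Dl n F Tl v w a b"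
          unfolding certify_infinite_iff E using * l by blast
        then show ?thesis by blast
      next
        assume "\<exists>n m \<phi>. transducer.nonexpanding E' (initial_of Bs) D n m \<phi>"
        then obtain n m \<phi> where "transducer.nonexpanding (set El) (set (initial_list inp)) (set Dl) n m \<phi>"
          unfolding l I by blast
        then have "\<exists>F. certify_finite (edges_list inp) (initial_list inp) El Dl ds n m F"
          unfolding certify_finite_iff E using * l by blast
        then show ?thesis by blast
      qed
    qed
    \<comment> \<open>Soundness makes the two searches exclusive and completeness makes them
      exhaustive, which is the condition under which \<open>r\<close> is known to answer.\<close>
    have iff: "(p \<longleftrightarrow> \<not> q) \<and> (p \<longleftrightarrow> c)" if "p \<or> q" "p \<Longrightarrow> c" "q \<Longrightarrow> \<not> c" for p q c
      using that by blast
    have "\<not> (\<exists>x. infinite (component (?R (edges_of Bs)) x))" if "?Q inp"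
      using nof[OF that] by simp
    note iff = iff[OF \<open>?P inp \<or> ?Q inp\<close> inf this, THEN conjunct1] iff[OF \<open>?P inp \<or> ?Q inp\<close> inf this, THEN conjunct2]
    have "(\<exists>x \<in> language A. infinite (orbit (inverse_semigroup (accepted_relation ` set Bs)) x)) \<longleftrightarrow>
        (\<exists>x. infinite (component (?R (edges_of Bs)) x))"
      by (rule infinite_orbit_iff) (fact B)+
    also have "\<dots> \<longleftrightarrow> ?P inp" by (rule iff(2)[symmetric])
    finally have "(\<exists>x \<in> language A. infinite (orbit (inverse_semigroup (accepted_relation ` set Bs)) x)) \<longleftrightarrow> ?P inp" .
    then show ?thesis
      using r[OF iff(1)] unfolding inp_def encode_input_list by (simp only:)
  qed
  then show ?thesis by blast
qed

end
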